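(* For every $\varepsilon>0$ there is $d_0=d_0(\varepsilon)$ such that, for every $d\ge d_0$, \[ \lim_{n\to\infty}\mathbb{P}\left( \left|\log c(G(n,d/n))-\frac{\pi^2}{6d}\right|\le\frac{\varepsilon}{d} \right)=1. \] Equivalently, $c(G(n,d/n))=1+\frac{\pi^2}{6d}+o_d(d^{-1})$ with high probability.
   Context: For a finite graph $G=(V,E)$ with connected components $C_1,\dots,C_k$, fix a root $r_i\in C_i$ in each component and let \[ P_G=\{x\in\mathbb{R}^V: x(r_i)=0 \text{ for all } i,\ |x(u)-x(v)|\le 1 \text{ for all } uv\in E\} \] be the rooted Lipschitz polytope. The growth constant $c(G)>0$ is defined by $c(G)^{|V|-k}=\mathrm{Vol}(P_G)$ (the volume being taken in the $(|V|-k)$-dimensional coordinate space of non-root vertices; it is independent of the choice of roots). Equivalently, if $N_G(h)$ is the number of integer-valued functions $f$ on $V$ with $f(r_i)=0$ for all $i$ and $|f(u)-f(v)|\le h$ for all edges $uv$, then $c(G)^{|V|-k}=\lim_{h\to\infty}N_G(h)/h^{|V|-k}$. $G(n,d/n)$ is the Erdős–Rényi random graph on $[n]$ in which each pair is an edge independently with probability $d/n$. "With high probability" means with probability tending to $1$ as $n\to\infty$ for fixed $d$; $o_d(d^{-1})$ denotes a quantity which, after taking $n\to\infty$, is $o(d^{-1})$ as $d\to\infty$. *)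

theory Defs
  imports "HOL-Probability.Probability" "HOL-Library.Landau_Symbols"
begin

text \<open>
  A finite simple graph is a finite vertex set \<open>V\<close> together with a set \<open>E\<close> of
  two-element subsets of \<open>V\<close>.
\<close>

definition all_pairs :: "'a set \<Rightarrow> 'a set set" where
  "all_pairs V = {{u, v} | u v. u \<in> V \<and> v \<in> V \<and> u \<noteq> v}"

definition fin_graph :: "'a set \<Rightarrow> 'a set set \<Rightarrow> bool" where
  "fin_graph V E \<longleftrightarrow> finite V \<and> E \<subseteq> all_pairs V"

definition connected_rel :: "'a set \<Rightarrow> 'a set set \<Rightarrow> ('a \<times> 'a) set" where
  "connected_rel V E = {(u, v). u \<in> V \<and> v \<in> V \<and> (u, v) \<in> {(a, b). {a, b} \<in> E}\<^sup>*}"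

definition conn_components :: "'a set \<Rightarrow> 'a set set \<Rightarrow> 'a set set" where
  "conn_components V E = V // connected_rel V E"

definition is_root_set :: "'a set \<Rightarrow> 'a set set \<Rightarrow> 'a set \<Rightarrow> bool" where
  "is_root_set V E R \<longleftrightarrow> R \<subseteq> V \<and> (\<forall>C \<in> conn_components V E. \<exists>!r. r \<in> R \<inter> C)"

text \<open>
  Points of the space of real functions on \<open>V\<close> are functions that are
  \<open>undefined\<close> outside \<open>V\<close>, as in the carrier of a finite product measure.
\<close>

definition lipschitz_polytope :: "'a set \<Rightarrow> 'a set set \<Rightarrow> 'a set \<Rightarrow> ('a \<Rightarrow> real) set" where
  "lipschitz_polytope V E R =
     {x \<in> extensional V. (\<forall>r\<in>R. x r = 0) \<and>
        (\<forall>u\<in>V. \<forall>v\<in>V. {u, v} \<in> E \<longrightarrow> \<bar>x u - x v\<bar> \<le> 1)}"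

definition polytope_volume :: "'a set \<Rightarrow> 'a set set \<Rightarrow> 'a set \<Rightarrow> real" where
  "polytope_volume V E R =
     measure (\<Pi>\<^sub>M v \<in> V - R. lborel)
       ((\<lambda>x. restrict x (V - R)) ` lipschitz_polytope V E R)"

definition free_dim :: "'a set \<Rightarrow> 'a set set \<Rightarrow> nat" where
  "free_dim V E = card V - card (conn_components V E)"

text \<open>
  The roots are fixed by Hilbert choice. For an edgeless graph the exponent
  \<open>free_dim V E\<close> is \<open>0\<close> and the defining equation does not determine the growth
  constant; the formula below then yields \<open>1\<close>. The equation itself is lemma
  \<open>growth_constant_power\<close>.
\<close>

definition chosen_roots :: "'a set \<Rightarrow> 'a set set \<Rightarrow> 'a set" where
  "chosen_roots V E = (SOME R. is_root_set V E R)"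

definition growth_constant :: "'a set \<Rightarrow> 'a set set \<Rightarrow> real" where
  "growth_constant V E =
     polytope_volume V E (chosen_roots V E) powr (1 / real (free_dim V E))"

text \<open>
  The Erdos-Renyi random graph on the vertex set \<open>{1..n}\<close>, as a distribution on edge
  sets. Note that \<open>bernoulli_pmf\<close> clamps its parameter to the unit interval.
\<close>

definition gnp :: "nat \<Rightarrow> real \<Rightarrow> nat set set pmf" where
  "gnp n p = map_pmf (\<lambda>f. {e. f e}) (Pi_pmf (all_pairs {1..n}) False (\<lambda>_. bernoulli_pmf p))"

lemma finite_all_pairs: "finite V \<Longrightarrow> finite (all_pairs V)"
  by (rule finite_subset[of _ "Pow V"]) (auto simp: all_pairs_def)

lemma fin_graph_gnp:
  assumes "E \<in> set_pmf (gnp n p)"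
  shows "fin_graph {1..n} E"
proof -
  have "finite (all_pairs {1..n})" by (simp add: finite_all_pairs)
  then show ?thesis
    using assms set_Pi_pmf_subset[of "all_pairs {1..n}" False "\<lambda>_. bernoulli_pmf p"]
    by (auto simp: gnp_def fin_graph_def)
qed

lemma equiv_connected_rel: "equiv V (connected_rel V E)"
proof (rule equivI)
  show "refl_on V (connected_rel V E)"
    by (auto simp: connected_rel_def refl_on_def)
  have "sym ({(a, b). {a, b} \<in> E}\<^sup>*)"
    by (rule sym_rtrancl) (auto simp: sym_def insert_commute)
  then show "sym (connected_rel V E)"
    by (auto simp: connected_rel_def sym_def)
  show "trans (connected_rel V E)"
    by (auto simp: connected_rel_def trans_def)
qed (auto simp: connected_rel_def)

lemma ex_root_set: "\<exists>R. is_root_set V E R"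
proof -
  let ?r = "connected_rel V E"
  define f where "f C = (SOME v. v \<in> C)" for C :: "'a set"
  have f: "f C \<in> C" if "C \<in> V // ?r" for C
    using in_quotient_imp_non_empty[OF equiv_connected_rel that]
    unfolding f_def by (simp add: some_in_eq)
  have "is_root_set V E (f ` (V // ?r))"
    unfolding is_root_set_def conn_components_def
  proof (intro conjI ballI)
    show "f ` (V // ?r) \<subseteq> V"
      using f in_quotient_imp_subset[OF equiv_connected_rel] by blast
    fix C assume C: "C \<in> V // ?r"
    show "\<exists>!r. r \<in> f ` (V // ?r) \<inter> C"
    proof (rule ex1I[of _ "f C"])
      show "f C \<in> f ` (V // ?r) \<inter> C" using C f by blast
      fix r assume "r \<in> f ` (V // ?r) \<inter> C"
      then obtain D where D: "D \<in> V // ?r" "r = f D" "f D \<in> C" by blast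
      then have "C = D"
        using quotient_disj[OF equiv_connected_rel C D(1)] f[OF D(1)] by blast
      then show "r = f C" using D by simp
    qed
  qed
  then show ?thesis ..
qed

lemma is_root_set_chosen: "is_root_set V E (chosen_roots V E)"
  unfolding chosen_roots_def by (rule someI_ex[OF ex_root_set])

lemma card_root_set:
  assumes "finite V" "is_root_set V E R"
  shows "card R = card (conn_components V E)"
proof -
  let ?r = "connected_rel V E"
  have R: "R \<subseteq> V" and u: "\<And>C. C \<in> V // ?r \<Longrightarrow> \<exists>!r. r \<in> R \<inter> C"
    using assms(2) by (auto simp: is_root_set_def conn_components_def)
  have self: "v \<in> ?r `` {v}" if "v \<in> V" for v
    using that by (auto simp: connected_rel_def)
  have "bij_betw (\<lambda>v. ?r `` {v}) R (V // ?r)"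
  proof (rule bij_betwI')
    fix x y assume xy: "x \<in> R" "y \<in> R"
    show "(?r `` {x} = ?r `` {y}) = (x = y)"
    proof
      assume "?r `` {x} = ?r `` {y}"
      then have "x \<in> R \<inter> ?r `` {x}" "y \<in> R \<inter> ?r `` {x}"
        using xy R self[of x] self[of y] by auto
      then show "x = y"
        using u[of "?r `` {x}"] xy R by (auto simp: quotientI subset_iff)
    qed simp
  next
    fix x assume "x \<in> R" then show "?r `` {x} \<in> V // ?r"
      using R by (auto intro: quotientI)
  next
    fix C assume C: "C \<in> V // ?r"
    then obtain r where r: "r \<in> R" "r \<in> C" using u by blast
    then have "C = ?r `` {r}"
      using quotient_disj[OF equiv_connected_rel C quotientI[of r V ?r]] self R by blast
    then show "\<exists>x\<in>R. C = ?r `` {x}" using r by blast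
  qed
  then show ?thesis by (simp add: bij_betw_same_card conn_components_def)
qed

lemma card_non_roots:
  assumes "finite V" "is_root_set V E R"
  shows "card (V - R) = free_dim V E"
proof -
  have "R \<subseteq> V" using assms by (simp add: is_root_set_def)
  with assms show ?thesis
    by (simp add: card_Diff_subset finite_subset free_dim_def card_root_set)
qed

lemma projected_polytope:
  assumes "R \<subseteq> V"
  shows "(\<lambda>x. restrict x (V - R)) ` lipschitz_polytope V E R =
    {y \<in> space (\<Pi>\<^sub>M v \<in> V - R. (lborel :: real measure)). \<forall>u\<in>V. \<forall>v\<in>V. {u, v} \<in> E \<longrightarrow>
       \<bar>(if u \<in> R then 0 else y u) - (if v \<in> R then 0 else y v)\<bar> \<le> 1}"
    (is "?L = ?R")
proof (intro equalityI subsetI)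
  fix y assume "y \<in> ?L"
  then show "y \<in> ?R"
    by (fastforce simp: lipschitz_polytope_def space_PiM)
next
  fix y assume y: "y \<in> ?R"
  define x where "x v = (if v \<in> R then 0 else y v)" for v
  have ext: "y \<in> extensional (V - R)" using y by (auto simp: space_PiM PiE_def)
  have "x \<in> lipschitz_polytope V E R"
    using y ext assms unfolding lipschitz_polytope_def x_def extensional_def by auto
  moreover have "y = restrict x (V - R)"
    using ext by (auto simp: x_def fun_eq_iff extensional_def)
  ultimately show "y \<in> ?L" by blast
qed

lemma sets_projected_polytope:
  assumes "finite V" "R \<subseteq> V"
  shows "(\<lambda>x. restrict x (V - R)) ` lipschitz_polytope V E R
           \<in> sets (\<Pi>\<^sub>M v \<in> V - R. (lborel :: real measure))"
proof -
  have [measurable]: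
    "(\<lambda>y. if u \<in> R then 0 else y u) \<in> borel_measurable (\<Pi>\<^sub>M v \<in> V - R. (lborel :: real measure))"
    if "u \<in> V" for u
    using that by (cases "u \<in> R") (auto intro!: measurable_component_singleton[THEN measurable_compose])
  have "{y \<in> space (\<Pi>\<^sub>M v \<in> V - R. (lborel :: real measure)). {u, v} \<in> E \<longrightarrow>
       \<bar>(if u \<in> R then 0 else y u) - (if v \<in> R then 0 else y v)\<bar> \<le> 1}
       \<in> sets (\<Pi>\<^sub>M v \<in> V - R. (lborel :: real measure))" if [simp]: "u \<in> V" "v \<in> V" for u v
    by measurable
  then show ?thesis
    unfolding projected_polytope[OF assms(2)]
    using assms(1) by (intro sets.sets_Collect_finite_All) auto
qed

lemma
  assumes G: "fin_graph V E" and root: "is_root_set V E R"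
  shows emeasure_projected_polytope:
      "emeasure (\<Pi>\<^sub>M v \<in> V - R. lborel)
         ((\<lambda>x. restrict x (V - R)) ` lipschitz_polytope V E R) = ennreal (polytope_volume V E R)"
    and polytope_volume_ge_1: "polytope_volume V E R \<ge> 1"
proof -
  let ?M = "\<Pi>\<^sub>M v \<in> V - R. (lborel :: real measure)"
  let ?P = "(\<lambda>x. restrict x (V - R)) ` lipschitz_polytope V E R"
  interpret product_sigma_finite "\<lambda>_. (lborel :: real measure)" ..
  have R: "R \<subseteq> V" using root by (simp add: is_root_set_def)
  have V: "finite V" and E: "E \<subseteq> all_pairs V" using G by (auto simp: fin_graph_def)
  have fin: "finite (V - R)" using V by simp
  note P = sets_projected_polytope[OF V R, of E]
  have bd: "\<exists>N. \<forall>x\<in>lipschitz_polytope V E R. \<bar>x u - x v\<bar> \<le> N"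
    if "(u, v) \<in> connected_rel V E" for u v
  proof -
    have "(u, v) \<in> {(a, b). {a, b} \<in> E}\<^sup>*"
      using that by (simp add: connected_rel_def)
    then show ?thesis
    proof induction
      case base then show ?case by auto
    next
      case (step y z)
      then obtain N where N: "\<And>x. x \<in> lipschitz_polytope V E R \<Longrightarrow> \<bar>x u - x y\<bar> \<le> N" by blast
      have yz: "{y, z} \<in> E" "y \<in> V" "z \<in> V"
        using step(2) E by (auto simp: all_pairs_def doubleton_eq_iff)
      have "\<bar>x u - x z\<bar> \<le> N + 1" if x: "x \<in> lipschitz_polytope V E R" for x
      proof -
        have "\<bar>x y - x z\<bar> \<le> 1"
          using x yz by (auto simp: lipschitz_polytope_def)
        then show ?thesis using N[OF x] by linarith
      qed
      then show ?case by blast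
    qed
  qed
  have "\<exists>N. \<forall>x\<in>lipschitz_polytope V E R. \<bar>x v\<bar> \<le> N" if v: "v \<in> V" for v
  proof -
    have "connected_rel V E `` {v} \<in> conn_components V E"
      using v by (auto simp: conn_components_def intro: quotientI)
    then have "\<exists>!r. r \<in> R \<inter> connected_rel V E `` {v}"
      by (rule bspec[OF conjunct2[OF root[unfolded is_root_set_def]]])
    then obtain r where r: "r \<in> R" "(v, r) \<in> connected_rel V E"
      by (auto elim!: ex1E)
    obtain N where "\<forall>x\<in>lipschitz_polytope V E R. \<bar>x v - x r\<bar> \<le> N"
      using bd[OF r(2)] by blast
    then show ?thesis using r(1) by (intro exI[of _ N]) (auto simp: lipschitz_polytope_def)
  qed
  then obtain N where N: "\<And>v x. v \<in> V \<Longrightarrow> x \<in> lipschitz_polytope V E R \<Longrightarrow> \<bar>x v\<bar> \<le> N v"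
    by metis
  have "?P \<subseteq> (\<Pi>\<^sub>E v\<in>V - R. {- N v..N v})"
  proof (intro image_subsetI restrict_PiE_iff[THEN iffD2] ballI)
    fix x v assume "x \<in> lipschitz_polytope V E R" "v \<in> V - R"
    then show "x v \<in> {- N v..N v}" using N[of v x] by (simp add: abs_le_iff)
  qed
  then have "emeasure ?M ?P \<le> emeasure ?M (\<Pi>\<^sub>E v\<in>V - R. {- N v..N v})"
    using fin by (intro emeasure_mono sets_PiM_I_finite) auto
  also have "\<dots> = (\<Prod>v\<in>V - R. emeasure lborel {- N v..N v})"
    using fin by (intro emeasure_PiM) auto
  also have "\<dots> < \<infinity>"
    by (auto simp: ennreal_prod_eq_top emeasure_lborel_Icc_eq less_top[symmetric] simp del: prod_ennreal)
  finally have finite: "emeasure ?M ?P < \<infinity>" .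
  then show eq: "emeasure ?M ?P = ennreal (polytope_volume V E R)"
    unfolding polytope_volume_def by (simp add: emeasure_eq_ennreal_measure)
  have "1 = (\<Prod>v\<in>V - R. emeasure lborel {- (1/2) .. 1/2 :: real})"
    by simp
  also have "\<dots> = emeasure ?M (\<Pi>\<^sub>E v\<in>V - R. {- (1/2) .. 1/2})"
    using fin by (intro emeasure_PiM[symmetric]) auto
  also have "\<dots> \<le> emeasure ?M ?P"
  proof (rule emeasure_mono[OF _ P])
    have "\<bar>(if u \<in> R then 0 else y u) - (if v \<in> R then 0 else y v)\<bar> \<le> 1"
      if y: "y \<in> (\<Pi>\<^sub>E v\<in>V - R. {- (1/2) .. 1/2 :: real})" and uv: "u \<in> V" "v \<in> V" for y u v
    proof -
      have "\<bar>if w \<in> R then 0 else y w\<bar> \<le> 1/2" if "w \<in> V" for w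
        using PiE_mem[OF y, of w] that by (auto simp: abs_le_iff)
      from this[OF uv(1)] this[OF uv(2)] show ?thesis by linarith
    qed
    moreover have "y \<in> space ?M" if "y \<in> (\<Pi>\<^sub>E v\<in>V - R. {- (1/2) .. 1/2 :: real})" for y
      using that by (auto simp: space_PiM PiE_def)
    ultimately show "(\<Pi>\<^sub>E v\<in>V - R. {- (1/2) .. 1/2}) \<subseteq> ?P"
      unfolding projected_polytope[OF R] by blast
  qed
  finally show "polytope_volume V E R \<ge> 1"
    unfolding eq by simp
qed

lemma growth_constant_power:
  assumes "fin_graph V E"
  shows "growth_constant V E > 0"
    and "growth_constant V E ^ free_dim V E = polytope_volume V E (chosen_roots V E)"
proof -
  let ?R = "chosen_roots V E"
  note root = is_root_set_chosen[of V E]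
  have ge: "polytope_volume V E ?R \<ge> 1"
    using polytope_volume_ge_1[OF assms root] .
  then show "growth_constant V E > 0" by (simp add: growth_constant_def)
  show "growth_constant V E ^ free_dim V E = polytope_volume V E ?R"
  proof (cases "free_dim V E = 0")
    case True
    have "finite V" using assms by (simp add: fin_graph_def)
    with True have VR: "V - ?R = {}"
      using card_non_roots[OF _ root] by simp
    interpret product_sigma_finite "\<lambda>_. (lborel :: real measure)" ..
    let ?P = "(\<lambda>x. restrict x (V - ?R)) ` lipschitz_polytope V E ?R"
    have "?P \<subseteq> {\<lambda>_. undefined}" unfolding VR by auto
    moreover have "?P \<noteq> {}"
    proof
      assume "?P = {}"
      then have "polytope_volume V E ?R = 0"
        unfolding polytope_volume_def by (simp only: measure_empty)
      with ge show False by simp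
    qed
    ultimately have P: "?P = {\<lambda>_. undefined}" by (simp only: subset_singleton_iff) simp
    have "polytope_volume V E ?R = 1"
      unfolding polytope_volume_def P unfolding VR by (simp add: measure_def)
    then show ?thesis using True by simp
  next
    case False
    then show ?thesis using ge
      by (simp add: growth_constant_def powr_power)
  qed
qed

end

theory Submission
  imports Defs "HOL-Real_Asymp.Real_Asymp"
begin

text \<open>
  Upper bound: a first moment computation. With high probability every Lipschitz function on the
  graph has all but few values within distance \<open>1\<close> of its median; the exceptional vertices are
  integrated out along edges at a cost of a factor \<open>2\<close> each, and each of them misses a positive
  fraction of the other vertices, which has probability \<open>exp (- c d)\<close>. For values in a window of
  length \<open>2\<close>, write each value as a fractional part plus \<open>0\<close> or \<open>1\<close>: the pairs that must not be
  edges are the inversions of a \<open>0\<close>-\<open>1\<close> word, so the expected volume is a sum of Gaussian binomial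
  coefficients at \<open>q = 1 - d / n\<close>, which is at most a polynomial factor times
  \<open>\<Prod>i. 1 / (1 - q ^ i) \<le> exp (pi\<^sup>2 n / (6 d))\<close>.

  Lower bound: deterministic, in terms of the number of edges only. Put the roots at \<open>0\<close> and split
  \<open>[-1, 1]\<close> into a lower half and a number of upper bins. A labelling of the vertices by bins
  determines a box inside the polytope (a lower vertex has to stay above the highest bin of its
  neighbours, minus \<open>1\<close>), boxes of different labellings are disjoint, and Jensen's inequality for an
  explicit product distribution on labellings bounds the sum of their volumes from below.
\<close>

section \<open>Inversions and Gaussian binomial coefficients\<close>

text \<open>The constant arises in both halves as the integral of -ln (1 - exp (- t)) over t > 0,
  that is, as the sum of 1 / k^2: above from the logarithm of the product of the factors 1 - q ^ i,
  below as a Riemann sum whose step \<open>h\<close> is \<open>d\<close> times the probability of a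
  bin. Because the lower bound sees only the number of edges, no concentration of the volume is
  needed and Markov's inequality suffices on the other side. The first moment has two obstacles.
  Pinned roots distinguish some vertices, and the median can lie far from 0. Roots are therefore
  released to [0, 1], which costs nothing in volume, and the median vertex and its value are summed
  over; this costs polynomial factors only. Moreover the exponent in the growth constant is the
  number of non-roots, not \<open>n\<close>, so the number of components must be small compared with
  \<open>n\<close>. The order of choices matters: the density \<open>\<delta>\<close> that makes
  exceptional vertices rare is fixed before \<open>d\<close>. Its failure has probability at most (4
  exp (- d \<delta>^2)) ^ n, and exceptional vertices contribute at most 4 exp (- d / 8) per vertex
  to the exponent, far below the scale 1 / d.\<close>

definition qpoch :: "real \<Rightarrow> nat \<Rightarrow> real" where
  "qpoch q n = (\<Prod>i=1..n. (1 - q ^ i))"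

lemma qpoch_0 [simp]: "qpoch q 0 = 1"
  and qpoch_Suc: "qpoch q (Suc n) = qpoch q n * (1 - q ^ Suc n)"
  by (simp_all add: qpoch_def)

lemma qpoch_pos:
  assumes "0 \<le> q" "q < 1"
  shows "0 < qpoch q n"
  unfolding qpoch_def
proof (rule prod_pos)
  fix i assume "i \<in> {1..n}"
  then show "0 < 1 - q ^ i" using assms power_less_one_iff[of q i] by simp
qed

lemma qpoch_antimono:
  assumes "0 \<le> q" "q < 1" "m \<le> n"
  shows "qpoch q n \<le> qpoch q m"
  using assms(3)
proof (induction n rule: dec_induct)
  case (step n)
  have "qpoch q (Suc n) \<le> qpoch q n * 1"
    unfolding qpoch_Suc using assms qpoch_pos[of q n] by (intro mult_left_mono) auto
  then show ?case using step by simp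
qed simp

text \<open>The word has letter 1 on \<open>S\<close> and is read in the order of the values
  \<open>y\<close>. When these lie in an interval of length 1, the pairs are exactly those along
  which \<open>y\<close> plus the indicator of \<open>S\<close> increases by more than 1.\<close>

definition inversions :: "('a \<Rightarrow> real) \<Rightarrow> 'a set \<Rightarrow> 'a set \<Rightarrow> ('a \<times> 'a) set" where
  "inversions y V S = {(i, j). i \<in> V - S \<and> j \<in> S \<and> y i < y j}"

lemma inversions_subset: "S \<subseteq> V \<Longrightarrow> inversions y V S \<subseteq> V \<times> V"
  by (auto simp: inversions_def)

text \<open>The quotient is the Gaussian binomial coefficient, \<open>qpoch q n\<close> being the
  q-Pochhammer symbol (q; q)_n. Deleting the element \<open>m\<close> of largest value gives the
  q-Pascal recurrence: outside \<open>S\<close> it takes part in no inversion, inside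
  \<open>S\<close> it forms one with each element of \<open>V - S\<close>.\<close>

lemma inversion_generating_function:
  assumes "finite V" "inj_on y V" "0 \<le> q" "q < 1" "k \<le> card V"
  shows "(\<Sum>S | S \<subseteq> V \<and> card S = k. q ^ card (inversions y V S)) =
           qpoch q (card V) / (qpoch q k * qpoch q (card V - k))"
  using assms(1,2,5)
proof (induction "card V" arbitrary: V k)
  case 0
  then have "{S. S \<subseteq> V \<and> card S = k} = {{}}" "V = {}" by auto
  then show ?case using 0 by (simp add: inversions_def)
next
  case (Suc n)
  then have ne: "y ` V \<noteq> {}" and fy: "finite (y ` V)" by auto
  from Max_in[OF fy ne] obtain m where m: "m \<in> V" "y m = Max (y ` V)" by auto
  define W where "W = V - {m}"
  have W: "finite W" "m \<notin> W" "V = insert m W" "card W = n" "inj_on y W"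
    using Suc m by (auto simp: W_def intro: inj_on_subset)
  have less: "y i < y m" if "i \<in> W" for i
  proof -
    have "y i \<le> y m" using m that fy by (auto simp: W_def)
    moreover have "y i \<noteq> y m" using Suc(4) m that by (auto simp: W_def inj_on_def)
    ultimately show ?thesis by simp
  qed
  define F where "F k = (\<Sum>S | S \<subseteq> W \<and> card S = k. q ^ card (inversions y W S))" for k
  have F: "F k = qpoch q n / (qpoch q k * qpoch q (n - k))" if "k \<le> n" for k
    unfolding F_def using Suc(1)[of W k] W that by simp
  have notin: "inversions y V S = inversions y W S" if "S \<subseteq> W" for S
    using that W less by (auto simp: inversions_def) (metis less not_less_iff_gr_or_eq subsetD)
  have isin: "card (inversions y V (insert m S)) = card (inversions y W S) + (n - card S)"
    if "S \<subseteq> W" for S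
  proof -
    have "inversions y V (insert m S) = inversions y W S \<union> (\<lambda>i. (i, m)) ` (W - S)"
      using that W less by (auto simp: inversions_def)
    moreover have "inversions y W S \<inter> (\<lambda>i. (i, m)) ` (W - S) = {}"
      using that W by (auto simp: inversions_def)
    moreover have "finite (inversions y W S)"
      using inversions_subset[OF that] W by (meson finite_SigmaI finite_subset)
    moreover have "card ((\<lambda>i. (i, m)) ` (W - S)) = n - card S"
      using W that by (subst card_image) (auto simp: inj_on_def card_Diff_subset finite_subset)
    ultimately show ?thesis using W by (simp add: card_Un_disjoint)
  qed
  have split: "{S. S \<subseteq> V \<and> card S = k} =
      {S. S \<subseteq> W \<and> card S = k} \<union> insert m ` {S. S \<subseteq> W \<and> Suc (card S) = k}" (is "?L = ?A \<union> ?B")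
  proof (intro equalityI subsetI)
    fix S assume S: "S \<in> ?L"
    show "S \<in> ?A \<union> ?B"
    proof (cases "m \<in> S")
      case True
      have "finite S" using S Suc by (auto intro: finite_subset)
      then have "Suc (card (S - {m})) = k" using S True by (metis (mono_tags) card_Suc_Diff1 mem_Collect_eq)
      then have "insert m (S - {m}) \<in> ?B" using S W by (intro imageI) auto
      then show ?thesis using True by (simp add: insert_absorb)
    next
      case False then show ?thesis using S W by auto
    qed
  next
    fix S assume "S \<in> ?A \<union> ?B"
    then show "S \<in> ?L"
    proof
      assume "S \<in> ?B"
      then obtain T where T: "T \<subseteq> W" "Suc (card T) = k" "S = insert m T" by auto
      then have "card S = k" using W by (auto simp: finite_subset card_insert_if)
      then show ?thesis using T W by auto
    qed (use W in auto)
  qed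
  have inj: "inj_on (insert m) {S. S \<subseteq> W \<and> Suc (card S) = k}"
    using W by (intro inj_onI) (metis (mono_tags, lifting) insert_ident mem_Collect_eq subsetD)
  have tot: "(\<Sum>S | S \<subseteq> V \<and> card S = k. q ^ card (inversions y V S)) =
      F k + (\<Sum>S | S \<subseteq> W \<and> Suc (card S) = k. q ^ card (inversions y W S) * q ^ (n - card S))"
  proof -
    have "(\<Sum>S | S \<subseteq> V \<and> card S = k. q ^ card (inversions y V S)) =
       (\<Sum>S\<in>{S. S \<subseteq> W \<and> card S = k}. q ^ card (inversions y V S)) +
       (\<Sum>S\<in>insert m ` {S. S \<subseteq> W \<and> Suc (card S) = k}. q ^ card (inversions y V S))"
      unfolding split using W by (intro sum.union_disjoint) auto
    also have "(\<Sum>S\<in>insert m ` {S. S \<subseteq> W \<and> Suc (card S) = k}. q ^ card (inversions y V S)) =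
       (\<Sum>S | S \<subseteq> W \<and> Suc (card S) = k. q ^ card (inversions y W S) * q ^ (n - card S))"
      by (subst sum.reindex[OF inj]) (auto simp: isin power_add intro!: sum.cong)
    finally show ?thesis by (simp add: F_def notin)
  qed
  note pos = qpoch_pos[OF assms(3,4)]
  show ?case
  proof (cases k)
    case 0
    then show ?thesis using tot F[of 0] pos[of n] pos[of "card V"] Suc by simp
  next
    case (Suc l)
    have "(\<Sum>S | S \<subseteq> W \<and> Suc (card S) = k. q ^ card (inversions y W S) * q ^ (n - card S)) =
        F l * q ^ (n - l)"
      unfolding F_def sum_distrib_right using Suc by (intro sum.cong) auto
    with tot have tot': "(\<Sum>S | S \<subseteq> V \<and> card S = k. q ^ card (inversions y V S)) = F k + F l * q ^ (n - l)"
      by simp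
    have l: "l \<le> n" using Suc Suc.prems Suc.hyps by simp
    show ?thesis
    proof (cases "l = n")
      \<comment> \<open>Here \<open>k = n + 1\<close>: no subset of \<open>W\<close> is that large,
        and the induction hypothesis does not cover \<open>F k\<close>.\<close>
      case True
      have "card S \<noteq> k" if "S \<subseteq> W" for S
        using card_mono[OF W(1) that] W(4) Suc True by linarith
      then have "{S. S \<subseteq> W \<and> card S = k} = {}" by blast
      then have "F k = 0" by (simp only: F_def sum.empty)
      then show ?thesis using tot' True F[of l] Suc pos[of n] pos[of "Suc n"] \<open>Suc n = card V\<close>[symmetric]
        by simp
    next
      case False
      define r where "r = n - k"
      have n: "n = Suc l + r" and nl: "n - l = Suc r" "card V - k = Suc r"
        using False l Suc \<open>Suc n = card V\<close> by (auto simp: r_def)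
      have "F k + F l * q ^ (n - l) =
          qpoch q n / (qpoch q l * qpoch q r * (1 - q ^ k)) +
          qpoch q n / (qpoch q l * (qpoch q r * (1 - q ^ Suc r))) * q ^ Suc r"
      proof -
        have "k \<le> n" "n - k = r" using n Suc by auto
        then have Fk: "F k = qpoch q n / (qpoch q k * qpoch q r)" using F[of k] by simp
        have Fl: "F l = qpoch q n / (qpoch q l * qpoch q (Suc r))" using F[OF l] nl by simp
        show ?thesis unfolding Fk Fl nl unfolding Suc qpoch_Suc by (simp only: mult_ac)
      qed
      \<comment> \<open>The numerators combine as (1 - q^(r+1)) + q^(r+1) (1 - q^k) = 1 - q^(n+1),
        because k + r = n.\<close>
      also have "\<dots> = qpoch q n * (1 - q ^ Suc n) / (qpoch q l * (1 - q ^ k) * (qpoch q r * (1 - q ^ Suc r)))"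
      proof -
        have a: "1 - q ^ k \<noteq> 0" "1 - q ^ Suc r \<noteq> 0"
          using assms(3,4) Suc power_less_one_iff[of q k] power_less_one_iff[of q "Suc r"] by auto
        have e: "q ^ Suc n = q ^ k * q ^ Suc r" using n Suc by (simp add: power_add)
        show ?thesis unfolding e using a pos[of l] pos[of r]
          by (simp add: divide_simps) (simp add: algebra_simps)
      qed
      also have "\<dots> = qpoch q (card V) / (qpoch q k * qpoch q (card V - k))"
        unfolding nl unfolding \<open>Suc n = card V\<close>[symmetric] Suc qpoch_Suc by (simp only: mult_ac)
      finally show ?thesis using tot' by simp
    qed
  qed
qed

text \<open>There are \<open>card V + 1\<close> Gaussian binomials. As \<open>qpoch\<close>
  decreases in its index, one factor of each denominator absorbs the numerator and the other is at
  least \<open>qpoch q (card V)\<close>. The linear factor lost is negligible on the exponential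
  scale.\<close>

lemma sum_inversions_le:
  assumes "finite V" "inj_on y V" "0 \<le> q" "q < 1"
  shows "(\<Sum>S\<in>Pow V. q ^ card (inversions y V S)) \<le> (real (card V) + 1) / qpoch q (card V)"
proof -
  note pos = qpoch_pos[OF assms(3,4)]
  have "(\<Sum>S\<in>Pow V. q ^ card (inversions y V S)) =
      (\<Sum>k\<in>{..card V}. \<Sum>S\<in>{S \<in> Pow V. card S = k}. q ^ card (inversions y V S))"
    using assms(1) by (intro sum.group[symmetric]) (auto simp: card_mono)
  also have "\<dots> = (\<Sum>k\<in>{..card V}. qpoch q (card V) / (qpoch q k * qpoch q (card V - k)))"
    using inversion_generating_function[OF assms] by (intro sum.cong) (auto simp: conj_commute Pow_def)
  also have "\<dots> \<le> (\<Sum>k\<in>{..card V}. 1 / qpoch q (card V))"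
  proof (rule sum_mono)
    fix k assume k: "k \<in> {..card V}"
    have "qpoch q (card V) / (qpoch q k * qpoch q (card V - k)) \<le>
        qpoch q (card V - k) / (qpoch q k * qpoch q (card V - k))"
      using pos[of k] pos[of "card V - k"] qpoch_antimono[OF assms(3,4), of "card V - k" "card V"]
      by (intro divide_right_mono) auto
    also have "\<dots> = 1 / qpoch q k" using pos[of "card V - k"] by simp
    also have "\<dots> \<le> 1 / qpoch q (card V)"
      using pos[of k] pos[of "card V"] qpoch_antimono[OF assms(3,4), of k "card V"] k
      by (intro divide_left_mono) auto
    finally show "qpoch q (card V) / (qpoch q k * qpoch q (card V - k)) \<le> 1 / qpoch q (card V)" .
  qed
  also have "\<dots> = (real (card V) + 1) / qpoch q (card V)" by (simp add: add.commute)
  finally show ?thesis .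
qed

section \<open>The q-Pochhammer product and the constant pi^2 / 6\<close>

lemma minus_ln_sums:
  fixes x :: real
  assumes "0 \<le> x" "x < 1"
  shows "(\<lambda>n. x ^ n / real n) sums - ln (1 - x)"
proof -
  have "(\<lambda>n. - ((- (- x)) ^ n) / real n) sums ln (1 + - x)"
    using assms by (intro ln_series') auto
  from sums_minus[OF this] show ?thesis by simp
qed

text \<open>Started at index 0, where the term is 1 / 0 = 0, so as to be compared term by term with
  the logarithmic series of \<open>minus_ln_sums\<close>.\<close>

lemma inverse_squares_sums_0: "(\<lambda>n. 1 / (real n)\<^sup>2) sums (pi\<^sup>2 / 6)"
proof -
  have "(\<lambda>n. 1 / (real (Suc n))\<^sup>2) sums (pi\<^sup>2 / 6 - 1 / (real 0)\<^sup>2)"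
    using inverse_squares_sums by (simp add: add.commute)
  then show ?thesis using sums_Suc_iff[of "\<lambda>n. 1 / (real n)\<^sup>2"] by fastforce
qed

text \<open>Expand every -ln (1 - q^i) and sum over \<open>i\<close> first: for the power
  \<open>k\<close> the geometric series is at most 1 / (exp (k b) - 1), hence at most 1 / (k b).
  What remains is the sum of 1 / (b k^2), uniformly in \<open>n\<close>.\<close>

lemma qpoch_exp_ge:
  assumes "0 < b"
  shows "exp (- (pi\<^sup>2 / (6 * b))) \<le> qpoch (exp (- b)) n"
proof -
  define q where "q = exp (- b)"
  have q: "0 < q" "q < 1" using assms by (auto simp: q_def)
  have qi: "0 \<le> q ^ i" "q ^ i < 1" if "i \<in> {1..n}" for i
    using that q power_less_one_iff[of q i] by auto
  have s: "(\<lambda>k. \<Sum>i=1..n. (q ^ i) ^ k / real k) sums (\<Sum>i=1..n. - ln (1 - q ^ i))"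
    using qi by (intro sums_sum minus_ln_sums) auto
  have t: "(\<lambda>k. (1 / b) * (1 / (real k)\<^sup>2)) sums ((1 / b) * (pi\<^sup>2 / 6))"
    by (intro sums_mult inverse_squares_sums_0)
  have "(\<Sum>i=1..n. - ln (1 - q ^ i)) \<le> (1 / b) * (pi\<^sup>2 / 6)"
  proof (rule sums_le[OF _ s t])
    fix k :: nat
    show "(\<Sum>i=1..n. (q ^ i) ^ k / real k) \<le> (1 / b) * (1 / (real k)\<^sup>2)"
    proof (cases "k = 0")
      case False
      define z where "z = q ^ k"
      have z: "0 < z" "z < 1" using q False power_less_one_iff[of q k] by (auto simp: z_def)
      have zi: "1 / z = exp (k * b)" by (simp add: z_def q_def exp_minus exp_of_nat_mult power_inverse inverse_eq_divide power_one_over)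
      have "(\<Sum>i=1..n. z ^ i) = z * (1 - z ^ n) / (1 - z)"
        using z by (subst sum_gp) (auto simp: algebra_simps)
      also have "\<dots> \<le> z * 1 / (1 - z)" using z by (intro divide_right_mono mult_left_mono) auto
      also have "\<dots> = 1 / (1 / z - 1)" using z by (simp add: field_simps)
      also have "\<dots> \<le> 1 / (k * b)"
      proof (rule divide_left_mono)
        show le: "real k * b \<le> 1 / z - 1"
          unfolding zi using exp_ge_add_one_self[of "k * b"] by linarith
        show "0 < (1 / z - 1) * (real k * b)"
          using z assms False by (intro mult_pos_pos) (auto simp: field_simps)
      qed simp
      finally have "(\<Sum>i=1..n. z ^ i) / k \<le> (1 / (k * b)) / k" by (rule divide_right_mono) simp
      then show ?thesis
        by (simp add: z_def sum_divide_distrib power2_eq_square mult_ac flip: power_mult)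
    qed simp
  qed
  moreover have "ln (qpoch q n) = (\<Sum>i=1..n. ln (1 - q ^ i))"
    unfolding qpoch_def using qi by (intro ln_prod finite_atLeastAtMost) (metis diff_gt_0_iff_gt less_irrefl)
  ultimately have "- (pi\<^sup>2 / (6 * b)) \<le> ln (qpoch q n)" by (simp add: sum_negf)
  then show ?thesis using qpoch_pos[of q n] q unfolding q_def by (simp add: ln_ge_iff)
qed

text \<open>The right-hand side is a Riemann sum of -ln (1 - exp (- t)) over t > 0. The choices are
  made in the order \<open>K\<close> (length of the logarithmic series), \<open>h\<close>,
  \<open>J\<close>, so that every limit passes through a finite sum; the terms of the series that
  are dropped are nonnegative.\<close>

lemma ex_step_size_ge:
  assumes "\<epsilon> > 0"
  shows "\<exists>h J. 0 < h \<and> pi\<^sup>2 / 6 - \<epsilon> \<le> h * (\<Sum>j=1..J. - ln (1 - exp (- h) ^ j))"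
proof -
  have "(\<lambda>K. \<Sum>k<K. 1 / (real k)\<^sup>2) \<longlonglongrightarrow> pi\<^sup>2 / 6"
    using inverse_squares_sums_0 by (simp add: sums_def)
  then have "eventually (\<lambda>K. pi\<^sup>2 / 6 - \<epsilon> < (\<Sum>k<K. 1 / (real k)\<^sup>2)) sequentially"
    using assms by (intro order_tendstoD) auto
  then obtain K where K: "pi\<^sup>2 / 6 - \<epsilon> < (\<Sum>k<K. 1 / (real k)\<^sup>2)"
    by (auto simp: eventually_sequentially)
  have "((\<lambda>h. h / (exp (real k * h) - 1) / real k) \<longlongrightarrow> 1 / (real k)\<^sup>2) (at_right 0)" for k
  proof (cases "k = 0")
    case False
    then have k: "real k > 0" by simp
    have "((\<lambda>h. (exp (real k * h) - 1) / h) \<longlongrightarrow> real k) (at 0)"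
    proof -
      have "((\<lambda>h. exp (real k * h)) has_real_derivative real k) (at 0)"
        by (auto intro!: derivative_eq_intros)
      from DERIV_D[OF this] show ?thesis by simp
    qed
    then have "((\<lambda>h. (exp (real k * h) - 1) / h) \<longlongrightarrow> real k) (at_right 0)"
      by (rule filterlim_mono) (auto simp: at_within_le_at)
    then have "((\<lambda>h. inverse ((exp (real k * h) - 1) / h) / real k) \<longlongrightarrow> inverse (real k) / real k) (at_right 0)"
      using k by (intro tendsto_intros) auto
    then show ?thesis by (simp add: power2_eq_square divide_simps)
  qed simp
  then have "((\<lambda>h. \<Sum>k<K. h / (exp (real k * h) - 1) / real k) \<longlongrightarrow> (\<Sum>k<K. 1 / (real k)\<^sup>2)) (at_right 0)"
    by (intro tendsto_sum)
  then have "eventually (\<lambda>h. pi\<^sup>2 / 6 - \<epsilon> < (\<Sum>k<K. h / (exp (real k * h) - 1) / real k)) (at_right 0)"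
    using K by (rule order_tendstoD)
  moreover have "eventually (\<lambda>h::real. 0 < h) (at_right 0)"
    by (rule eventually_at_right_less)
  ultimately have "eventually (\<lambda>h. pi\<^sup>2 / 6 - \<epsilon> < (\<Sum>k<K. h / (exp (real k * h) - 1) / real k) \<and> 0 < h) (at_right 0)"
    by (rule eventually_conj)
  then obtain h where h: "0 < h" "pi\<^sup>2 / 6 - \<epsilon> < (\<Sum>k<K. h / (exp (real k * h) - 1) / real k)"
    using eventually_happens[of _ "at_right (0::real)"] by auto
  define q where "q = exp (- h)"
  have q: "0 < q" "q < 1" using h by (auto simp: q_def)
  have "(\<lambda>J. \<Sum>j=1..J. (q ^ j) ^ k / real k) \<longlonglongrightarrow> 1 / (exp (real k * h) - 1) / real k" for k
  proof (cases "k = 0")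
    case False
    define z where "z = q ^ k"
    have z: "0 < z" "z < 1" using q False power_less_one_iff[of q k] by (auto simp: z_def)
    have zi: "exp (real k * h) = 1 / z" by (simp add: z_def q_def exp_minus exp_of_nat_mult power_inverse inverse_eq_divide power_one_over)
    have "(\<Sum>j=1..J. (q ^ j) ^ k / real k) = z * (1 - z ^ J) / (1 - z) / real k" for J
    proof -
      have "(\<Sum>j=1..J. z ^ j) = z * (1 - z ^ J) / (1 - z)"
        using z by (subst sum_gp) (auto simp: algebra_simps)
      moreover have "(\<Sum>j=1..J. (q ^ j) ^ k / real k) = (\<Sum>j=1..J. z ^ j) / real k"
        by (simp add: z_def sum_divide_distrib mult.commute flip: power_mult)
      ultimately show ?thesis by simp
    qed
    moreover have "(\<lambda>J. z * (1 - z ^ J) / (1 - z) / real k) \<longlonglongrightarrow> z * (1 - 0) / (1 - z) / real k"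
      using z False by (intro tendsto_intros LIMSEQ_power_zero) auto
    moreover have "z * (1 - 0) / (1 - z) / real k = 1 / (exp (real k * h) - 1) / real k"
      unfolding zi using z by (simp add: field_simps)
    ultimately show ?thesis by simp
  qed simp
  then have "(\<lambda>J. h * (\<Sum>k<K. \<Sum>j=1..J. (q ^ j) ^ k / real k)) \<longlonglongrightarrow>
     h * (\<Sum>k<K. 1 / (exp (real k * h) - 1) / real k)"
    by (intro tendsto_intros)
  moreover have "h * (\<Sum>k<K. 1 / (exp (real k * h) - 1) / real k) > pi\<^sup>2 / 6 - \<epsilon>"
    using h(2) by (simp add: sum_distrib_left)
  ultimately have "eventually (\<lambda>J. pi\<^sup>2 / 6 - \<epsilon> < h * (\<Sum>k<K. \<Sum>j=1..J. (q ^ j) ^ k / real k)) sequentially"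
    by (rule order_tendstoD)
  then obtain J where J: "pi\<^sup>2 / 6 - \<epsilon> < h * (\<Sum>k<K. \<Sum>j=1..J. (q ^ j) ^ k / real k)"
    by (auto simp: eventually_sequentially)
  have "(\<Sum>k<K. \<Sum>j=1..J. (q ^ j) ^ k / real k) = (\<Sum>j=1..J. \<Sum>k<K. (q ^ j) ^ k / real k)"
    by (rule sum.swap)
  also have "\<dots> \<le> (\<Sum>j=1..J. - ln (1 - q ^ j))"
  proof (rule sum_mono)
    fix j assume "j \<in> {1..J}"
    then have "0 \<le> q ^ j" "q ^ j < 1" using q power_less_one_iff[of q j] by auto
    from minus_ln_sums[OF this] this(1) show "(\<Sum>k<K. (q ^ j) ^ k / real k) \<le> - ln (1 - q ^ j)"
      unfolding sums_iff by (metis (no_types, lifting) divide_nonneg_nonneg of_nat_0_le_iff sum_le_suminf finite_lessThan zero_le_power)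
  qed
  finally have "h * (\<Sum>k<K. \<Sum>j=1..J. (q ^ j) ^ k / real k) \<le> h * (\<Sum>j=1..J. - ln (1 - q ^ j))"
    using h by (intro mult_left_mono) auto
  with J h(1) show ?thesis unfolding q_def by (intro exI[of _ h] exI[of _ J]) linarith
qed

section \<open>Lower bound for the volume\<close>

text \<open>Jensen's inequality from the tangent at the mean \<open>m\<close>: exp (g - m) is at
  least 1 + (g - m), which averages to 1.\<close>

lemma exp_weighted_mean_le:
  fixes w g :: "'a \<Rightarrow> real"
  assumes "\<And>t. t \<in> T \<Longrightarrow> 0 \<le> w t" "(\<Sum>t\<in>T. w t) = 1"
  shows "exp (\<Sum>t\<in>T. w t * g t) \<le> (\<Sum>t\<in>T. w t * exp (g t))"
proof -
  define m where "m = (\<Sum>t\<in>T. w t * g t)"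
  have "exp m = exp m * (\<Sum>t\<in>T. w t * (1 + (g t - m)))"
  proof -
    have "(\<Sum>t\<in>T. w t * (1 + (g t - m))) = (\<Sum>t\<in>T. w t) + m - (\<Sum>t\<in>T. w t) * m"
      unfolding sum_distrib_right by (simp add: algebra_simps sum.distrib sum_subtractf) (simp add: m_def mult.commute)
    then show ?thesis using assms(2) by simp
  qed
  also have "\<dots> = (\<Sum>t\<in>T. w t * (exp m * (1 + (g t - m))))"
    by (simp add: sum_distrib_left mult_ac)
  also have "\<dots> \<le> (\<Sum>t\<in>T. w t * (exp m * exp (g t - m)))"
    using assms(1) by (intro sum_mono mult_left_mono) auto
  also have "\<dots> = (\<Sum>t\<in>T. w t * exp (g t))" by (simp flip: exp_add)
  finally show ?thesis unfolding m_def .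
qed

lemma sum_atMost_Suc_labels:
  fixes f :: "nat \<Rightarrow> real"
  shows "(\<Sum>c\<le>Suc J. f c) = f 0 + (\<Sum>c=1..J. f c) + f (Suc J)"
proof -
  have "{..Suc J} = insert 0 (insert (Suc J) {1..J})" by auto
  then show ?thesis by simp
qed

text \<open>Each bin \<open>j\<close> carries probability \<open>h / d\<close>, and a vertex of degree about \<open>d\<close> has no neighbour
  in the top \<open>j\<close> bins with probability about \<open>exp (- j h)\<close>. The widths \<open>om j / d\<close> are such that the
  highest bin among its neighbours then ends at \<open>1/2\<close> on average, so that only the entropy of the
  bins contributes. Label \<open>0\<close> stands for the lower half and label \<open>J + 1\<close> for the bulk of the upper
  half.\<close>

lemma lipschitz_volume_lower_bound:
  fixes F :: "'a set" and E :: "'a set set" and d h :: real and J :: nat and om :: "nat \<Rightarrow> real"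
  assumes fin: "finite F" and noloop: "\<And>v. {v} \<notin> E" and h: "0 < h" and d: "0 < d"
    and om: "\<And>j. om j = h / (1 - exp (- h) ^ j)"
    and C: "C = 2 * (\<Sum>j=1..J. om j)" and Cd: "2 * C \<le> d"
  defines "dg \<equiv> \<lambda>v. card {u \<in> F. {u, v} \<in> E}"
  shows "ennreal (exp (\<Sum>v\<in>F. (h * (\<Sum>j=1..J. - ln (1 - exp (- h) ^ j)) + real J * h
             - (\<Sum>j=1..J. om j * (1 - (1 - real j * h / d) ^ dg v))) / d - (C / d)\<^sup>2))
         \<le> emeasure (\<Pi>\<^sub>M v\<in>F. lborel) {y \<in> space (\<Pi>\<^sub>M v\<in>F. (lborel :: real measure)).
             (\<forall>u\<in>F. \<forall>v\<in>F. {u, v} \<in> E \<longrightarrow> \<bar>y u - y v\<bar> \<le> 1) \<and> (\<forall>u\<in>F. \<bar>y u\<bar> \<le> 1)}"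
    (is "_ \<le> emeasure ?M ?X")
proof -
  interpret product_sigma_finite "\<lambda>_::'a. (lborel :: real measure)" ..
  define q where "q = exp (- h)"
  have q: "0 < q" "q < 1" using h by (auto simp: q_def)
  have qj: "0 < q ^ j" "q ^ j < 1" if "1 \<le> j" for j
    using that q power_less_one_iff[of q j] by auto
  have om_pos: "h \<le> om j" "0 < om j" if "1 \<le> j" for j
  proof -
    have "h / 1 \<le> h / (1 - q ^ j)" using qj[OF that] h by (intro divide_left_mono) auto
    then show "h \<le> om j" by (simp add: om q_def)
    then show "0 < om j" using h by simp
  qed
  define SO where "SO = (\<Sum>j=1..J. om j)"
  have Jh: "real J * h \<le> SO"
    using sum_mono[of "{1..J}" "\<lambda>_. h" om] om_pos by (simp add: SO_def)
  have SOd: "SO / d \<le> 1 / 4" using Cd C d by (simp add: SO_def field_simps)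
  have Jhd: "real J * h / d \<le> 1 / 4"
    using SOd Jh d by (meson divide_right_mono less_imp_le order_trans)
  have Jhd0: "0 \<le> real J * h / d" using h d by simp
  \<comment> \<open>Bins are numbered from the top: bin \<open>c\<close> in 1..J is (b c, b (c -
    1)], of width \<open>om c / d\<close>, and the bulk is (0, b J].\<close>
  define b where "b j = (if j = Suc J then 0 else 1/2 - real J * h / d + (\<Sum>i\<in>{j<..J}. om i) / d)" for j
  \<comment> \<open>The bulk has probability equal to its width, so it contributes no logarithm. The
    lower half has probability 1/2, the length of a lower interval whose constraint \<open>M\<close>
    equals 1/2.\<close>
  define P where "P c = (if c = 0 then 1/2 else if c = Suc J then 1/2 - real J * h / d else h / d)" for c
  have P0: "0 < P c" for c using Jhd h d by (auto simp: P_def)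
  have Psum: "(\<Sum>c\<le>Suc J. P c) = 1"
    unfolding sum_atMost_Suc_labels by (simp add: P_def)
  define T where "T = (\<Pi>\<^sub>E v\<in>F. {..Suc J})"
  have finT: "finite T" unfolding T_def using fin by (intro finite_PiE) auto
  define w where "w \<tau> = (\<Prod>v\<in>F. P (\<tau> v))" for \<tau> :: "'a \<Rightarrow> nat"
  have w0: "0 \<le> w \<tau>" for \<tau> unfolding w_def using P0 by (intro prod_nonneg) (auto intro: less_imp_le)
  have wprod: "(\<Sum>\<tau>\<in>T. w \<tau> * (\<Prod>v\<in>F. \<phi> v (\<tau> v))) = (\<Prod>v\<in>F. \<Sum>c\<le>Suc J. P c * \<phi> v c)"
    for \<phi> :: "'a \<Rightarrow> nat \<Rightarrow> real"
    unfolding T_def w_def prod.distrib[symmetric] using fin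
    by (subst prod_sum_PiE) auto
  have wsum: "(\<Sum>\<tau>\<in>T. w \<tau>) = 1"
    using wprod[of "\<lambda>_ _. 1"] Psum by simp
  define Nb where "Nb v = {u \<in> F. {u, v} \<in> E}" for v
  have Nb: "finite (Nb v)" "Nb v \<subseteq> F" "v \<notin> Nb v" "card (Nb v) = dg v" for v
    using fin noloop by (auto simp: Nb_def dg_def)
  define ind :: "'a \<Rightarrow> nat \<Rightarrow> ('a \<Rightarrow> nat) \<Rightarrow> real"
    where "ind v j \<tau> = (if \<exists>u\<in>Nb v. 1 \<le> \<tau> u \<and> \<tau> u \<le> j then 1 else 0)" for v j \<tau>
  have ind01: "0 \<le> ind v j \<tau>" "ind v j \<tau> \<le> 1" for v j \<tau> by (auto simp: ind_def)
  \<comment> \<open>Summing widths, this is the upper end of the highest bin among 1..J that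
    contains a neighbour of \<open>v\<close>, and \<open>b J\<close> if there is none. Being linear
    in the indicators, it has an explicit expectation.\<close>
  define M where "M v \<tau> = 1/2 - real J * h / d + (\<Sum>j=1..J. om j * ind v j \<tau>) / d" for v \<tau>
  have Msum: "0 \<le> (\<Sum>j=1..J. om j * ind v j \<tau>)" "(\<Sum>j=1..J. om j * ind v j \<tau>) \<le> SO" for v \<tau>
    unfolding SO_def using om_pos ind01
    by (auto intro!: sum_nonneg sum_mono mult_nonneg_nonneg mult_left_le simp: less_imp_le)
  have Mle: "M v \<tau> \<le> 3/4" "1/4 \<le> M v \<tau>" for v \<tau>
  proof -
    have "(\<Sum>j=1..J. om j * ind v j \<tau>) / d \<le> SO / d" "0 \<le> (\<Sum>j=1..J. om j * ind v j \<tau>) / d"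
      using Msum[of v \<tau>] d by (auto intro!: divide_right_mono)
    then show "M v \<tau> \<le> 3/4" "1/4 \<le> M v \<tau>" using SOd Jhd Jhd0 unfolding M_def by linarith+
  qed
  define lo where "lo v \<tau> = (if \<tau> v = 0 then M v \<tau> - 1 else b (\<tau> v))" for v :: 'a and \<tau>
  define hi where "hi v \<tau> = (if \<tau> v = 0 then 0 else b (\<tau> v - 1))" for v :: 'a and \<tau>
  define Box where "Box \<tau> = (\<Pi>\<^sub>E v\<in>F. {lo v \<tau> <.. hi v \<tau>})" for \<tau>
  have bstep: "b (c - 1) - b c = om c / d" if "c \<in> {1..J}" for c
  proof -
    have "{c - 1<..J} = insert c {c<..J}" using that by auto
    moreover have "c - 1 \<noteq> Suc J" "c \<noteq> Suc J" using that by auto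
    ultimately show ?thesis by (simp add: b_def add_divide_distrib)
  qed
  have bJ: "b J = 1/2 - real J * h / d" "b (Suc J) = 0" by (simp_all add: b_def)
  have b_le: "b (Suc c) \<le> b c" if "c \<le> J" for c
  proof (cases "c = J")
    case True then show ?thesis unfolding True bJ using Jhd by linarith
  next
    case False
    then have "b c - b (Suc c) = om (Suc c) / d" using bstep[of "Suc c"] that by simp
    then show ?thesis using om_pos[of "Suc c"] d by (smt (verit) divide_pos_pos le_add1 plus_1_eq_Suc)
  qed
  have b_mono: "b k \<le> b c" if "c \<le> k" "k \<le> Suc J" for c k
    using that
  proof (induction k rule: dec_induct)
    case (step k) then show ?case using b_le[of k] by simp
  qed simp
  have b0: "b 0 \<le> 3/4"
  proof -
    have "{0<..J} = {1..J}" by auto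
    then have "b 0 = 1/2 - real J * h / d + SO / d" by (simp add: b_def SO_def)
    then show ?thesis using SOd Jhd0 by linarith
  qed
  have b_nonneg: "0 \<le> b c" if "c \<le> Suc J" for c using b_mono[OF that] bJ by simp
  have b_M: "b (\<tau> u - 1) \<le> M v \<tau>" if "u \<in> Nb v" "\<tau> u \<noteq> 0" "\<tau> u \<le> Suc J" for u v \<tau>
  proof (cases "\<tau> u = Suc J")
    case True then show ?thesis using bJ Msum(1)[of v \<tau>] d by (simp add: M_def)
  next
    case False
    have "(\<Sum>i\<in>{\<tau> u - 1<..J}. om i) = (\<Sum>i\<in>{\<tau> u - 1<..J}. om i * ind v i \<tau>)"
      using that by (intro sum.cong) (auto simp: ind_def)
    also have "\<dots> \<le> (\<Sum>j=1..J. om j * ind v j \<tau>)"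
      using om_pos ind01 by (intro sum_mono2) (auto intro!: mult_nonneg_nonneg simp: less_imp_le)
    finally show ?thesis using False that d by (auto simp: b_def M_def divide_right_mono)
  qed
  have TJ: "\<tau> v \<le> Suc J" if "\<tau> \<in> T" "v \<in> F" for \<tau> v using that by (auto simp: T_def)
  have sub: "Box \<tau> \<subseteq> ?X" if \<tau>: "\<tau> \<in> T" for \<tau>
  proof
    fix y assume y: "y \<in> Box \<tau>"
    then have I: "lo v \<tau> < y v" "y v \<le> hi v \<tau>" if "v \<in> F" for v
      using that by (auto simp: Box_def)
    have low: "-1 < y v \<and> y v \<le> 0" if "v \<in> F" "\<tau> v = 0" for v
      using I[OF that(1)] that Mle(2)[of v \<tau>] by (auto simp: lo_def hi_def)
    have up: "0 < y v \<and> y v \<le> 3/4" if "v \<in> F" "\<tau> v \<noteq> 0" for v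
    proof -
      have "b (\<tau> v - 1) \<le> b 0" using TJ[OF \<tau> that(1)] by (intro b_mono) auto
      then show ?thesis
        using I[OF that(1)] that b_nonneg[OF TJ[OF \<tau> that(1)]] b0 by (auto simp: lo_def hi_def)
    qed
    have mix: "y u - y v \<le> 1" if "u \<in> F" "v \<in> F" "{u, v} \<in> E" "\<tau> u \<noteq> 0" "\<tau> v = 0" for u v
    proof -
      have "y u \<le> M v \<tau>"
        using I(2)[OF that(1)] b_M[of u v \<tau>] that TJ[OF \<tau> that(1)] by (auto simp: hi_def Nb_def)
      then show ?thesis using I(1)[OF that(2)] that by (simp add: lo_def)
    qed
    have "\<bar>y u - y v\<bar> \<le> 1" if uv: "u \<in> F" "v \<in> F" "{u, v} \<in> E" for u v
    proof (cases "\<tau> u = 0")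
      case True
      show ?thesis
      proof (cases "\<tau> v = 0")
        case True
        then show ?thesis using low[OF uv(1) \<open>\<tau> u = 0\<close>] low[OF uv(2) True] by linarith
      next
        case False
        then have "y v - y u \<le> 1" using mix[of v u] True uv by (simp add: insert_commute)
        then show ?thesis using low[OF uv(1) True] up[OF uv(2) False] by linarith
      qed
    next
      case False
      show ?thesis
      proof (cases "\<tau> v = 0")
        case True
        then have "y u - y v \<le> 1" using mix[of u v] False uv by simp
        then show ?thesis using low[OF uv(2) True] up[OF uv(1) False] by linarith
      next
        case F: False
        then show ?thesis using up[OF uv(1) False] up[OF uv(2) F] by linarith
      qed
    qed
    moreover have "\<bar>y u\<bar> \<le> 1" if "u \<in> F" for u
      using low[OF that] up[OF that] by (cases "\<tau> u = 0") auto
    moreover have "y \<in> space ?M" using y by (auto simp: Box_def space_PiM PiE_def)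
    ultimately show "y \<in> ?X" by blast
  qed
  have same: "\<tau> v = \<tau>' v"
    if t: "\<tau> \<in> T" "\<tau>' \<in> T" "v \<in> F" "y \<in> Box \<tau>" "y \<in> Box \<tau>'" "\<tau> v \<le> \<tau>' v" for \<tau> \<tau>' v y
  proof (rule ccontr)
    assume ne: "\<tau> v \<noteq> \<tau>' v"
    have I: "lo v \<tau> < y v" "y v \<le> hi v \<tau>" "lo v \<tau>' < y v" "y v \<le> hi v \<tau>'"
      using t by (auto simp: Box_def)
    have J': "\<tau> v \<le> Suc J" "\<tau>' v \<le> Suc J" using t TJ by auto
    show False
    proof (cases "\<tau> v = 0")
      case True
      then have "y v \<le> 0" "b (\<tau>' v) < y v" using I ne by (auto simp: hi_def lo_def)
      then show False using b_nonneg[OF J'(2)] by simp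
    next
      case False
      then have "b (\<tau> v) < y v" "y v \<le> b (\<tau>' v - 1)" using I t(6) by (auto simp: hi_def lo_def)
      moreover have "b (\<tau>' v - 1) \<le> b (\<tau> v)" using t(6) ne J' by (intro b_mono) auto
      ultimately show False by simp
    qed
  qed
  have disj: "disjoint_family_on Box T"
  proof (unfold disjoint_family_on_def, intro ballI impI)
    fix \<tau> \<tau>' assume t: "\<tau> \<in> T" "\<tau>' \<in> T" "\<tau> \<noteq> \<tau>'"
    show "Box \<tau> \<inter> Box \<tau>' = {}"
    proof (rule ccontr)
      assume "Box \<tau> \<inter> Box \<tau>' \<noteq> {}"
      then obtain y where y: "y \<in> Box \<tau>" "y \<in> Box \<tau>'" by blast
      have "\<tau> v = \<tau>' v" if "v \<in> F" for v
        using same[OF t(1,2) that y] same[OF t(2,1) that y(2,1)] by (metis linear)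
      then have "\<tau> = \<tau>'" using t unfolding T_def by (intro PiE_ext) auto
      then show False using t by simp
    qed
  qed
  have sets_Box: "Box \<tau> \<in> sets ?M" for \<tau>
    unfolding Box_def using fin by (intro sets_PiM_I_finite) auto
  \<comment> \<open>A lower vertex has an interval of length 1 - M = (1 + z) / 2, so
    \<open>z\<close> measures the deviation from its probability 1/2.\<close>
  define z where "z v \<tau> = 1 - 2 * M v \<tau>" for v \<tau>
  have z_eq: "z v \<tau> = 2 * (real J * h - (\<Sum>j=1..J. om j * ind v j \<tau>)) / d" for v \<tau>
    using d by (simp add: z_def M_def field_simps)
  have z_abs: "\<bar>z v \<tau>\<bar> \<le> C / d" for v \<tau>
  proof -
    have "\<bar>real J * h - (\<Sum>j=1..J. om j * ind v j \<tau>)\<bar> \<le> SO"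
      using Msum[of v \<tau>] Jh h by (smt (verit) mult_nonneg_nonneg of_nat_0_le_iff)
    then show ?thesis unfolding z_eq C SO_def[symmetric] using d
      by (simp add: abs_mult divide_right_mono)
  qed
  \<comment> \<open>A lower bound for the logarithm of side length over probability. On lower
    vertices it uses ln (1 + z) \<ge> z - 2 z^2, valid since \<open>\<bar>z\<bar>\<close> is at most
    C / d \<le> 1/2.\<close>
  define g where "g v \<tau> = (if \<tau> v = 0 then z v \<tau> - 2 * (C / d)\<^sup>2 else if \<tau> v = Suc J then 0
      else - ln (1 - q ^ \<tau> v))" for v \<tau>
  have len: "P (\<tau> v) * exp (g v \<tau>) \<le> hi v \<tau> - lo v \<tau>" if "\<tau> \<in> T" "v \<in> F" for v \<tau>
  proof (cases "\<tau> v = 0")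
    case True
    have "C / d \<le> 1 / 2" using Cd d by (simp add: field_simps)
    then have z12: "\<bar>z v \<tau>\<bar> \<le> 1/2" using z_abs[of v \<tau>] by linarith
    have "(z v \<tau>)\<^sup>2 \<le> (C / d)\<^sup>2" using z_abs[of v \<tau>] by (metis abs_le_square_iff abs_ge_self order_trans)
    then have "z v \<tau> - 2 * (C / d)\<^sup>2 \<le> ln (1 + z v \<tau>)"
      using abs_ln_one_plus_x_minus_x_bound[OF z12] by linarith
    then have "exp (z v \<tau> - 2 * (C / d)\<^sup>2) \<le> 1 + z v \<tau>"
      using z12 by (subst ln_ge_iff[symmetric]) auto
    then show ?thesis using True by (simp add: g_def P_def hi_def lo_def z_def)
  next
    case False
    show ?thesis
    proof (cases "\<tau> v = Suc J")
      case True then show ?thesis by (simp add: g_def P_def hi_def lo_def bJ)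
    next
      case F: False
      then have c: "\<tau> v \<in> {1..J}" using False TJ[OF that] by auto
      then have "exp (- ln (1 - q ^ \<tau> v)) = 1 / (1 - q ^ \<tau> v)"
        using qj[of "\<tau> v"] by (simp add: exp_minus field_simps)
      then show ?thesis using False F bstep[OF c]
        by (simp add: g_def P_def hi_def lo_def om q_def mult.commute)
    qed
  qed
  \<comment> \<open>Each box has volume at least \<open>w \<tau>\<close> times the exponential of
    the sum of the \<open>g v \<tau>\<close>, so the total volume dominates an expectation under
    \<open>w\<close>.\<close>
  have "exp (\<Sum>\<tau>\<in>T. w \<tau> * (\<Sum>v\<in>F. g v \<tau>)) \<le> (\<Sum>\<tau>\<in>T. w \<tau> * exp (\<Sum>v\<in>F. g v \<tau>))"
    using w0 wsum by (intro exp_weighted_mean_le) auto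
  also have "\<dots> = (\<Sum>\<tau>\<in>T. \<Prod>v\<in>F. P (\<tau> v) * exp (g v \<tau>))"
    using fin by (simp add: w_def exp_sum prod.distrib)
  also have "\<dots> \<le> (\<Sum>\<tau>\<in>T. \<Prod>v\<in>F. hi v \<tau> - lo v \<tau>)"
    using len P0 by (intro sum_mono prod_mono) (auto simp: less_imp_le)
  finally have "ennreal (exp (\<Sum>\<tau>\<in>T. w \<tau> * (\<Sum>v\<in>F. g v \<tau>))) \<le> ennreal (\<Sum>\<tau>\<in>T. \<Prod>v\<in>F. hi v \<tau> - lo v \<tau>)"
    by (rule ennreal_leI)
  also have "\<dots> = (\<Sum>\<tau>\<in>T. emeasure ?M (Box \<tau>))"
  proof -
    have nn: "0 \<le> hi v \<tau> - lo v \<tau>" if "\<tau> \<in> T" "v \<in> F" for v \<tau>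
      using len[OF that] P0[of "\<tau> v"] by (smt (verit) exp_gt_zero mult_pos_pos)
    have "emeasure ?M (Box \<tau>) = ennreal (\<Prod>v\<in>F. hi v \<tau> - lo v \<tau>)" if "\<tau> \<in> T" for \<tau>
    proof -
      have "emeasure ?M (Box \<tau>) = (\<Prod>v\<in>F. emeasure lborel {lo v \<tau> <.. hi v \<tau>})"
        unfolding Box_def using fin by (intro emeasure_PiM) auto
      also have "\<dots> = (\<Prod>v\<in>F. ennreal (hi v \<tau> - lo v \<tau>))"
        using nn[OF that] by (intro prod.cong) auto
      also have "\<dots> = ennreal (\<Prod>v\<in>F. hi v \<tau> - lo v \<tau>)"
        using nn[OF that] by (intro prod_ennreal) auto
      finally show ?thesis .
    qed
    moreover have "ennreal (\<Sum>\<tau>\<in>T. \<Prod>v\<in>F. hi v \<tau> - lo v \<tau>) = (\<Sum>\<tau>\<in>T. ennreal (\<Prod>v\<in>F. hi v \<tau> - lo v \<tau>))"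
      using nn by (intro sum_ennreal[symmetric] prod_nonneg) auto
    ultimately show ?thesis by simp
  qed
  also have "\<dots> = emeasure ?M (\<Union>\<tau>\<in>T. Box \<tau>)"
    using finT disj sets_Box by (intro sum_emeasure) auto
  also have "\<dots> \<le> emeasure ?M ?X"
  proof (rule emeasure_mono)
    have "{y \<in> space ?M. \<bar>y u - y v\<bar> \<le> 1} \<in> sets ?M" if [simp]: "u \<in> F" "v \<in> F" for u v
      by measurable
    moreover have "{y \<in> space ?M. \<bar>y u\<bar> \<le> 1} \<in> sets ?M" if [simp]: "u \<in> F" for u
      by measurable
    ultimately show "?X \<in> sets ?M" using fin
      by (intro sets.sets_Collect_conj sets.sets_Collect_finite_All sets.sets_Collect_imp) auto
  qed (use sub in blast)
  finally have main: "ennreal (exp (\<Sum>\<tau>\<in>T. w \<tau> * (\<Sum>v\<in>F. g v \<tau>))) \<le> emeasure ?M ?X" .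
  have E1: "(\<Sum>\<tau>\<in>T. w \<tau> * f (\<tau> v)) = (\<Sum>c\<le>Suc J. P c * f c)" if v: "v \<in> F" for v f
  proof -
    have "(\<Sum>\<tau>\<in>T. w \<tau> * f (\<tau> v)) = (\<Sum>\<tau>\<in>T. w \<tau> * (\<Prod>u\<in>F. if u = v then f (\<tau> u) else 1))"
      using fin v by (simp add: prod.delta)
    also have "\<dots> = (\<Prod>u\<in>F. \<Sum>c\<le>Suc J. P c * (if u = v then f c else 1))"
      by (rule wprod[where \<phi> = "\<lambda>u c. if u = v then f c else 1"])
    also have "\<dots> = (\<Prod>u\<in>F. if u = v then (\<Sum>c\<le>Suc J. P c * f c) else 1)"
      using Psum by (intro prod.cong) auto
    finally show ?thesis using fin v by (simp add: prod.delta)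
  qed
  \<comment> \<open>Labels are independent under \<open>w\<close> and \<open>v\<close> is not its
    own neighbour, so the probability that \<open>v\<close> is lower and no neighbour lies in bins
    1..j is a product.\<close>
  have E2: "(\<Sum>\<tau>\<in>T. w \<tau> * (of_bool (\<tau> v = 0) * (1 - ind v j \<tau>))) = 1/2 * (1 - real j * h / d) ^ dg v"
    if v: "v \<in> F" and j: "j \<in> {1..J}" for v j
  proof -
    define \<phi> :: "'a \<Rightarrow> nat \<Rightarrow> real"
      where "\<phi> u c = (if u = v then of_bool (c = 0) else if u \<in> Nb v then of_bool (\<not> (1 \<le> c \<and> c \<le> j)) else 1)" for u c
    have prod_split: "(\<Prod>u\<in>F. f u) = f v * (\<Prod>u\<in>Nb v. f u)"
      if "\<And>u. u \<in> F \<Longrightarrow> u \<noteq> v \<Longrightarrow> u \<notin> Nb v \<Longrightarrow> f u = 1" for f :: "'a \<Rightarrow> real"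
    proof -
      have "(\<Prod>u\<in>F. f u) = (\<Prod>u\<in>insert v (Nb v). f u)"
        using fin v Nb that by (intro prod.mono_neutral_right) auto
      then show ?thesis using Nb by simp
    qed
    have "of_bool (\<tau> v = 0) * (1 - ind v j \<tau>) = (\<Prod>u\<in>F. \<phi> u (\<tau> u))" for \<tau>
    proof -
      have "(\<Prod>u\<in>F. \<phi> u (\<tau> u)) = \<phi> v (\<tau> v) * (\<Prod>u\<in>Nb v. \<phi> u (\<tau> u))"
        by (rule prod_split) (auto simp: \<phi>_def)
      also have "(\<Prod>u\<in>Nb v. \<phi> u (\<tau> u)) = 1 - ind v j \<tau>"
      proof (cases "\<exists>u\<in>Nb v. 1 \<le> \<tau> u \<and> \<tau> u \<le> j")
        case True
        then obtain u where u: "u \<in> Nb v" "1 \<le> \<tau> u \<and> \<tau> u \<le> j" by blast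
        then have "\<phi> u (\<tau> u) = 0" using Nb by (auto simp: \<phi>_def)
        then have "(\<Prod>u\<in>Nb v. \<phi> u (\<tau> u)) = 0" using u Nb by (intro prod_zero) auto
        then show ?thesis using True by (simp add: ind_def)
      next
        case False
        then have "(\<Prod>u\<in>Nb v. \<phi> u (\<tau> u)) = (\<Prod>u\<in>Nb v. 1)"
          using Nb by (intro prod.cong) (auto simp: \<phi>_def)
        then show ?thesis using False by (simp add: ind_def)
      qed
      finally show ?thesis by (simp add: \<phi>_def)
    qed
    then have "(\<Sum>\<tau>\<in>T. w \<tau> * (of_bool (\<tau> v = 0) * (1 - ind v j \<tau>))) = (\<Prod>u\<in>F. \<Sum>c\<le>Suc J. P c * \<phi> u c)"
      using wprod[of \<phi>] by simp
    also have "\<dots> = (\<Sum>c\<le>Suc J. P c * \<phi> v c) * (\<Prod>u\<in>Nb v. \<Sum>c\<le>Suc J. P c * \<phi> u c)"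
      using Psum by (intro prod_split) (simp add: \<phi>_def)
    also have "(\<Sum>c\<le>Suc J. P c * \<phi> v c) = 1/2"
      unfolding sum_atMost_Suc_labels by (simp add: \<phi>_def P_def)
    also have "(\<Prod>u\<in>Nb v. \<Sum>c\<le>Suc J. P c * \<phi> u c) = (\<Prod>u\<in>Nb v. 1 - real j * h / d)"
    proof (intro prod.cong refl)
      fix u assume u: "u \<in> Nb v"
      then have \<phi>: "\<phi> u c = 1 - of_bool (c \<in> {1..j})" for c using Nb by (auto simp: \<phi>_def)
      have "(\<Sum>c\<le>Suc J. P c * \<phi> u c) = 1 - (\<Sum>c\<le>Suc J. P c * of_bool (c \<in> {1..j}))"
        unfolding \<phi> right_diff_distrib sum_subtractf using Psum by simp
      also have "(\<Sum>c\<le>Suc J. P c * of_bool (c \<in> {1..j})) = (\<Sum>c\<in>{1..j}. P c)"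
        using j by (intro sum.mono_neutral_cong_right) auto
      also have "\<dots> = (\<Sum>c\<in>{1..j}. h / d)"
        using j by (intro sum.cong) (auto simp: P_def)
      finally show "(\<Sum>c\<le>Suc J. P c * \<phi> u c) = 1 - real j * h / d" by simp
    qed
    finally show ?thesis using Nb by simp
  qed
  have Eg: "(\<Sum>\<tau>\<in>T. w \<tau> * g v \<tau>) = (h * (\<Sum>j=1..J. - ln (1 - q ^ j)) + real J * h
             - (\<Sum>j=1..J. om j * (1 - (1 - real j * h / d) ^ dg v))) / d - (C / d)\<^sup>2"
    if v: "v \<in> F" for v
  proof -
    \<comment> \<open>Writing each indicator as 1 minus its complement moves a constant into
      \<open>a\<close>, which depends on the label of \<open>v\<close> alone; the complements are
      the events of \<open>E2\<close>.\<close>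
    define a where "a c = (if c = 0 then 2 * (real J * h - SO) / d - 2 * (C / d)\<^sup>2 else if c = Suc J then 0
      else - ln (1 - q ^ c))" for c
    have g: "g v \<tau> = a (\<tau> v) + (\<Sum>j=1..J. 2 * om j / d * (of_bool (\<tau> v = 0) * (1 - ind v j \<tau>)))" for \<tau>
    proof (cases "\<tau> v = 0")
      case True
      have "(\<Sum>j=1..J. 2 * om j / d * (1 - ind v j \<tau>)) = 2 * (SO - (\<Sum>j=1..J. om j * ind v j \<tau>)) / d"
        unfolding SO_def sum_subtractf[symmetric] sum_distrib_left sum_divide_distrib
        by (intro sum.cong) (auto simp: algebra_simps)
      then show ?thesis using True
        by (simp add: g_def a_def z_eq) (simp add: diff_divide_distrib right_diff_distrib)
    qed (simp add: g_def a_def)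
    have "(\<Sum>\<tau>\<in>T. w \<tau> * g v \<tau>) = (\<Sum>\<tau>\<in>T. w \<tau> * a (\<tau> v)) +
       (\<Sum>j=1..J. 2 * om j / d * (\<Sum>\<tau>\<in>T. w \<tau> * (of_bool (\<tau> v = 0) * (1 - ind v j \<tau>))))"
      unfolding g distrib_left sum.distrib sum_distrib_left
      by (subst (2) sum.swap) (simp add: mult_ac)
    also have "(\<Sum>\<tau>\<in>T. w \<tau> * a (\<tau> v)) = (\<Sum>c\<le>Suc J. P c * a c)" by (rule E1[OF v])
    also have "\<dots> = (real J * h - SO) / d - (C / d)\<^sup>2 + h / d * (\<Sum>j=1..J. - ln (1 - q ^ j))"
      unfolding sum_atMost_Suc_labels sum_distrib_left by (auto simp: P_def a_def intro!: sum.cong)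
    also have "(\<Sum>j=1..J. 2 * om j / d * (\<Sum>\<tau>\<in>T. w \<tau> * (of_bool (\<tau> v = 0) * (1 - ind v j \<tau>)))) =
       (\<Sum>j=1..J. om j / d * (1 - real j * h / d) ^ dg v)"
    proof (intro sum.cong refl)
      fix j assume "j \<in> {1..J}"
      note E2 = E2[OF v this]
      show "2 * om j / d * (\<Sum>\<tau>\<in>T. w \<tau> * (of_bool (\<tau> v = 0) * (1 - ind v j \<tau>))) =
          om j / d * (1 - real j * h / d) ^ dg v"
        unfolding E2 by simp
    qed
    also have "\<dots> = (SO - (\<Sum>j=1..J. om j * (1 - (1 - real j * h / d) ^ dg v))) / d"
      unfolding SO_def sum_subtractf[symmetric] sum_divide_distrib
      by (intro sum.cong) (auto simp: algebra_simps)
    finally show ?thesis by (simp add: diff_divide_distrib add_divide_distrib)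
  qed
  have "(\<Sum>\<tau>\<in>T. w \<tau> * (\<Sum>v\<in>F. g v \<tau>)) = (\<Sum>v\<in>F. \<Sum>\<tau>\<in>T. w \<tau> * g v \<tau>)"
    unfolding sum_distrib_left by (rule sum.swap)
  also have "\<dots> = (\<Sum>v\<in>F. (h * (\<Sum>j=1..J. - ln (1 - q ^ j)) + real J * h
             - (\<Sum>j=1..J. om j * (1 - (1 - real j * h / d) ^ dg v))) / d - (C / d)\<^sup>2)"
    using Eg by (rule sum.cong[OF refl])
  finally show ?thesis using main unfolding q_def by simp
qed

section \<open>Random graph estimates\<close>

lemma all_pairs_eq: "all_pairs V = {s. s \<subseteq> V \<and> card s = 2}"
  by (auto simp: all_pairs_def card_2_iff)

lemma card_all_pairs_le:
  assumes "finite V"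
  shows "real (card (all_pairs V)) \<le> (real (card V))\<^sup>2 / 2"
proof -
  have "card (all_pairs V) = card V choose 2"
    unfolding all_pairs_eq by (rule n_subsets[OF assms])
  then have "2 * card (all_pairs V) \<le> card V * (card V - 1)"
    unfolding choose_two by simp
  also have "\<dots> \<le> card V * card V" by simp
  finally have "real (2 * card (all_pairs V)) \<le> real (card V * card V)" by (rule of_nat_mono)
  then show ?thesis by (simp add: power2_eq_square)
qed

lemma finite_set_pmf_gnp: "finite (set_pmf (gnp n p))"
proof (rule finite_subset)
  show "set_pmf (gnp n p) \<subseteq> Pow (all_pairs {1..n})"
    using fin_graph_gnp by (auto simp: fin_graph_def)
qed (simp add: finite_all_pairs)

lemma prob_gnp_avoid:
  assumes "B \<subseteq> all_pairs {1..n}" "0 \<le> p" "p \<le> 1"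
  shows "measure_pmf.prob (gnp n p) {E. E \<inter> B = {}} = (1 - p) ^ card B"
proof -
  have fin: "finite (all_pairs {1..n})" by (simp add: finite_all_pairs)
  have "measure_pmf.prob (gnp n p) {E. E \<inter> B = {}} =
      measure_pmf.prob (Pi_pmf (all_pairs {1..n}) False (\<lambda>_. bernoulli_pmf p))
        (Pi (all_pairs {1..n}) (\<lambda>e. if e \<in> B then {False} else UNIV))"
    unfolding gnp_def measure_map_pmf using assms(1)
    by (intro arg_cong[where f = "measure _"]) (auto simp: Pi_def vimage_def split: if_splits)
  also have "\<dots> = (\<Prod>e\<in>all_pairs {1..n}. if e \<in> B then 1 - p else 1)"
    unfolding measure_Pi_pmf_Pi[OF fin] using assms
    by (intro prod.cong) (auto simp: measure_pmf_single)
  also have "\<dots> = (\<Prod>e\<in>B. 1 - p)"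
    using assms(1) fin by (intro prod.mono_neutral_cong_right) auto
  finally show ?thesis by simp
qed

text \<open>Intersecting with \<open>all_pairs\<close> makes the power a product over the
  independent coordinates for every outcome, not only on the support.\<close>

lemma expectation_gnp_power_card:
  assumes "0 \<le> p" "p \<le> 1" "0 \<le> z"
  shows "measure_pmf.expectation (gnp n p) (\<lambda>E. z ^ card (E \<inter> all_pairs {1..n})) =
           (1 - p + p * z) ^ card (all_pairs {1..n})"
proof -
  have fin: "finite (all_pairs {1..n})" by (simp add: finite_all_pairs)
  have "measure_pmf.expectation (gnp n p) (\<lambda>E. z ^ card (E \<inter> all_pairs {1..n})) =
    measure_pmf.expectation (Pi_pmf (all_pairs {1..n}) False (\<lambda>_. bernoulli_pmf p))
      (\<lambda>f. \<Prod>e\<in>all_pairs {1..n}. if f e then z else 1)"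
    unfolding gnp_def integral_map_pmf using fin
    by (intro Bochner_Integration.integral_cong refl)
       (auto simp: prod.If_cases Int_commute Collect_conj_eq)
  also have "\<dots> = (\<Prod>e\<in>all_pairs {1..n}. measure_pmf.expectation (bernoulli_pmf p) (\<lambda>b. if b then z else 1))"
    using fin assms by (intro expectation_prod_Pi_pmf) (auto intro!: integrable_measure_pmf_finite)
  also have "\<dots> = (\<Prod>e\<in>all_pairs {1..n}. 1 - p + p * z)"
    using assms by (intro prod.cong) (auto simp: mult.commute)
  finally show ?thesis by simp
qed

text \<open>Chernoff's bound with exponential base \<open>1 + \<delta>\<close>, the optimal one for
  a Poisson variable exceeding its mean by that factor. The rate is positive by
  \<open>ln_one_plus_times_gt\<close>.\<close>

lemma prob_gnp_card_ge:
  assumes "0 < d" "d \<le> real n" "0 < \<delta>"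
  shows "measure_pmf.prob (gnp n (d / real n)) {E. (1 + \<delta>) * d * real n / 2 \<le> real (card E)} \<le>
           exp (- (d * ((1 + \<delta>) * ln (1 + \<delta>) - \<delta>) / 2) * real n)"
proof -
  let ?M = "gnp n (d / real n)" and ?A = "all_pairs {1..n}"
  define c where "c = (1 + \<delta>) * d * real n / 2"
  have n: "0 < real n" using assms by linarith
  have p: "0 \<le> d / real n" "d / real n \<le> 1" using assms n by (auto simp: field_simps)
  have fs: "finite (set_pmf ?M)" by (rule finite_set_pmf_gnp)
  have "measure_pmf.prob ?M {E. c \<le> real (card E)} =
        measure_pmf.prob ?M {E. (1 + \<delta>) powr c \<le> (1 + \<delta>) ^ card (E \<inter> ?A)}"
  proof (rule measure_prob_cong_0)
    fix E assume E: "E \<in> {E. c \<le> real (card E)} - {E. (1 + \<delta>) powr c \<le> (1 + \<delta>) ^ card (E \<inter> ?A)}"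
    show "pmf ?M E = 0"
    proof (rule ccontr)
      assume "pmf ?M E \<noteq> 0"
      then have "E \<inter> ?A = E" using fin_graph_gnp[of E n] by (auto simp: set_pmf_iff fin_graph_def)
      then show False using E assms(3) powr_mono[of c "real (card E)" "1 + \<delta>"]
        by (simp add: powr_realpow)
    qed
  next
    fix E assume E: "E \<in> {E. (1 + \<delta>) powr c \<le> (1 + \<delta>) ^ card (E \<inter> ?A)} - {E. c \<le> real (card E)}"
    show "pmf ?M E = 0"
    proof (rule ccontr)
      assume "pmf ?M E \<noteq> 0"
      then have "E \<inter> ?A = E" using fin_graph_gnp[of E n] by (auto simp: set_pmf_iff fin_graph_def)
      then have "(1 + \<delta>) powr c \<le> (1 + \<delta>) powr real (card E)"
        using E assms(3) by (simp add: powr_realpow)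
      then show False using E assms(3) by (simp add: powr_le_cancel_iff)
    qed
  qed
  also have "\<dots> \<le> measure_pmf.expectation ?M (\<lambda>E. (1 + \<delta>) ^ card (E \<inter> ?A)) / (1 + \<delta>) powr c"
  proof -
    have "measure_pmf.prob ?M {E \<in> space (measure_pmf ?M). (1 + \<delta>) powr c \<le> (1 + \<delta>) ^ card (E \<inter> ?A)} \<le>
        measure_pmf.expectation ?M (\<lambda>E. (1 + \<delta>) ^ card (E \<inter> ?A)) / (1 + \<delta>) powr c"
      using assms(3) fs
      by (intro integral_Markov_inequality_measure[where A = "{}"])
         (auto intro!: integrable_measure_pmf_finite)
    then show ?thesis by simp
  qed
  also have "\<dots> = (1 + d / real n * \<delta>) ^ card ?A / (1 + \<delta>) powr c"
  proof -
    have e: "1 - d / real n + d / real n * (1 + \<delta>) = 1 + d / real n * \<delta>" by (simp only: distrib_left)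
    have "0 \<le> 1 + \<delta>" using assms(3) by simp
    from expectation_gnp_power_card[OF p this, of n, unfolded e] show ?thesis by simp
  qed
  also have "\<dots> \<le> exp (d / real n * \<delta>) ^ card ?A / (1 + \<delta>) powr c"
    using assms(1,3) by (intro divide_right_mono power_mono) auto
  also have "\<dots> = exp (real (card ?A) * (d / real n * \<delta>) - c * ln (1 + \<delta>))"
    using assms(3) by (simp only: powr_def exp_diff exp_of_nat_mult) simp
  also have "\<dots> \<le> exp ((real n)\<^sup>2 / 2 * (d / real n * \<delta>) - c * ln (1 + \<delta>))"
  proof -
    have "real (card ?A) * (d / real n * \<delta>) \<le> (real n)\<^sup>2 / 2 * (d / real n * \<delta>)"
      using card_all_pairs_le[of "{1..n}"] assms n by (intro mult_right_mono) auto
    then show ?thesis by simp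
  qed
  also have "(real n)\<^sup>2 / 2 * (d / real n * \<delta>) - c * ln (1 + \<delta>) =
      - (d * ((1 + \<delta>) * ln (1 + \<delta>) - \<delta>) / 2) * real n"
    using n by (simp add: c_def power2_eq_square field_simps)
  finally show ?thesis unfolding c_def .
qed

text \<open>It is applied to the vertices on one side of the median against those farther than 1 on
  the other side, and to two halves of the root set.\<close>

definition cut_dense :: "real \<Rightarrow> nat \<Rightarrow> nat set set \<Rightarrow> bool" where
  "cut_dense \<delta> n E \<longleftrightarrow> (\<forall>A B. A \<subseteq> {1..n} \<longrightarrow> B \<subseteq> {1..n} \<longrightarrow> A \<inter> B = {} \<longrightarrow>
     \<delta> * real n \<le> real (card A) \<longrightarrow> \<delta> * real n \<le> real (card B) \<longrightarrow> (\<exists>a\<in>A. \<exists>b\<in>B. {a, b} \<in> E))"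

lemma card_image_pairs:
  assumes "A \<inter> B = {}"
  shows "card ((\<lambda>(a, b). {a, b}) ` (A \<times> B)) = card A * card B"
proof -
  have "inj_on (\<lambda>(a, b). {a, b}) (A \<times> B)"
    using assms by (auto simp: inj_on_def doubleton_eq_iff)
  then show ?thesis by (simp add: card_image card_cartesian_product)
qed

text \<open>Union bound over at most 4^n pairs of sets: each offers at least (\<delta> n)^2
  potential edges, all missing with probability at most exp (- d \<delta>^2 n). It is effective as
  soon as d \<delta>^2 > ln 4.\<close>

lemma prob_gnp_not_cut_dense:
  assumes "0 < d" "d \<le> real n" "0 < \<delta>"
  shows "measure_pmf.prob (gnp n (d / real n)) {E. \<not> cut_dense \<delta> n E} \<le> (4 * exp (- (d * \<delta>\<^sup>2))) ^ n"
proof -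
  let ?M = "gnp n (d / real n)"
  have n: "0 < real n" using assms by linarith
  have p: "0 \<le> d / real n" "d / real n \<le> 1" using assms n by (auto simp: field_simps)
  define I where "I = {(A, B). A \<subseteq> {1..n} \<and> B \<subseteq> {1..n} \<and> A \<inter> B = {} \<and>
     \<delta> * real n \<le> real (card A) \<and> \<delta> * real n \<le> real (card B)}"
  define X where "X = (\<lambda>(A :: nat set, B :: nat set). {E. E \<inter> (\<lambda>(a, b). {a, b}) ` (A \<times> B) = {}})"
  have I: "I \<subseteq> Pow {1..n} \<times> Pow {1..n}" by (auto simp: I_def)
  then have finI: "finite I" by (rule finite_subset) auto
  have "card I \<le> card (Pow {1..n} \<times> Pow {1..n})" using I by (intro card_mono) auto
  also have "\<dots> = 4 ^ n" by (simp add: card_cartesian_product card_Pow flip: power_mult_distrib)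
  finally have cI: "card I \<le> 4 ^ n" .
  have "measure_pmf.prob ?M {E. \<not> cut_dense \<delta> n E} \<le> measure_pmf.prob ?M (\<Union>i\<in>I. X i)"
  proof (rule measure_pmf.finite_measure_mono)
    show "{E. \<not> cut_dense \<delta> n E} \<subseteq> (\<Union>i\<in>I. X i)"
    proof
      fix E assume "E \<in> {E. \<not> cut_dense \<delta> n E}"
      then obtain A B where AB: "A \<subseteq> {1..n}" "B \<subseteq> {1..n}" "A \<inter> B = {}"
        "\<delta> * real n \<le> real (card A)" "\<delta> * real n \<le> real (card B)"
        "\<And>a b. a \<in> A \<Longrightarrow> b \<in> B \<Longrightarrow> {a, b} \<notin> E" by (auto simp: cut_dense_def)
      then have "(A, B) \<in> I" "E \<in> X (A, B)" by (auto simp: I_def X_def)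
      then show "E \<in> (\<Union>i\<in>I. X i)" by blast
    qed
  qed simp
  also have "\<dots> \<le> (\<Sum>i\<in>I. measure_pmf.prob ?M (X i))"
    using finI by (intro measure_pmf.finite_measure_subadditive_finite) auto
  also have "\<dots> \<le> (\<Sum>i\<in>I. exp (- (d * \<delta>\<^sup>2) * real n))"
  proof (rule sum_mono)
    fix i assume i: "i \<in> I"
    obtain A B where [simp]: "i = (A, B)" by (cases i)
    have AB: "A \<subseteq> {1..n}" "B \<subseteq> {1..n}" "A \<inter> B = {}"
        "\<delta> * real n \<le> real (card A)" "\<delta> * real n \<le> real (card B)" using i by (auto simp: I_def)
    have "measure_pmf.prob ?M (X i) = (1 - d / real n) ^ (card A * card B)"
    proof -
      have sub: "(\<lambda>(a, b). {a, b}) ` (A \<times> B) \<subseteq> all_pairs {1..n}"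
        using AB unfolding all_pairs_def by fastforce
      show ?thesis
        unfolding X_def using prob_gnp_avoid[OF sub p] card_image_pairs[OF AB(3)] by simp
    qed
    also have "\<dots> \<le> exp (- (d / real n)) ^ (card A * card B)"
      using p exp_ge_add_one_self[of "- (d / real n)"] by (intro power_mono) auto
    also have "\<dots> = exp (- (d / real n) * (real (card A) * real (card B)))"
      by (simp flip: exp_of_nat_mult add: mult_ac)
    also have "\<dots> \<le> exp (- (d / real n) * ((\<delta> * real n) * (\<delta> * real n)))"
      using AB assms n by (intro iffD2[OF exp_le_cancel_iff] mult_left_mono_neg mult_mono) auto
    also have "- (d / real n) * ((\<delta> * real n) * (\<delta> * real n)) = - (d * \<delta>\<^sup>2) * real n"
      using n by (simp add: power2_eq_square)
    finally show "measure_pmf.prob ?M (X i) \<le> exp (- (d * \<delta>\<^sup>2) * real n)" .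
  qed
  also have "\<dots> = real (card I) * exp (- (d * \<delta>\<^sup>2) * real n)" by simp
  also have "\<dots> \<le> 4 ^ n * exp (- (d * \<delta>\<^sup>2) * real n)"
  proof (rule mult_right_mono)
    have "real (card I) \<le> real (4 ^ n)" using cI by (rule of_nat_mono)
    then show "real (card I) \<le> 4 ^ n" by simp
  qed simp
  also have "\<dots> = (4 * exp (- (d * \<delta>\<^sup>2))) ^ n"
    by (simp add: power_mult_distrib mult.commute flip: exp_of_nat_mult)
  finally show ?thesis .
qed

section \<open>Integrating out vertices\<close>

lemma distr_PiM_lborel_translate:
  assumes "finite I"
  shows "distr (\<Pi>\<^sub>M i\<in>I. lborel) (\<Pi>\<^sub>M i\<in>I. lborel) (\<lambda>x. \<lambda>i\<in>I. x i + c i) = (\<Pi>\<^sub>M i\<in>I. (lborel :: real measure))"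
proof -
  interpret product_sigma_finite "\<lambda>_. (lborel :: real measure)" ..
  let ?M = "\<Pi>\<^sub>M i\<in>I. (lborel :: real measure)"
  have [measurable]: "(\<lambda>x. \<lambda>i\<in>I. x i + c i) \<in> measurable ?M ?M"
    by (intro measurable_restrict) measurable
  show ?thesis
  proof (rule PiM_eqI[OF assms])
    fix A assume A: "\<And>i. i \<in> I \<Longrightarrow> A i \<in> sets (lborel :: real measure)"
    have [measurable]: "Pi\<^sub>E I A \<in> sets ?M" using A assms by (intro sets_PiM_I_finite) auto
    have shift: "(\<lambda>t. t + c i) -` A i \<in> sets lborel"
        "emeasure lborel ((\<lambda>t. t + c i) -` A i) = emeasure lborel (A i)" if "i \<in> I" for i
    proof -
      have [measurable]: "A i \<in> sets borel" using A[OF that] by simp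
      have "(\<lambda>t. t + c i) -` A i \<inter> space lborel \<in> sets lborel" by measurable
      then show "(\<lambda>t. t + c i) -` A i \<in> sets lborel" by simp
      have "emeasure lborel (A i) = emeasure (distr lborel borel ((+) (c i))) (A i)"
        by (simp add: lborel_distr_plus)
      also have "\<dots> = emeasure lborel ((\<lambda>t. t + c i) -` A i)"
        by (subst emeasure_distr) (auto simp: add.commute[of _ "c i"])
      finally show "emeasure lborel ((\<lambda>t. t + c i) -` A i) = emeasure lborel (A i)" by simp
    qed
    have "emeasure (distr ?M ?M (\<lambda>x. \<lambda>i\<in>I. x i + c i)) (Pi\<^sub>E I A) =
        emeasure ?M ((\<lambda>x. \<lambda>i\<in>I. x i + c i) -` Pi\<^sub>E I A \<inter> space ?M)"
      by (rule emeasure_distr) measurable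
    also have "(\<lambda>x. \<lambda>i\<in>I. x i + c i) -` Pi\<^sub>E I A \<inter> space ?M = (\<Pi>\<^sub>E i\<in>I. (\<lambda>t. t + c i) -` A i)"
      by (auto simp: space_PiM PiE_def Pi_def)
    also have "emeasure ?M \<dots> = (\<Prod>i\<in>I. emeasure lborel ((\<lambda>t. t + c i) -` A i))"
      using assms shift by (intro emeasure_PiM) auto
    also have "\<dots> = (\<Prod>i\<in>I. emeasure lborel (A i))" using shift by (intro prod.cong) auto
    finally show "emeasure (distr ?M ?M (\<lambda>x. \<lambda>i\<in>I. x i + c i)) (Pi\<^sub>E I A) =
        (\<Prod>i\<in>I. emeasure lborel (A i))" .
  qed simp
qed

lemma nn_integral_PiM_lborel_translate:
  assumes "finite I" and [measurable]: "f \<in> borel_measurable (\<Pi>\<^sub>M i\<in>I. (lborel :: real measure))"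
  shows "(\<integral>\<^sup>+x. f (\<lambda>i\<in>I. x i + c i) \<partial>(\<Pi>\<^sub>M i\<in>I. lborel)) = (\<integral>\<^sup>+x. f x \<partial>(\<Pi>\<^sub>M i\<in>I. lborel))"
proof -
  have [measurable]: "(\<lambda>x. \<lambda>i\<in>I. x i + c i) \<in> measurable (\<Pi>\<^sub>M i\<in>I. (lborel :: real measure)) (\<Pi>\<^sub>M i\<in>I. lborel)"
    by (intro measurable_restrict) measurable
  have "(\<integral>\<^sup>+x. f x \<partial>(\<Pi>\<^sub>M i\<in>I. lborel)) =
      (\<integral>\<^sup>+x. f x \<partial>(distr (\<Pi>\<^sub>M i\<in>I. lborel) (\<Pi>\<^sub>M i\<in>I. lborel) (\<lambda>x. \<lambda>i\<in>I. x i + c i)))"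
    by (simp add: distr_PiM_lborel_translate[OF assms(1)])
  also have "\<dots> = (\<integral>\<^sup>+x. f (\<lambda>i\<in>I. x i + c i) \<partial>(\<Pi>\<^sub>M i\<in>I. lborel))"
    by (rule nn_integral_distr) measurable
  finally show ?thesis by simp
qed

text \<open>A retraction onto the roots that is constant along edges: it extends root values to a
  shift preserving all differences along edges, and it shows that no edge joins two distinct
  roots.\<close>

lemma ex_root_function:
  assumes "is_root_set V E R"
  shows "\<exists>rt. (\<forall>v\<in>V. rt v \<in> R \<and> (v, rt v) \<in> connected_rel V E) \<and> (\<forall>r\<in>R. rt r = r) \<and>
           (\<forall>u\<in>V. \<forall>v\<in>V. {u, v} \<in> E \<longrightarrow> rt u = rt v)"
proof -
  let ?r = "connected_rel V E"
  have R: "R \<subseteq> V" using assms by (simp add: is_root_set_def)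
  have ex1: "\<exists>!r. r \<in> R \<and> (v, r) \<in> ?r" if "v \<in> V" for v
  proof -
    have "?r `` {v} \<in> conn_components V E" using that by (auto simp: conn_components_def intro: quotientI)
    then have "\<exists>!r. r \<in> R \<inter> ?r `` {v}" by (rule bspec[OF conjunct2[OF assms[unfolded is_root_set_def]]])
    then show ?thesis by simp
  qed
  define rt where "rt v = (THE r. r \<in> R \<and> (v, r) \<in> ?r)" for v
  have rt: "rt v \<in> R" "(v, rt v) \<in> ?r" if "v \<in> V" for v
    using theI'[OF ex1[OF that]] by (auto simp: rt_def)
  have rt_eq: "rt v = r" if "v \<in> V" "r \<in> R" "(v, r) \<in> ?r" for v r
    using ex1[OF that(1)] that rt[OF that(1)] by blast
  have "rt r = r" if "r \<in> R" for r
    using rt_eq[of r r] that R by (auto simp: connected_rel_def)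
  moreover have "rt u = rt v" if "u \<in> V" "v \<in> V" "{u, v} \<in> E" for u v
  proof (rule rt_eq[OF that(1)])
    have "(u, v) \<in> ?r" using that by (auto simp: connected_rel_def)
    then show "(u, rt v) \<in> ?r" using rt[OF that(2)] equiv_connected_rel[of V E]
      by (meson equivE transE)
  qed (use rt that in auto)
  ultimately show ?thesis using rt by blast
qed

text \<open>With roots in [0, 1] rather than pinned, all of \<open>V\<close> carries Lebesgue
  measure and a set of exceptional vertices may contain roots. The intersection
  \<open>R \<inter> V\<close> lets subsets of the vertex set take the place of
  \<open>V\<close>.\<close>

definition box_rooted_lipschitz :: "'a set \<Rightarrow> 'a set set \<Rightarrow> 'a set \<Rightarrow> ('a \<Rightarrow> real) set" where
  "box_rooted_lipschitz V E R = {x \<in> space (\<Pi>\<^sub>M v\<in>V. (lborel :: real measure)). (\<forall>r\<in>R \<inter> V. 0 \<le> x r \<and> x r \<le> 1) \<and>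
     (\<forall>u\<in>V. \<forall>v\<in>V. {u, v} \<in> E \<longrightarrow> \<bar>x u - x v\<bar> \<le> 1)}"

lemma sets_box_rooted_lipschitz [measurable]:
  assumes "finite V"
  shows "box_rooted_lipschitz V E R \<in> sets (\<Pi>\<^sub>M v\<in>V. (lborel :: real measure))"
proof -
  let ?M = "\<Pi>\<^sub>M v\<in>V. (lborel :: real measure)"
  have "{y \<in> space ?M. \<bar>y u - y v\<bar> \<le> 1} \<in> sets ?M" if [simp]: "u \<in> V" "v \<in> V" for u v
    by measurable
  moreover have "{y \<in> space ?M. 0 \<le> y u \<and> y u \<le> 1} \<in> sets ?M" if [simp]: "u \<in> V" for u
    by measurable
  ultimately show ?thesis unfolding box_rooted_lipschitz_def using assms
    by (intro sets.sets_Collect_conj sets.sets_Collect_finite_All sets.sets_Collect_imp) auto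
qed

text \<open>Fubini over the root values: the fibre above root values \<open>a\<close> contains the
  polytope translated by \<open>a (rt v)\<close>, a shift that is constant along edges, and the cube
  of root values has volume 1.\<close>

lemma polytope_volume_le_box_rooted:
  assumes G: "fin_graph V E" and root: "is_root_set V E R"
  shows "ennreal (polytope_volume V E R) \<le> emeasure (\<Pi>\<^sub>M v\<in>V. lborel) (box_rooted_lipschitz V E R)"
proof -
  interpret product_sigma_finite "\<lambda>_. (lborel :: real measure)" ..
  have V: "finite V" using G by (simp add: fin_graph_def)
  have R: "R \<subseteq> V" using root by (simp add: is_root_set_def)
  define J where "J = V - R"
  have J: "R \<inter> J = {}" "finite R" "finite J" "R \<union> J = V"
    using V R by (auto simp: J_def finite_subset)
  obtain rt where rt: "\<And>v. v \<in> V \<Longrightarrow> rt v \<in> R" "\<And>r. r \<in> R \<Longrightarrow> rt r = r"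
      "\<And>u v. u \<in> V \<Longrightarrow> v \<in> V \<Longrightarrow> {u, v} \<in> E \<Longrightarrow> rt u = rt v"
    using ex_root_function[OF root] by blast
  let ?MR = "\<Pi>\<^sub>M v\<in>R. (lborel :: real measure)" and ?MJ = "\<Pi>\<^sub>M v\<in>J. (lborel :: real measure)"
  define P where "P = (\<lambda>x. restrict x (V - R)) ` lipschitz_polytope V E R"
  define Q where "Q = box_rooted_lipschitz V E R"
  have P: "P = {y \<in> space ?MJ. \<forall>u\<in>V. \<forall>v\<in>V. {u, v} \<in> E \<longrightarrow>
       \<bar>(if u \<in> R then 0 else y u) - (if v \<in> R then 0 else y v)\<bar> \<le> 1}"
    unfolding P_def J_def by (rule projected_polytope[OF R])
  have Psets [measurable]: "P \<in> sets ?MJ"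
    unfolding P_def J_def by (rule sets_projected_polytope[OF V R])
  have Qsets: "Q \<in> sets (\<Pi>\<^sub>M v\<in>R \<union> J. (lborel :: real measure))"
    unfolding Q_def J by (rule sets_box_rooted_lipschitz[OF V])
  define B where "B a = (\<lambda>y. merge R J (a, y)) -` Q \<inter> space ?MJ" for a
  have Bsets: "B a \<in> sets ?MJ" if "a \<in> space ?MR" for a
  proof -
    have "(\<lambda>y. merge R J (a, y)) \<in> measurable ?MJ (\<Pi>\<^sub>M v\<in>R \<union> J. (lborel :: real measure))"
      using that by measurable
    then show ?thesis unfolding B_def using Qsets by (rule measurable_sets)
  qed
  have inner: "emeasure ?MJ P \<le> emeasure ?MJ (B a)" if a: "a \<in> (\<Pi>\<^sub>E r\<in>R. {0..1})" for a
  proof -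
    have aR: "a \<in> space ?MR" using a by (auto simp: space_PiM PiE_def)
    define c where "c v = a (rt v)" for v
    have "emeasure ?MJ P = (\<integral>\<^sup>+y. indicator P y \<partial>?MJ)" by simp
    also have "\<dots> \<le> (\<integral>\<^sup>+y. indicator (B a) (\<lambda>i\<in>J. y i + c i) \<partial>?MJ)"
    proof (rule nn_integral_mono)
      fix y assume "y \<in> space ?MJ"
      have "(\<lambda>i\<in>J. y i + c i) \<in> B a" if y: "y \<in> P"
      proof -
        let ?x = "merge R J (a, \<lambda>i\<in>J. y i + c i)"
        have x: "?x v = (if v \<in> R then 0 else y v) + a (rt v)" if "v \<in> V" for v
          using that J rt(2)[of v] by (auto simp: merge_def c_def)
        have "?x \<in> space (\<Pi>\<^sub>M v\<in>V. (lborel :: real measure))"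
          using J by (auto simp: space_PiM merge_def PiE_def extensional_def)
        moreover have "0 \<le> ?x r \<and> ?x r \<le> 1" if "r \<in> R" for r
          using a that by (auto simp: merge_def PiE_def Pi_def)
        moreover have "\<bar>?x u - ?x v\<bar> \<le> 1" if "u \<in> V" "v \<in> V" "{u, v} \<in> E" for u v
          unfolding x[OF that(1)] x[OF that(2)] rt(3)[OF that] using y that unfolding P by simp
        ultimately show ?thesis
          by (auto simp: B_def Q_def box_rooted_lipschitz_def space_PiM)
      qed
      then show "(indicator P y :: ennreal) \<le> indicator (B a) (\<lambda>i\<in>J. y i + c i)"
        by (auto simp: indicator_def)
    qed
    also have "\<dots> = (\<integral>\<^sup>+y. indicator (B a) y \<partial>?MJ)"
      using Bsets[OF aR] J by (intro nn_integral_PiM_lborel_translate) auto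
    also have "\<dots> = emeasure ?MJ (B a)" using Bsets[OF aR] by simp
    finally show ?thesis .
  qed
  have box: "(\<Pi>\<^sub>E r\<in>R. {0..1}) \<in> sets ?MR" using J by (intro sets_PiM_I_finite) auto
  have "ennreal (polytope_volume V E R) = emeasure ?MJ P"
    unfolding P_def J_def by (rule emeasure_projected_polytope[OF G root, symmetric])
  also have "\<dots> = emeasure ?MJ P * emeasure ?MR (\<Pi>\<^sub>E r\<in>R. {0..1})"
    using J by (subst emeasure_PiM) auto
  also have "\<dots> = (\<integral>\<^sup>+a. emeasure ?MJ P * indicator (\<Pi>\<^sub>E r\<in>R. {0..1}) a \<partial>?MR)"
    using box by (simp add: nn_integral_cmult_indicator)
  also have "\<dots> \<le> (\<integral>\<^sup>+a. emeasure ?MJ (B a) \<partial>?MR)"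
    using inner by (intro nn_integral_mono) (auto simp: indicator_def)
  also have "\<dots> = emeasure (\<Pi>\<^sub>M v\<in>R \<union> J. lborel) Q"
    unfolding B_def by (rule emeasure_fold_integral[OF J(1-3) Qsets, symmetric])
  finally show ?thesis unfolding Q_def J .
qed

text \<open>Given the other coordinates, the new one is confined to an interval of length 2.\<close>

lemma emeasure_PiM_insert_le:
  assumes "finite Z" "v \<notin> Z" and X: "X \<in> sets (\<Pi>\<^sub>M i\<in>insert v Z. (lborel :: real measure))"
    and Y: "Y \<in> sets (\<Pi>\<^sub>M i\<in>Z. (lborel :: real measure))"
    and XY: "\<And>x. x \<in> X \<Longrightarrow> restrict x Z \<in> Y"
    and len: "\<And>x. x \<in> X \<Longrightarrow> \<bar>x v - a (restrict x Z)\<bar> \<le> 1"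
  shows "emeasure (\<Pi>\<^sub>M i\<in>insert v Z. lborel) X \<le> 2 * emeasure (\<Pi>\<^sub>M i\<in>Z. lborel) Y"
proof -
  interpret product_sigma_finite "\<lambda>_. (lborel :: real measure)" ..
  have "emeasure (\<Pi>\<^sub>M i\<in>insert v Z. lborel) X = (\<integral>\<^sup>+x. indicator X x \<partial>(\<Pi>\<^sub>M i\<in>insert v Z. lborel))"
    using X by simp
  also have "\<dots> = (\<integral>\<^sup>+x. (\<integral>\<^sup>+t. indicator X (x(v := t)) \<partial>lborel) \<partial>(\<Pi>\<^sub>M i\<in>Z. lborel))"
    using X assms(1,2) by (intro product_nn_integral_insert) auto
  also have "\<dots> \<le> (\<integral>\<^sup>+x. 2 * indicator Y x \<partial>(\<Pi>\<^sub>M i\<in>Z. lborel))"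
  proof (rule nn_integral_mono)
    fix x assume x: "x \<in> space (\<Pi>\<^sub>M i\<in>Z. (lborel :: real measure))"
    have res: "restrict (x(v := t)) Z = x" for t
      using x assms(2) by (auto simp: space_PiM PiE_def extensional_def restrict_def fun_eq_iff)
    have "(\<integral>\<^sup>+t. indicator X (x(v := t)) \<partial>lborel) \<le> (\<integral>\<^sup>+t. indicator Y x * indicator {a x - 1..a x + 1} t \<partial>lborel)"
    proof (rule nn_integral_mono)
      fix t :: real
      have "x \<in> Y \<and> t \<in> {a x - 1..a x + 1}" if "x(v := t) \<in> X"
        using XY[OF that] len[OF that] unfolding res by auto
      then show "indicator X (x(v := t)) \<le> (indicator Y x * indicator {a x - 1..a x + 1} t :: ennreal)"
        by (auto simp: indicator_def)
    qed
    also have "\<dots> = indicator Y x * 2"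
      by (subst nn_integral_cmult_indicator) auto
    finally show "(\<integral>\<^sup>+t. indicator X (x(v := t)) \<partial>lborel) \<le> 2 * indicator Y x"
      by (simp add: mult.commute)
  qed
  also have "\<dots> = 2 * emeasure (\<Pi>\<^sub>M i\<in>Z. lborel) Y"
    using Y by (simp add: nn_integral_cmult)
  finally show ?thesis .
qed

lemma rtrancl_leaves_set:
  assumes "(a, b) \<in> r\<^sup>*" "a \<in> Z" "b \<notin> Z"
  shows "\<exists>u v. (u, v) \<in> r \<and> u \<in> Z \<and> v \<notin> Z"
  using assms by (induction rule: rtrancl_induct) blast+

text \<open>The vertices outside \<open>U\<close> can be ordered so that each is confined to an
  interval of length 2 by what precedes it: first the missing roots, then always a vertex adjacent
  to one already present.\<close>

lemma emeasure_box_rooted_restrict_le: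
  assumes G: "fin_graph V E" and root: "is_root_set V E R" and UV: "U \<subseteq> V"
    and X0 [measurable]: "X0 \<in> sets (\<Pi>\<^sub>M i\<in>U. (lborel :: real measure))"
  shows "emeasure (\<Pi>\<^sub>M v\<in>V. lborel) {x \<in> box_rooted_lipschitz V E R. restrict x U \<in> X0} \<le>
           2 ^ card (V - U) * emeasure (\<Pi>\<^sub>M i\<in>U. lborel) X0"
proof -
  have V: "finite V" and E: "E \<subseteq> all_pairs V" using G by (auto simp: fin_graph_def)
  have R: "R \<subseteq> V" using root by (simp add: is_root_set_def)
  obtain rt where rt: "\<And>v. v \<in> V \<Longrightarrow> rt v \<in> R \<and> (v, rt v) \<in> connected_rel V E"
    using ex_root_function[OF root] by blast
  define X where "X Z = {x \<in> box_rooted_lipschitz Z E R. restrict x U \<in> X0}" for Z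
  have Xsets: "X Z \<in> sets (\<Pi>\<^sub>M i\<in>Z. (lborel :: real measure))" if "U \<subseteq> Z" "finite Z" for Z
  proof -
    have "(\<lambda>x. restrict x U) \<in> measurable (\<Pi>\<^sub>M i\<in>Z. (lborel :: real measure)) (\<Pi>\<^sub>M i\<in>U. lborel)"
      by (rule measurable_restrict_subset[OF that(1)])
    then have "(\<lambda>x. restrict x U) -` X0 \<inter> space (\<Pi>\<^sub>M i\<in>Z. (lborel :: real measure)) \<in> sets (\<Pi>\<^sub>M i\<in>Z. lborel)"
      using X0 by (rule measurable_sets)
    then have "box_rooted_lipschitz Z E R \<inter>
        ((\<lambda>x. restrict x U) -` X0 \<inter> space (\<Pi>\<^sub>M i\<in>Z. (lborel :: real measure))) \<in> sets (\<Pi>\<^sub>M i\<in>Z. lborel)"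
      using sets_box_rooted_lipschitz[OF that(2)] by blast
    also have "box_rooted_lipschitz Z E R \<inter>
        ((\<lambda>x. restrict x U) -` X0 \<inter> space (\<Pi>\<^sub>M i\<in>Z. (lborel :: real measure))) = X Z"
      by (auto simp: X_def box_rooted_lipschitz_def)
    finally show ?thesis .
  qed
  have "emeasure (\<Pi>\<^sub>M v\<in>V. lborel) (X V) \<le> 2 ^ card (V - Z) * emeasure (\<Pi>\<^sub>M i\<in>Z. lborel) (X Z)"
    if "U \<subseteq> Z" "Z \<subseteq> V" for Z
    using that
  proof (induction "card (V - Z)" arbitrary: Z)
    case 0
    then have "Z = V" using V by auto
    then show ?case by simp
  next
    case (Suc k)
    have finZ: "finite Z" using V Suc by (auto intro: finite_subset)
    obtain v0 where v0: "v0 \<in> V - Z" using Suc(2) by (metis card.empty ex_in_conv nat.distinct(1))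
    obtain v a where v: "v \<in> V - Z"
      and a: "\<And>x. x \<in> X (insert v Z) \<Longrightarrow> \<bar>x v - a (restrict x Z)\<bar> \<le> (1::real)"
    proof (cases "R \<subseteq> Z")
      case True
      \<comment> \<open>All roots being in \<open>Z\<close>, a path from the root of
        \<open>v0\<close> to \<open>v0\<close> leaves \<open>Z\<close> along some edge, whose outer
        end is the vertex to add.\<close>
      have "(rt v0, v0) \<in> connected_rel V E"
        using rt[of v0] v0 equiv_connected_rel[of V E] by (meson DiffD1 equivE symD)
      then have "(rt v0, v0) \<in> {(a, b). {a, b} \<in> E}\<^sup>*" by (simp add: connected_rel_def)
      from rtrancl_leaves_set[OF this, of Z] obtain u v where uv: "{u, v} \<in> E" "u \<in> Z" "v \<notin> Z"
        using rt[of v0] v0 True by auto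
      have "v \<in> V" using uv(1) E by (auto simp: all_pairs_def doubleton_eq_iff)
      moreover have "\<bar>x v - (\<lambda>y. y u) (restrict x Z)\<bar> \<le> 1" if "x \<in> X (insert v Z)" for x
      proof -
        have "\<bar>x u - x v\<bar> \<le> 1" using that uv by (auto simp: X_def box_rooted_lipschitz_def)
        then show ?thesis using uv(2) by (simp add: abs_minus_commute)
      qed
      ultimately show ?thesis using uv that[of v "\<lambda>y. y u"] by blast
    next
      case False
      then obtain r where r: "r \<in> R" "r \<notin> Z" by blast
      \<comment> \<open>A root takes its value in [0, 1], so the constant centre 0 will do.\<close>
      have "\<bar>x r - (\<lambda>_. 0) (restrict x Z)\<bar> \<le> 1" if "x \<in> X (insert r Z)" for x
        using that r by (auto simp: X_def box_rooted_lipschitz_def)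
      then show ?thesis using r R that[of r "\<lambda>_. 0"] by blast
    qed
    have k: "k = card (V - insert v Z)"
      using Suc(2) v V by (metis Diff_insert card_Diff_singleton diff_Suc_1)
    have "emeasure (\<Pi>\<^sub>M v\<in>V. lborel) (X V) \<le>
        2 ^ card (V - insert v Z) * emeasure (\<Pi>\<^sub>M i\<in>insert v Z. lborel) (X (insert v Z))"
      using Suc v by (intro Suc(1)[OF k]) auto
    also have "\<dots> \<le> 2 ^ card (V - insert v Z) * (2 * emeasure (\<Pi>\<^sub>M i\<in>Z. lborel) (X Z))"
    proof (intro mult_left_mono emeasure_PiM_insert_le[where a = a])
      show "restrict x Z \<in> X Z" if x: "x \<in> X (insert v Z)" for x
      proof -
        have "restrict (restrict x Z) U = restrict x U" using Suc by (auto simp: restrict_def fun_eq_iff)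
        then show ?thesis
          using x by (auto simp: X_def box_rooted_lipschitz_def space_PiM)
      qed
      show "X (insert v Z) \<in> sets (\<Pi>\<^sub>M i\<in>insert v Z. (lborel :: real measure))"
        using Suc finZ by (intro Xsets) auto
      show "X Z \<in> sets (\<Pi>\<^sub>M i\<in>Z. (lborel :: real measure))"
        using Suc finZ by (intro Xsets) auto
    qed (use finZ v a in auto)
    also have "\<dots> = 2 ^ card (V - Z) * emeasure (\<Pi>\<^sub>M i\<in>Z. lborel) (X Z)"
      unfolding k[symmetric] Suc(2)[symmetric] by (simp add: mult_ac)
    finally show ?case .
  qed
  from this[OF order.refl UV] have
    "emeasure (\<Pi>\<^sub>M v\<in>V. lborel) (X V) \<le> 2 ^ card (V - U) * emeasure (\<Pi>\<^sub>M i\<in>U. lborel) (X U)" .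
  also have "\<dots> \<le> 2 ^ card (V - U) * emeasure (\<Pi>\<^sub>M i\<in>U. lborel) X0"
  proof (intro mult_left_mono emeasure_mono X0)
    show "X U \<subseteq> X0"
      by (auto simp: X_def box_rooted_lipschitz_def space_PiM)
  qed simp
  finally show ?thesis unfolding X_def .
qed

text \<open>A path to the root need not have more steps than there are ordered adjacent pairs. The
  estimate is crude, but it only limits the position of the median, where any polynomial is
  affordable.\<close>

lemma box_rooted_lipschitz_bounded:
  assumes G: "fin_graph V E" and root: "is_root_set V E R"
    and x: "x \<in> box_rooted_lipschitz V E R" and w: "w \<in> V"
  shows "\<bar>x w\<bar> \<le> (real (card V))\<^sup>2 + 1"
proof -
  have V: "finite V" and E: "E \<subseteq> all_pairs V" using G by (auto simp: fin_graph_def)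
  have R: "R \<subseteq> V" using root by (simp add: is_root_set_def)
  obtain r where r: "r \<in> R" "(w, r) \<in> connected_rel V E"
    using ex_root_function[OF root] w by blast
  define S where "S = {(a, b). {a, b} \<in> E}"
  have S: "S \<subseteq> V \<times> V" using E by (auto simp: S_def all_pairs_def doubleton_eq_iff)
  then have finS: "finite S" using V by (auto intro: finite_subset)
  have "card S \<le> card (V \<times> V)" using S V by (intro card_mono) auto
  then have cS: "card S \<le> card V * card V" by (simp add: card_cartesian_product)
  have "(w, r) \<in> S\<^sup>*" using r by (simp add: connected_rel_def S_def)
  then obtain k where k: "k \<le> card S" "(w, r) \<in> S ^^ k"
    using rtrancl_finite_eq_relpow[OF finS] by auto
  have "\<bar>x w - x b\<bar> \<le> real k" if "(w, b) \<in> S ^^ k" for k b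
    using that
  proof (induction k arbitrary: b)
    case (Suc k)
    then obtain y where y: "(w, y) \<in> S ^^ k" "(y, b) \<in> S" by auto
    have "\<bar>x y - x b\<bar> \<le> 1" using x y(2) S by (auto simp: box_rooted_lipschitz_def S_def)
    then show ?case using Suc.IH[OF y(1)] by simp
  qed simp
  from this[OF k(2)] have "\<bar>x w - x r\<bar> \<le> real k" .
  also have "real k \<le> real (card V * card V)" using k(1) cS by linarith
  finally have "\<bar>x w - x r\<bar> \<le> (real (card V))\<^sup>2" by (simp add: power2_eq_square)
  moreover have "0 \<le> x r" "x r \<le> 1" using x r R by (auto simp: box_rooted_lipschitz_def)
  ultimately show ?thesis by linarith
qed

section \<open>Functions with values in a window\<close>

text \<open>Take \<open>w\<close> of least value among the vertices with at least half of all values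
  at or below their own. If more than half of the values were strictly below, the largest of these
  would belong to a smaller candidate.\<close>

lemma ex_median:
  fixes x :: "'a \<Rightarrow> real"
  assumes "finite V" "V \<noteq> {}"
  shows "\<exists>w\<in>V. card V \<le> 2 * card {u \<in> V. x u \<le> x w} \<and> card V \<le> 2 * card {u \<in> V. x w \<le> x u}"
proof -
  define W where "W = {w \<in> V. card V \<le> 2 * card {u \<in> V. x u \<le> x w}}"
  have finx: "finite (x ` V)" using assms by simp
  obtain m where m: "m \<in> V" "x m = Max (x ` V)" using Max_in[OF finx] assms by fastforce
  have "{u \<in> V. x u \<le> x m} = V" using m finx by auto
  then have "m \<in> W" using m by (simp add: W_def)
  then have W: "finite (x ` W)" "x ` W \<noteq> {}" using assms by (auto simp: W_def)
  obtain w where w: "w \<in> W" "x w = Min (x ` W)" using Min_in[OF W] by fastforce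
  have wmin: "x w \<le> x v" if "v \<in> W" for v using w W that by auto
  have wV: "w \<in> V" "card V \<le> 2 * card {u \<in> V. x u \<le> x w}" using w by (auto simp: W_def)
  have split: "card V = card {u \<in> V. x u < x w} + card {u \<in> V. x w \<le> x u}"
    using assms by (subst card_Un_disjoint[symmetric]) (auto intro!: arg_cong[where f = card])
  have "2 * card {u \<in> V. x u < x w} \<le> card V"
  proof (cases "{u \<in> V. x u < x w} = {}")
    case False
    define B where "B = {u \<in> V. x u < x w}"
    have B: "finite (x ` B)" "x ` B \<noteq> {}" using assms False by (auto simp: B_def)
    obtain b where b: "b \<in> B" "x b = Max (x ` B)" using Max_in[OF B] by fastforce
    have "B \<subseteq> {u \<in> V. x u \<le> x b}" using b B by (auto simp: B_def)
    then have "card B \<le> card {u \<in> V. x u \<le> x b}" using assms by (intro card_mono) auto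
    moreover have "b \<notin> W" using wmin[of b] b by (auto simp: B_def)
    then have "2 * card {u \<in> V. x u \<le> x b} < card V" using b by (auto simp: W_def B_def)
    ultimately show ?thesis unfolding B_def by linarith
  next
    case True
    show ?thesis unfolding True by simp
  qed
  then show ?thesis using wV split by (intro bexI[of _ w]) auto
qed

lemma power_card_eq_prod:
  fixes q :: "'b :: comm_semiring_1"
  assumes "finite A"
  shows "q ^ card {a \<in> A. P a} = (\<Prod>a\<in>A. if P a then q else 1)"
proof -
  have "A \<inter> Collect P = {a \<in> A. P a}" by auto
  then show ?thesis using assms by (simp add: prod.If_cases)
qed

text \<open>Diagonals are null sets by Fubini. This supplies the distinct values on which the count
  of inversions rests.\<close>

lemma AE_PiM_lborel_inj_on:
  assumes "finite I"
  shows "AE x in (\<Pi>\<^sub>M i\<in>I. (lborel :: real measure)). inj_on x I"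
proof -
  interpret product_sigma_finite "\<lambda>_. (lborel :: real measure)" ..
  let ?M = "\<lambda>I. \<Pi>\<^sub>M i\<in>I. (lborel :: real measure)"
  have ne: "AE x in ?M I. x i \<noteq> x j" if ij: "i \<in> I" "j \<in> I" "i \<noteq> j" for i j
  proof -
    define K where "K = I - {i}"
    have K: "finite K" "i \<notin> K" "I = insert i K" "j \<in> K" using assms ij by (auto simp: K_def)
    have m0: "{x \<in> space (?M I). x i = x j} \<in> sets (?M I)"
      using ij by measurable
    have m: "{x \<in> space (?M (insert i K)). x i = x j} \<in> sets (?M (insert i K))"
      using m0 unfolding K(3) .
    have "emeasure (?M I) {x \<in> space (?M I). x i = x j} =
       (\<integral>\<^sup>+x. indicator {x \<in> space (?M (insert i K)). x i = x j} x \<partial>?M (insert i K))"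
      using m unfolding K(3) by simp
    also have "\<dots> = (\<integral>\<^sup>+x. (\<integral>\<^sup>+t. indicator {x \<in> space (?M (insert i K)). x i = x j} (x(i := t)) \<partial>lborel) \<partial>?M K)"
      using K m by (intro product_nn_integral_insert) auto
    also have "\<dots> \<le> (\<integral>\<^sup>+x. (\<integral>\<^sup>+t. indicator {x j} t \<partial>lborel) \<partial>?M K)"
      using K ij(3) by (intro nn_integral_mono) (auto simp: indicator_def)
    also have "\<dots> = 0" by simp
    finally have "emeasure (?M I) {x \<in> space (?M I). x i = x j} = 0" by simp
    then show ?thesis using m0 by (intro AE_I[of _ _ "{x \<in> space (?M I). x i = x j}"]) auto
  qed
  have "AE x in ?M I. \<forall>i\<in>I. \<forall>j\<in>I. i \<noteq> j \<longrightarrow> x i \<noteq> x j"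
    using assms ne by (intro AE_finite_allI) auto
  then show ?thesis by eventually_elim (auto simp: inj_on_def)
qed

text \<open>Cut the window at \<open>c\<close> and lower by 1 the set \<open>S\<close> of
  coordinates in the upper half. All pieces then lie in one unit box, where the pairs with a jump
  above 1 include the inversions of \<open>S\<close>, so the sum over \<open>S\<close> can be
  bounded pointwise before integrating.\<close>

lemma window_integral_le:
  fixes q c :: real and I :: "'a set"
  assumes I: "finite I" and q: "0 < q" "q < 1"
  shows "(\<integral>\<^sup>+x. indicator (\<Pi>\<^sub>E i\<in>I. {c - 1..c + 1}) x * ennreal (q ^ card {p \<in> I \<times> I. x (fst p) + 1 < x (snd p)})
            \<partial>(\<Pi>\<^sub>M i\<in>I. lborel)) \<le> ennreal ((real (card I) + 1) / qpoch q (card I))"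
proof -
  let ?M = "\<Pi>\<^sub>M i\<in>I. (lborel :: real measure)"
  define f where "f x = ennreal (q ^ card {p \<in> I \<times> I. x (fst p) + 1 < x (snd p)})" for x :: "'a \<Rightarrow> real"
  have f_alt: "f x = ennreal (\<Prod>p\<in>I \<times> I. if x (fst p) + 1 < x (snd p) then q else 1)" for x
    unfolding f_def using I by (subst power_card_eq_prod) auto
  have [measurable]: "f \<in> borel_measurable ?M"
  proof -
    have "(\<lambda>x. if x (fst p) + 1 < x (snd p) then q else 1) \<in> borel_measurable ?M" if p: "p \<in> I \<times> I" for p
    proof -
      have [simp]: "fst p \<in> I" "snd p \<in> I" using p by auto
      show ?thesis by measurable
    qed
    then show ?thesis unfolding f_alt[abs_def] by measurable
  qed
  \<comment> \<open>These closed boxes overlap on their boundaries, which is harmless for an upper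
    bound.\<close>
  define box where "box S = (\<Pi>\<^sub>E i\<in>I. if i \<in> S then {c..c + 1} else {c - 1..c})" for S
  have [measurable]: "box S \<in> sets ?M" for S
    unfolding box_def using I by (intro sets_PiM_I_finite) auto
  have "(\<integral>\<^sup>+x. indicator (\<Pi>\<^sub>E i\<in>I. {c - 1..c + 1}) x * f x \<partial>?M) \<le>
      (\<integral>\<^sup>+x. (\<Sum>S\<in>Pow I. indicator (box S) x * f x) \<partial>?M)"
  proof (rule nn_integral_mono)
    fix x
    show "indicator (\<Pi>\<^sub>E i\<in>I. {c - 1..c + 1}) x * f x \<le> (\<Sum>S\<in>Pow I. indicator (box S) x * f x)"
    proof (cases "x \<in> (\<Pi>\<^sub>E i\<in>I. {c - 1..c + 1})")
      case True
      define S where "S = {i \<in> I. c < x i}"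
      have "x \<in> box S" using True by (auto simp: box_def S_def PiE_def Pi_def)
      then have "indicator (\<Pi>\<^sub>E i\<in>I. {c - 1..c + 1}) x * f x = indicator (box S) x * f x" using True by simp
      also have "\<dots> \<le> (\<Sum>S\<in>Pow I. indicator (box S) x * f x)"
        using I by (intro member_le_sum) (auto simp: S_def)
      finally show ?thesis .
    qed simp
  qed
  also have "\<dots> = (\<Sum>S\<in>Pow I. \<integral>\<^sup>+x. indicator (box S) x * f x \<partial>?M)"
    by (rule nn_integral_sum) measurable
  also have "\<dots> \<le> (\<Sum>S\<in>Pow I. \<integral>\<^sup>+y. indicator (box {}) y * ennreal (q ^ card (inversions y I S)) \<partial>?M)"
  proof (rule sum_mono)
    fix S assume S: "S \<in> Pow I"
    define s :: "'a \<Rightarrow> real" where "s i = (if i \<in> S then 1 else 0)" for i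
    have "(\<integral>\<^sup>+x. indicator (box S) x * f x \<partial>?M) =
        (\<integral>\<^sup>+y. indicator (box S) (\<lambda>i\<in>I. y i + s i) * f (\<lambda>i\<in>I. y i + s i) \<partial>?M)"
      using I by (intro nn_integral_PiM_lborel_translate[symmetric]) auto
    also have "\<dots> \<le> (\<integral>\<^sup>+y. indicator (box {}) y * ennreal (q ^ card (inversions y I S)) \<partial>?M)"
    proof (rule nn_integral_mono)
      fix y assume y: "y \<in> space ?M"
      let ?x = "\<lambda>i\<in>I. y i + s i"
      show "indicator (box S) ?x * f ?x \<le> indicator (box {}) y * ennreal (q ^ card (inversions y I S))"
      proof (cases "?x \<in> box S")
        case True
        have "y i \<in> {c - 1..c}" if "i \<in> I" for i
        proof -
          have "?x i \<in> (if i \<in> S then {c..c + 1} else {c - 1..c})"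
            using True that unfolding box_def by (rule PiE_mem)
          then show ?thesis using that by (auto simp: s_def split: if_splits)
        qed
        then have "y \<in> box {}" using y by (auto simp: box_def space_PiM PiE_def)
        moreover have "f ?x \<le> ennreal (q ^ card (inversions y I S))"
          unfolding f_def
        proof (intro ennreal_leI power_decreasing card_mono)
          show "inversions y I S \<subseteq> {p \<in> I \<times> I. ?x (fst p) + 1 < ?x (snd p)}"
            using S by (auto simp: inversions_def s_def)
        qed (use I q in auto)
        ultimately show ?thesis using True by simp
      qed simp
    qed
    finally show "(\<integral>\<^sup>+x. indicator (box S) x * f x \<partial>?M) \<le>
        (\<integral>\<^sup>+y. indicator (box {}) y * ennreal (q ^ card (inversions y I S)) \<partial>?M)" .
  qed
  also have "\<dots> = (\<integral>\<^sup>+y. (\<Sum>S\<in>Pow I. indicator (box {}) y * ennreal (q ^ card (inversions y I S))) \<partial>?M)"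
  proof (rule nn_integral_sum[symmetric])
    fix S assume S: "S \<in> Pow I"
    have "card (inversions y I S) = card {p \<in> (I - S) \<times> S. y (fst p) < y (snd p)}" for y
      by (intro arg_cong[where f = card]) (auto simp: inversions_def)
    moreover have "finite ((I - S) \<times> S)" using I S by (auto intro: finite_subset)
    ultimately have alt: "q ^ card (inversions y I S) =
        (\<Prod>p\<in>(I - S) \<times> S. if y (fst p) < y (snd p) then q else 1)" for y
      by (simp add: power_card_eq_prod)
    have "(\<lambda>y. if y (fst p) < y (snd p) then q else 1) \<in> borel_measurable ?M" if p: "p \<in> (I - S) \<times> S" for p
    proof -
      have [simp]: "fst p \<in> I" "snd p \<in> I" using p S by auto
      show ?thesis by measurable
    qed
    then have [measurable]: "(\<lambda>y. q ^ card (inversions y I S)) \<in> borel_measurable ?M"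
      unfolding alt by measurable
    show "(\<lambda>y. indicator (box {}) y * ennreal (q ^ card (inversions y I S))) \<in> borel_measurable ?M"
      by measurable
  qed
  also have "\<dots> \<le> (\<integral>\<^sup>+y. ennreal ((real (card I) + 1) / qpoch q (card I)) * indicator (box {}) y \<partial>?M)"
  proof (rule nn_integral_mono_AE)
    show "AE y in ?M. (\<Sum>S\<in>Pow I. indicator (box {}) y * ennreal (q ^ card (inversions y I S))) \<le>
        ennreal ((real (card I) + 1) / qpoch q (card I)) * indicator (box {}) y"
      using AE_PiM_lborel_inj_on[OF I]
    proof eventually_elim
      case (elim y)
      have "(\<Sum>S\<in>Pow I. ennreal (q ^ card (inversions y I S))) = ennreal (\<Sum>S\<in>Pow I. q ^ card (inversions y I S))"
        using q by (intro sum_ennreal) auto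
      also have "\<dots> \<le> ennreal ((real (card I) + 1) / qpoch q (card I))"
        using sum_inversions_le[OF I elim, of q] q by (intro ennreal_leI) auto
      finally show ?case by (cases "y \<in> box {}") auto
    qed
  qed
  also have "\<dots> = ennreal ((real (card I) + 1) / qpoch q (card I)) * emeasure ?M (box {})"
    by (rule nn_integral_cmult_indicator) measurable
  also have "emeasure ?M (box {}) = 1"
  proof -
    interpret product_sigma_finite "\<lambda>_. (lborel :: real measure)" ..
    have "emeasure ?M (box {}) = (\<Prod>i\<in>I. emeasure lborel {c - 1..c})"
      unfolding box_def using I by (subst emeasure_PiM) auto
    then show ?thesis by simp
  qed
  finally show ?thesis by (simp add: f_def)
qed

section \<open>Profiles of Lipschitz functions\<close>

text \<open>Here \<open>w\<close> is a median vertex of a function, \<open>D\<close> the set of vertices whose value is farther than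
  \<open>1\<close> from the median, and \<open>Dp\<close> the part of \<open>D\<close> above it.\<close>

definition window_set :: "nat \<Rightarrow> nat set \<Rightarrow> nat \<Rightarrow> (nat \<Rightarrow> real) set" where
  "window_set n D w = {x \<in> space (\<Pi>\<^sub>M u\<in>{1..n} - D. (lborel :: real measure)).
     \<bar>x w\<bar> \<le> (real n)\<^sup>2 + 1 \<and> (\<forall>u\<in>{1..n} - D. \<bar>x u - x w\<bar> \<le> 1) \<and>
     n div 4 \<le> card {u \<in> {1..n} - D. x u \<le> x w} \<and> n div 4 \<le> card {u \<in> {1..n} - D. x w \<le> x u}}"

text \<open>For a function with this profile all these pairs differ by more than 1 in value: a
  vertex above the window misses every vertex at or below the median, and symmetrically. The values
  on \<open>D\<close> do not occur, since those coordinates are integrated out.\<close>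

definition forced_non_edges :: "nat \<Rightarrow> nat set \<Rightarrow> nat set \<Rightarrow> nat \<Rightarrow> (nat \<Rightarrow> real) \<Rightarrow> (nat \<times> nat) set" where
  "forced_non_edges n D Dp w x =
     {p \<in> ({1..n} - D) \<times> ({1..n} - D). x (fst p) + 1 < x (snd p)} \<union>
     {u \<in> {1..n} - D. x u \<le> x w} \<times> Dp \<union> {u \<in> {1..n} - D. x w \<le> x u} \<times> (D - Dp)"

definition profile_set :: "nat \<Rightarrow> nat set set \<Rightarrow> nat set \<Rightarrow> nat set \<Rightarrow> nat \<Rightarrow> (nat \<Rightarrow> real) set" where
  "profile_set n E D Dp w =
     {x \<in> window_set n D w. \<forall>p\<in>forced_non_edges n D Dp w x. {fst p, snd p} \<notin> E}"

lemma sets_window_set [measurable]: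
  assumes "w \<in> {1..n} - D"
  shows "window_set n D w \<in> sets (\<Pi>\<^sub>M u\<in>{1..n} - D. (lborel :: real measure))"
proof -
  let ?M = "\<Pi>\<^sub>M u\<in>{1..n} - D. (lborel :: real measure)"
  have card_eq: "card {u \<in> A. P u} = (\<Sum>u\<in>A. if P u then 1 else 0)" if "finite A" for A :: "nat set" and P
    using that by (simp add: sum.If_cases Int_def)
  have cm: "(\<lambda>x. x u) \<in> borel_measurable ?M" if "u \<in> {1..n} - D" for u
    using that by measurable
  note [measurable] = cm[OF assms]
  have 1: "{x \<in> space ?M. \<bar>x u - x w\<bar> \<le> 1} \<in> sets ?M" if "u \<in> {1..n} - D" for u
  proof -
    note [measurable] = cm[OF that]
    show ?thesis by measurable
  qed
  have 2: "{x \<in> space ?M. \<bar>x w\<bar> \<le> (real n)\<^sup>2 + 1} \<in> sets ?M"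
    by measurable
  have 3: "{x \<in> space ?M. k \<le> card {u \<in> {1..n} - D. x u \<le> x w}} \<in> sets ?M" for k
  proof -
    have "(\<lambda>x. if x u \<le> x w then 1 else 0) \<in> measurable ?M (count_space (UNIV :: nat set))"
      if "u \<in> {1..n} - D" for u
    proof -
      note [measurable] = cm[OF that]
      show ?thesis by measurable
    qed
    then have [measurable]: "(\<lambda>x. \<Sum>u\<in>{1..n} - D. if x u \<le> x w then 1 else 0)
        \<in> measurable ?M (count_space (UNIV :: nat set))"
      by (rule measurable_sum_nat)
    show ?thesis unfolding card_eq[OF finite_Diff[OF finite_atLeastAtMost]] by measurable
  qed
  have 4: "{x \<in> space ?M. k \<le> card {u \<in> {1..n} - D. x w \<le> x u}} \<in> sets ?M" for k
  proof -
    have "(\<lambda>x. if x w \<le> x u then 1 else 0) \<in> measurable ?M (count_space (UNIV :: nat set))"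
      if "u \<in> {1..n} - D" for u
    proof -
      note [measurable] = cm[OF that]
      show ?thesis by measurable
    qed
    then have [measurable]: "(\<lambda>x. \<Sum>u\<in>{1..n} - D. if x w \<le> x u then 1 else 0)
        \<in> measurable ?M (count_space (UNIV :: nat set))"
      by (rule measurable_sum_nat)
    show ?thesis unfolding card_eq[OF finite_Diff[OF finite_atLeastAtMost]] by measurable
  qed
  show ?thesis unfolding window_set_def
    by (intro sets.sets_Collect_conj 2 3 4 sets.sets_Collect_finite_All 1) simp_all
qed

lemma forced_non_edges_subset:
  assumes "D \<subseteq> {1..n}" "Dp \<subseteq> D"
  shows "forced_non_edges n D Dp w x \<subseteq> ({1..n} - D) \<times> {1..n}"
  using assms by (auto simp: forced_non_edges_def)

lemma sets_profile_set [measurable]: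
  assumes w: "w \<in> {1..n} - D" and D: "D \<subseteq> {1..n}" "Dp \<subseteq> D"
  shows "profile_set n E D Dp w \<in> sets (\<Pi>\<^sub>M u\<in>{1..n} - D. (lborel :: real measure))"
proof -
  let ?M = "\<Pi>\<^sub>M u\<in>{1..n} - D. (lborel :: real measure)"
  have m: "{x \<in> space ?M. p \<in> forced_non_edges n D Dp w x} \<in> sets ?M" if "p \<in> ({1..n} - D) \<times> {1..n}" for p
  proof -
    obtain u v where [simp]: "p = (u, v)" by (cases p)
    have u: "u \<in> {1..n} - D" using that by simp
    have 1: "{x \<in> space ?M. x u \<le> x w} \<in> sets ?M" "{x \<in> space ?M. x w \<le> x u} \<in> sets ?M"
      using u w by measurable
    have 2: "{x \<in> space ?M. v \<in> {1..n} - D \<and> x u + 1 < x v} \<in> sets ?M"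
    proof (cases "v \<in> {1..n} - D")
      case True
      then have "{x \<in> space ?M. x u + 1 < x v} \<in> sets ?M" using u by measurable
      then show ?thesis using True by simp
    qed auto
    have "{x \<in> space ?M. p \<in> forced_non_edges n D Dp w x} =
       {x \<in> space ?M. (v \<in> {1..n} - D \<and> x u + 1 < x v) \<or> (x u \<le> x w \<and> v \<in> Dp) \<or> (x w \<le> x u \<and> v \<in> D - Dp)}"
      using u by (auto simp: forced_non_edges_def)
    also have "\<dots> \<in> sets ?M"
    proof (intro sets.sets_Collect_disj 2)
      show "{x \<in> space ?M. x u \<le> x w \<and> v \<in> Dp} \<in> sets ?M" using 1 by (cases "v \<in> Dp") auto
      show "{x \<in> space ?M. x w \<le> x u \<and> v \<in> D - Dp} \<in> sets ?M" using 1 by (cases "v \<in> D - Dp") auto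
    qed
    finally show ?thesis .
  qed
  have "profile_set n E D Dp w = window_set n D w \<inter>
     {x \<in> space ?M. \<forall>p\<in>({1..n} - D) \<times> {1..n}. p \<in> forced_non_edges n D Dp w x \<longrightarrow> {fst p, snd p} \<notin> E}"
  proof -
    have "window_set n D w \<subseteq> space ?M" by (auto simp: window_set_def)
    then show ?thesis using forced_non_edges_subset[OF D] unfolding profile_set_def by blast
  qed
  also have "\<dots> \<in> sets ?M"
    using m sets_window_set[OF w]
    by (intro sets.Int sets.sets_Collect_finite_All sets.sets_Collect_imp) auto
  finally show ?thesis .
qed

text \<open>No edge joins the vertices above the window to the half at or below the median, so cut
  density leaves fewer than \<delta> n of them, and likewise below. The profile does not record the
  size of \<open>D\<close>, only that about a quarter of all vertices remains on each side of the
  median.\<close>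

lemma ex_profile:
  assumes G: "fin_graph {1..n} E" and root: "is_root_set {1..n} E R" and n: "1 \<le> n"
    and cut: "cut_dense \<delta> n E" and \<delta>: "0 < \<delta>" "\<delta> \<le> 1/8"
    and x: "x \<in> box_rooted_lipschitz {1..n} E R"
  shows "\<exists>D Dp w. D \<subseteq> {1..n} \<and> Dp \<subseteq> D \<and> w \<in> {1..n} - D \<and> restrict x ({1..n} - D) \<in> profile_set n E D Dp w"
proof -
  let ?V = "{1..n}"
  obtain w where w: "w \<in> ?V" "n \<le> 2 * card {u \<in> ?V. x u \<le> x w}" "n \<le> 2 * card {u \<in> ?V. x w \<le> x u}"
    using ex_median[of ?V x] n by auto
  define Lo where "Lo = {u \<in> ?V. x u \<le> x w}"
  define Hi where "Hi = {u \<in> ?V. x w \<le> x u}"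
  define Dp where "Dp = {v \<in> ?V. x w + 1 < x v}"
  define Dm where "Dm = {v \<in> ?V. x v + 1 < x w}"
  have fin: "finite Lo" "finite Hi" "finite Dp" "finite Dm"
    by (auto simp: Lo_def Hi_def Dp_def Dm_def)
  have lip: "\<bar>x u - x v\<bar> \<le> 1" if "u \<in> ?V" "v \<in> ?V" "{u, v} \<in> E" for u v
    using x that by (auto simp: box_rooted_lipschitz_def)
  have big: "\<delta> * real n \<le> real (card A)" if "n \<le> 2 * card A" for A :: "nat set"
  proof -
    have "\<delta> * real n \<le> 1/8 * real n" using \<delta> by (intro mult_right_mono) auto
    moreover have "real n \<le> 2 * real (card A)" using that by linarith
    ultimately show ?thesis by linarith
  qed
  have n8: "\<delta> * real n \<le> real n / 8" using mult_right_mono[OF \<delta>(2), of "real n"] by simp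
  have Dp: "real (card Dp) < \<delta> * real n"
  proof (rule ccontr)
    assume "\<not> ?thesis"
    then have "\<delta> * real n \<le> real (card Dp)" by linarith
    moreover have "Lo \<subseteq> ?V" "Dp \<subseteq> ?V" "Lo \<inter> Dp = {}" by (auto simp: Lo_def Dp_def)
    moreover have "\<delta> * real n \<le> real (card Lo)" unfolding Lo_def by (rule big[OF w(2)])
    ultimately obtain a b where "a \<in> Lo" "b \<in> Dp" "{a, b} \<in> E"
      using cut unfolding cut_dense_def by blast
    then show False using lip[of a b] by (auto simp: Lo_def Dp_def)
  qed
  have Dm: "real (card Dm) < \<delta> * real n"
  proof (rule ccontr)
    assume "\<not> ?thesis"
    then have "\<delta> * real n \<le> real (card Dm)" by linarith
    moreover have "Hi \<subseteq> ?V" "Dm \<subseteq> ?V" "Hi \<inter> Dm = {}" by (auto simp: Hi_def Dm_def)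
    moreover have "\<delta> * real n \<le> real (card Hi)" unfolding Hi_def by (rule big[OF w(3)])
    ultimately obtain a b where "a \<in> Hi" "b \<in> Dm" "{a, b} \<in> E"
      using cut unfolding cut_dense_def by blast
    then show False using lip[of a b] by (auto simp: Hi_def Dm_def)
  qed
  define D where "D = Dp \<union> Dm"
  have DV: "D \<subseteq> ?V" "Dp \<subseteq> D" by (auto simp: D_def Dp_def Dm_def)
  have wD: "w \<in> ?V - D" using w by (auto simp: D_def Dp_def Dm_def)
  define y where "y = restrict x (?V - D)"
  have yx: "y u = x u" if "u \<in> ?V - D" for u using that by (simp add: y_def)
  have sub: "card A - card B \<le> card (A - B)" if "finite B" for A B :: "nat set"
    using that by (rule diff_card_le_card_Diff)
  have "card Lo \<le> card (Lo - Dm) + card Dm" using sub[OF fin(4), of Lo] by linarith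
  then have "real (card Lo) \<le> real (card (Lo - Dm)) + real (card Dm)" by linarith
  moreover have "real n \<le> 2 * real (card Lo)" using w by (simp add: Lo_def flip: of_nat_le_iff)
  \<comment> \<open>At least n / 2 vertices are on this side, and fewer than \<delta> n \<le> n / 8
    of them are removed.\<close>
  ultimately have c1: "real n / 4 \<le> real (card (Lo - Dm))" using Dm n8 by linarith
  have "card Hi \<le> card (Hi - Dp) + card Dp" using sub[OF fin(3), of Hi] by linarith
  then have "real (card Hi) \<le> real (card (Hi - Dp)) + real (card Dp)" by linarith
  moreover have "real n \<le> 2 * real (card Hi)" using w by (simp add: Hi_def flip: of_nat_le_iff)
  ultimately have c2: "real n / 4 \<le> real (card (Hi - Dp))" using Dp n8 by linarith
  have eq: "{u \<in> ?V - D. y u \<le> y w} = Lo - Dm" "{u \<in> ?V - D. y w \<le> y u} = Hi - Dp"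
    using yx[OF wD] yx by (auto simp: D_def Lo_def Hi_def Dp_def Dm_def)
  have "y \<in> space (\<Pi>\<^sub>M u\<in>?V - D. (lborel :: real measure))" by (simp add: space_PiM y_def)
  moreover have "n div 4 \<le> card {u \<in> ?V - D. y u \<le> y w}" unfolding eq using c1 by linarith
  moreover have "n div 4 \<le> card {u \<in> ?V - D. y w \<le> y u}" unfolding eq using c2 by linarith
  moreover have "\<bar>y w\<bar> \<le> (real n)\<^sup>2 + 1"
    using box_rooted_lipschitz_bounded[OF G root x w(1)] yx[OF wD] by simp
  moreover have "\<bar>y u - y w\<bar> \<le> 1" if "u \<in> ?V - D" for u
    unfolding yx[OF that] yx[OF wD] using that by (auto simp: D_def Dp_def Dm_def abs_le_iff)
  ultimately have win: "y \<in> window_set n D w" unfolding window_set_def by blast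
  have "{fst p, snd p} \<notin> E" if p: "p \<in> forced_non_edges n D Dp w y" for p
  proof
    assume e: "{fst p, snd p} \<in> E"
    have pV: "fst p \<in> ?V - D" "snd p \<in> ?V"
      using subsetD[OF forced_non_edges_subset[OF DV] p] by (simp_all only: mem_Times_iff)
    have l: "\<bar>x (fst p) - x (snd p)\<bar> \<le> 1" using lip[of "fst p" "snd p"] pV e by blast
    consider "snd p \<in> ?V - D" "y (fst p) + 1 < y (snd p)" | "y (fst p) \<le> y w" "snd p \<in> Dp"
      | "y w \<le> y (fst p)" "snd p \<in> D - Dp"
      using p unfolding forced_non_edges_def Un_iff mem_Times_iff mem_Collect_eq by blast
    then show False
    proof cases
      case 1 then show ?thesis using l unfolding yx[OF pV(1)] yx[OF 1(1)] by linarith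
    next
      case 2 then show ?thesis using l unfolding yx[OF pV(1)] yx[OF wD] by (simp add: Dp_def)
    next
      case 3
      then have "x (snd p) + 1 < x w" by (auto simp: D_def Dm_def)
      then show ?thesis using l 3 unfolding yx[OF pV(1)] yx[OF wD] by linarith
    qed
  qed
  then have "y \<in> profile_set n E D Dp w" using win by (simp add: profile_set_def)
  then show ?thesis using wD DV unfolding y_def by blast
qed

definition profiles :: "nat \<Rightarrow> (nat set \<times> nat set \<times> nat) set" where
  "profiles n = (SIGMA D:Pow {1..n}. Pow D \<times> ({1..n} - D))"

lemma finite_profiles: "finite (profiles n)"
proof -
  have "profiles n \<subseteq> Pow {1..n} \<times> Pow {1..n} \<times> {1..n}" by (auto simp: profiles_def)
  then show ?thesis by (rule finite_subset) simp
qed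

lemma polytope_volume_le_sum_profiles:
  assumes G: "fin_graph {1..n} E" and root: "is_root_set {1..n} E R" and n: "1 \<le> n"
    and cut: "cut_dense \<delta> n E" and \<delta>: "0 < \<delta>" "\<delta> \<le> 1/8"
  shows "ennreal (polytope_volume {1..n} E R) \<le> (\<Sum>(D, Dp, w)\<in>profiles n.
           2 ^ card D * emeasure (\<Pi>\<^sub>M u\<in>{1..n} - D. lborel) (profile_set n E D Dp w))"
proof -
  let ?V = "{1..n}"
  define Q where "Q = box_rooted_lipschitz ?V E R"
  define X where "X = (\<lambda>(D, Dp, w). {x \<in> Q. restrict x (?V - D) \<in> profile_set n E D Dp w})"
  have Q: "Q \<in> sets (\<Pi>\<^sub>M v\<in>?V. (lborel :: real measure))"
    unfolding Q_def by (rule sets_box_rooted_lipschitz) simp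
  have Xsets: "X t \<in> sets (\<Pi>\<^sub>M v\<in>?V. (lborel :: real measure))" if "t \<in> profiles n" for t
  proof -
    obtain D Dp w where t: "t = (D, Dp, w)" by (cases t)
    have D: "D \<subseteq> ?V" "Dp \<subseteq> D" "w \<in> ?V - D" using that t by (auto simp: profiles_def)
    have "(\<lambda>x. restrict x (?V - D)) \<in> measurable (\<Pi>\<^sub>M i\<in>?V. (lborel :: real measure)) (\<Pi>\<^sub>M i\<in>?V - D. lborel)"
      by (rule measurable_restrict_subset) auto
    then have "(\<lambda>x. restrict x (?V - D)) -` profile_set n E D Dp w \<inter> space (\<Pi>\<^sub>M i\<in>?V. (lborel :: real measure))
        \<in> sets (\<Pi>\<^sub>M i\<in>?V. lborel)"
      using sets_profile_set[OF D(3,1,2)] by (rule measurable_sets)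
    from sets.Int[OF Q this] show ?thesis
      by (rule back_subst[where P = "\<lambda>A. A \<in> _"])
         (auto simp: X_def t Q_def box_rooted_lipschitz_def)
  qed
  have "ennreal (polytope_volume ?V E R) \<le> emeasure (\<Pi>\<^sub>M v\<in>?V. lborel) Q"
    unfolding Q_def by (rule polytope_volume_le_box_rooted[OF G root])
  also have "\<dots> \<le> emeasure (\<Pi>\<^sub>M v\<in>?V. lborel) (\<Union>t\<in>profiles n. X t)"
  proof (rule emeasure_mono)
    show "Q \<subseteq> (\<Union>t\<in>profiles n. X t)"
    proof
      fix x assume x: "x \<in> Q"
      then obtain D Dp w where "D \<subseteq> ?V" "Dp \<subseteq> D" "w \<in> ?V - D" "restrict x (?V - D) \<in> profile_set n E D Dp w"
        using ex_profile[OF G root n cut \<delta>, of x] unfolding Q_def by blast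
      then have "(D, Dp, w) \<in> profiles n" "x \<in> X (D, Dp, w)" using x by (auto simp: profiles_def X_def)
      then show "x \<in> (\<Union>t\<in>profiles n. X t)" by blast
    qed
    show "(\<Union>t\<in>profiles n. X t) \<in> sets (\<Pi>\<^sub>M v\<in>?V. (lborel :: real measure))"
      using finite_profiles Xsets by (intro sets.finite_UN) auto
  qed
  also have "\<dots> \<le> (\<Sum>t\<in>profiles n. emeasure (\<Pi>\<^sub>M v\<in>?V. lborel) (X t))"
    using Xsets by (intro emeasure_subadditive_finite finite_profiles) auto
  also have "\<dots> \<le> (\<Sum>(D, Dp, w)\<in>profiles n.
           2 ^ card D * emeasure (\<Pi>\<^sub>M u\<in>?V - D. lborel) (profile_set n E D Dp w))"
  proof (rule sum_mono)
    fix t assume t: "t \<in> profiles n"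
    obtain D Dp w where teq: "t = (D, Dp, w)" by (cases t)
    have D: "D \<subseteq> ?V" "Dp \<subseteq> D" "w \<in> ?V - D" using t teq by (auto simp: profiles_def)
    have "emeasure (\<Pi>\<^sub>M v\<in>?V. lborel) {x \<in> Q. restrict x (?V - D) \<in> profile_set n E D Dp w} \<le>
           2 ^ card (?V - (?V - D)) * emeasure (\<Pi>\<^sub>M i\<in>?V - D. lborel) (profile_set n E D Dp w)"
      unfolding Q_def using sets_profile_set[OF D(3,1,2)]
      by (intro emeasure_box_rooted_restrict_le[OF G root]) auto
    moreover have "?V - (?V - D) = D" using D by auto
    ultimately show "emeasure (\<Pi>\<^sub>M v\<in>?V. lborel) (X t) \<le> (case t of (D, Dp, w) \<Rightarrow>
        2 ^ card D * emeasure (\<Pi>\<^sub>M u\<in>?V - D. lborel) (profile_set n E D Dp w))"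
      by (simp add: X_def teq)
  qed
  finally show ?thesis .
qed

text \<open>Passing to unordered pairs loses nothing: an increasing pair cannot be reversed, and
  every other pair has exactly one end in \<open>D\<close>, namely the second. The first family
  omits \<open>w\<close>, whose value is to serve as the centre of the window.\<close>

lemma card_forced_non_edges_ge:
  assumes D: "D \<subseteq> {1..n}" "Dp \<subseteq> D" and x: "x \<in> window_set n D w"
  shows "card {p \<in> ({1..n} - D - {w}) \<times> ({1..n} - D - {w}). x (fst p) + 1 < x (snd p)} + (n div 4) * card D
           \<le> card ((\<lambda>p. {fst p, snd p}) ` forced_non_edges n D Dp w x)"
proof -
  let ?V = "{1..n}"
  define A where "A = {p \<in> (?V - D) \<times> (?V - D). x (fst p) + 1 < x (snd p)}"
  define A' where "A' = {p \<in> (?V - D - {w}) \<times> (?V - D - {w}). x (fst p) + 1 < x (snd p)}"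
  define B where "B = {u \<in> ?V - D. x u \<le> x w} \<times> Dp"
  define C where "C = {u \<in> ?V - D. x w \<le> x u} \<times> (D - Dp)"
  have finD: "finite D" "finite Dp" using D by (auto intro: finite_subset)
  have fin: "finite A" "finite B" "finite C"
    unfolding A_def B_def C_def using finD by auto
  have "inj_on (\<lambda>p. {fst p, snd p}) (A \<union> B \<union> C)"
  proof (rule inj_onI)
    fix p p' assume pp: "p \<in> A \<union> B \<union> C" "p' \<in> A \<union> B \<union> C" "{fst p, snd p} = {fst p', snd p'}"
    have "fst p = fst p' \<and> snd p = snd p' \<or> fst p = snd p' \<and> snd p = fst p'"
      using pp(3) by (simp add: doubleton_eq_iff)
    moreover have "\<not> (fst p = snd p' \<and> snd p = fst p')"
      using pp(1,2) D by (cases p; cases p') (auto simp: A_def B_def C_def)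
    ultimately show "p = p'" by (simp add: prod_eq_iff)
  qed
  then have "card ((\<lambda>p. {fst p, snd p}) ` forced_non_edges n D Dp w x) = card (A \<union> B \<union> C)"
    unfolding forced_non_edges_def A_def B_def C_def by (rule card_image)
  also have "\<dots> = card A + card B + card C"
    using fin D by (subst card_Un_disjoint, auto simp: A_def B_def C_def)+
  finally have eq: "card ((\<lambda>p. {fst p, snd p}) ` forced_non_edges n D Dp w x) = card A + card B + card C" .
  have "card A' \<le> card A" using fin by (intro card_mono) (auto simp: A_def A'_def)
  moreover have "(n div 4) * card Dp \<le> card B"
    using x unfolding B_def card_cartesian_product by (intro mult_right_mono) (auto simp: window_set_def)
  moreover have "(n div 4) * card (D - Dp) \<le> card C"
    using x unfolding C_def card_cartesian_product by (intro mult_right_mono) (auto simp: window_set_def)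
  moreover have "card D = card Dp + card (D - Dp)"
    using D finD by (metis card_Diff_subset card_mono le_add_diff_inverse)
  ultimately show ?thesis unfolding eq A'_def[symmetric] by (simp add: distrib_left)
qed

section \<open>Expected volume\<close>

text \<open>Fubini with the value of the median vertex outermost. It ranges over an interval of
  length 2 (n^2 + 1), and for each fixed value the others lie in a window around it.\<close>

lemma window_set_integral_le:
  assumes w: "w \<in> {1..n} - D" and D: "D \<subseteq> {1..n}" and q: "0 < q" "q < 1"
  shows "(\<integral>\<^sup>+x. indicator (window_set n D w) x *
             ennreal (q ^ card {p \<in> ({1..n} - D - {w}) \<times> ({1..n} - D - {w}). x (fst p) + 1 < x (snd p)})
             \<partial>(\<Pi>\<^sub>M u\<in>{1..n} - D. lborel)) \<le>
         ennreal (2 * ((real n)\<^sup>2 + 1) * ((real n + 1) / qpoch q n))"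
proof -
  interpret product_sigma_finite "\<lambda>_::nat. (lborel :: real measure)" ..
  define I where "I = {1..n} - D - {w}"
  have I: "finite I" "w \<notin> I" "{1..n} - D = insert w I" "card I \<le> n"
    using w card_mono[of "{1..n}" I] by (auto simp: I_def)
  let ?M = "\<Pi>\<^sub>M u\<in>insert w I. (lborel :: real measure)"
  define K where "K = (real n)\<^sup>2 + 1"
  define Z where "Z = (real n + 1) / qpoch q n"
  have Z0: "0 \<le> Z" using qpoch_pos[of q n] q by (simp add: Z_def)
  define f where "f x = ennreal (q ^ card {p \<in> I \<times> I. x (fst p) + 1 < x (snd p)})" for x :: "nat \<Rightarrow> real"
  have f_alt: "f x = ennreal (\<Prod>p\<in>I \<times> I. if x (fst p) + 1 < x (snd p) then q else 1)" for x
    unfolding f_def using I by (subst power_card_eq_prod) auto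
  have fm [measurable]: "f \<in> borel_measurable ?M"
  proof -
    have "(\<lambda>x. if x (fst p) + 1 < x (snd p) then q else 1) \<in> borel_measurable ?M" if p: "p \<in> I \<times> I" for p
    proof -
      have 1: "fst p \<in> insert w I" and 2: "snd p \<in> insert w I" using p by auto
      have [measurable]: "(\<lambda>x. x (fst p)) \<in> borel_measurable ?M"
        using measurable_component_singleton[OF 1, of "\<lambda>_. lborel"] by simp
      have [measurable]: "(\<lambda>x. x (snd p)) \<in> borel_measurable ?M"
        using measurable_component_singleton[OF 2, of "\<lambda>_. lborel"] by simp
      show ?thesis by measurable
    qed
    then show ?thesis unfolding f_alt[abs_def] by measurable
  qed
  have Wm: "window_set n D w \<in> sets ?M" using sets_window_set[OF w] unfolding I(3) .
  have "(\<integral>\<^sup>+x. indicator (window_set n D w) x * f x \<partial>?M) =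
      (\<integral>\<^sup>+c. (\<integral>\<^sup>+x. indicator (window_set n D w) (x(w := c)) * f (x(w := c)) \<partial>(\<Pi>\<^sub>M u\<in>I. lborel)) \<partial>lborel)"
    using I Wm by (intro product_nn_integral_insert_rev) auto
  also have "\<dots> \<le> (\<integral>\<^sup>+c. ennreal Z * indicator {- K..K} c \<partial>lborel)"
  proof (rule nn_integral_mono)
    fix c :: real
    have "(\<integral>\<^sup>+x. indicator (window_set n D w) (x(w := c)) * f (x(w := c)) \<partial>(\<Pi>\<^sub>M u\<in>I. lborel)) \<le>
        (\<integral>\<^sup>+x. indicator {- K..K} c * (indicator (\<Pi>\<^sub>E i\<in>I. {c - 1..c + 1}) x *
           ennreal (q ^ card {p \<in> I \<times> I. x (fst p) + 1 < x (snd p)})) \<partial>(\<Pi>\<^sub>M u\<in>I. lborel))"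
    proof (rule nn_integral_mono)
      fix x assume x: "x \<in> space (\<Pi>\<^sub>M u\<in>I. (lborel :: real measure))"
      have feq: "f (x(w := c)) = ennreal (q ^ card {p \<in> I \<times> I. x (fst p) + 1 < x (snd p)})"
      proof -
        have "{p \<in> I \<times> I. (x(w := c)) (fst p) + 1 < (x(w := c)) (snd p)} = {p \<in> I \<times> I. x (fst p) + 1 < x (snd p)}"
          using I(2) by auto
        then show ?thesis unfolding f_def by simp
      qed
      have "c \<in> {- K..K} \<and> x \<in> (\<Pi>\<^sub>E i\<in>I. {c - 1..c + 1})" if win: "x(w := c) \<in> window_set n D w"
      proof
        have "\<bar>(x(w := c)) w\<bar> \<le> K" using win unfolding window_set_def K_def by blast
        then show "c \<in> {- K..K}" by auto
        have "x i \<in> {c - 1..c + 1}" if i: "i \<in> I" for i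
        proof -
          have "\<bar>(x(w := c)) i - (x(w := c)) w\<bar> \<le> 1" using win i unfolding window_set_def I_def by blast
          then show ?thesis using i I(2) by (auto split: if_splits)
        qed
        then show "x \<in> (\<Pi>\<^sub>E i\<in>I. {c - 1..c + 1})" using x by (auto simp: space_PiM PiE_def)
      qed
      then show "indicator (window_set n D w) (x(w := c)) * f (x(w := c)) \<le>
          indicator {- K..K} c * (indicator (\<Pi>\<^sub>E i\<in>I. {c - 1..c + 1}) x *
           ennreal (q ^ card {p \<in> I \<times> I. x (fst p) + 1 < x (snd p)}))"
        unfolding feq by (cases "x(w := c) \<in> window_set n D w") auto
    qed
    also have "\<dots> \<le> indicator {- K..K} c * ennreal Z"
    proof (cases "c \<in> {- K..K}")
      case True
      have "(\<integral>\<^sup>+x. indicator (\<Pi>\<^sub>E i\<in>I. {c - 1..c + 1}) x *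
           ennreal (q ^ card {p \<in> I \<times> I. x (fst p) + 1 < x (snd p)}) \<partial>(\<Pi>\<^sub>M u\<in>I. lborel))
           \<le> ennreal ((real (card I) + 1) / qpoch q (card I))"
        by (rule window_integral_le[OF I(1) q])
      also have "\<dots> \<le> ennreal Z"
        unfolding Z_def using I(4) q qpoch_pos[of q n] qpoch_antimono[of q "card I" n]
        by (intro ennreal_leI frac_le) auto
      finally show ?thesis using True by simp
    qed simp
    finally show "(\<integral>\<^sup>+x. indicator (window_set n D w) (x(w := c)) * f (x(w := c)) \<partial>(\<Pi>\<^sub>M u\<in>I. lborel)) \<le>
        ennreal Z * indicator {- K..K} c" by (simp add: mult.commute)
  qed
  also have "\<dots> = ennreal Z * emeasure lborel {- K..K}"
    by (rule nn_integral_cmult_indicator) simp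
  also have "\<dots> = ennreal (2 * K * Z)"
  proof -
    have "0 \<le> K" by (simp add: K_def)
    then have "emeasure lborel {- K..K} = ennreal (2 * K)" by (subst emeasure_lborel_Icc) auto
    then show ?thesis using Z0 \<open>0 \<le> K\<close> by (simp add: ennreal_mult[symmetric] mult.commute)
  qed
  finally show ?thesis unfolding f_def K_def Z_def I_def[symmetric] unfolding I(3) I_def[symmetric] .
qed

text \<open>Expectation and volume are exchanged. For a fixed point \<open>x\<close> the pairs that
  must not be edges form a fixed set, so the probability is a power of \<open>1 - p\<close>.\<close>

lemma expected_profile_volume_le:
  assumes D: "D \<subseteq> {1..n}" "Dp \<subseteq> D" and w: "w \<in> {1..n} - D" and p: "0 < p" "p < 1"
  shows "(\<integral>\<^sup>+E. emeasure (\<Pi>\<^sub>M u\<in>{1..n} - D. lborel) (profile_set n E D Dp w) \<partial>gnp n p) \<le>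
           ennreal ((1 - p) ^ (n div 4 * card D) * (2 * ((real n)\<^sup>2 + 1) * ((real n + 1) / qpoch (1 - p) n)))"
proof -
  let ?M = "\<Pi>\<^sub>M u\<in>{1..n} - D. (lborel :: real measure)" and ?g = "gnp n p"
  define q where "q = 1 - p"
  have q: "0 < q" "q < 1" using p by (auto simp: q_def)
  note fs = finite_set_pmf_gnp[of n p]
  note pm [measurable] = sets_profile_set[OF w D]
  define c where "c x = card {p \<in> ({1..n} - D - {w}) \<times> ({1..n} - D - {w}). x (fst p) + 1 < x (snd p)}"
    for x :: "nat \<Rightarrow> real"
  define m where "m = n div 4 * card D"
  have "(\<integral>\<^sup>+E. emeasure ?M (profile_set n E D Dp w) \<partial>?g) =
      (\<Sum>E\<in>set_pmf ?g. emeasure ?M (profile_set n E D Dp w) * ennreal (pmf ?g E))"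
    by (intro nn_integral_measure_pmf_finite[OF fs]) simp
  also have "\<dots> = (\<Sum>E\<in>set_pmf ?g. \<integral>\<^sup>+x. indicator (profile_set n E D Dp w) x * ennreal (pmf ?g E) \<partial>?M)"
    unfolding nn_integral_multc[OF borel_measurable_indicator[OF pm]] nn_integral_indicator[OF pm] ..
  also have "\<dots> = (\<integral>\<^sup>+x. (\<Sum>E\<in>set_pmf ?g. indicator (profile_set n E D Dp w) x * ennreal (pmf ?g E)) \<partial>?M)"
    by (rule nn_integral_sum[symmetric]) measurable
  also have "\<dots> \<le> (\<integral>\<^sup>+x. ennreal (q ^ m) * (indicator (window_set n D w) x * ennreal (q ^ c x)) \<partial>?M)"
  proof (rule nn_integral_mono)
    fix x
    show "(\<Sum>E\<in>set_pmf ?g. indicator (profile_set n E D Dp w) x * ennreal (pmf ?g E)) \<le>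
        ennreal (q ^ m) * (indicator (window_set n D w) x * ennreal (q ^ c x))"
    proof (cases "x \<in> window_set n D w")
      case True
      define B where "B = (\<lambda>p. {fst p, snd p}) ` forced_non_edges n D Dp w x"
      have "fst p \<noteq> snd p" if "p \<in> forced_non_edges n D Dp w x" for p
        using that D by (auto simp: forced_non_edges_def)
      then have Bsub: "B \<subseteq> all_pairs {1..n}"
        using forced_non_edges_subset[OF D, of w x] unfolding B_def all_pairs_def by fastforce
      have "(\<Sum>E\<in>set_pmf ?g. indicator (profile_set n E D Dp w) x * ennreal (pmf ?g E)) =
         (\<Sum>E\<in>set_pmf ?g. indicator {E. E \<inter> B = {}} E * ennreal (pmf ?g E))"
        using True by (intro sum.cong refl) (auto simp: profile_set_def B_def indicator_def)
      also have "\<dots> = (\<integral>\<^sup>+E. indicator {E. E \<inter> B = {}} E \<partial>?g)"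
        by (intro nn_integral_measure_pmf_finite[OF fs, symmetric]) simp
      also have "\<dots> = ennreal (measure_pmf.prob ?g {E. E \<inter> B = {}})"
        by (simp add: measure_pmf.emeasure_eq_measure)
      also have "measure_pmf.prob ?g {E. E \<inter> B = {}} = q ^ card B"
        unfolding q_def using p by (intro prob_gnp_avoid[OF Bsub]) auto
      also have "ennreal (q ^ card B) \<le> ennreal (q ^ (c x + m))"
        unfolding B_def c_def m_def using card_forced_non_edges_ge[OF D True] q
        by (intro ennreal_leI power_decreasing) auto
      also have "\<dots> = ennreal (q ^ m) * (indicator (window_set n D w) x * ennreal (q ^ c x))"
        using True q by (simp add: power_add ennreal_mult mult.commute)
      finally show ?thesis .
    qed (simp add: profile_set_def)
  qed
  also have "\<dots> = ennreal (q ^ m) * (\<integral>\<^sup>+x. indicator (window_set n D w) x * ennreal (q ^ c x) \<partial>?M)"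
  proof (rule nn_integral_cmult)
    let ?I = "{1..n} - D - {w}"
    have alt: "q ^ c x = (\<Prod>p\<in>?I \<times> ?I. if x (fst p) + 1 < x (snd p) then q else 1)" for x
      unfolding c_def by (subst power_card_eq_prod) auto
    have "(\<lambda>x. if x (fst p) + 1 < x (snd p) then q else 1) \<in> borel_measurable ?M" if p: "p \<in> ?I \<times> ?I" for p
    proof -
      have 1: "fst p \<in> {1..n} - D" and 2: "snd p \<in> {1..n} - D" using p by auto
      have [measurable]: "(\<lambda>x. x (fst p)) \<in> borel_measurable ?M"
        using measurable_component_singleton[OF 1, of "\<lambda>_. lborel"] by simp
      have [measurable]: "(\<lambda>x. x (snd p)) \<in> borel_measurable ?M"
        using measurable_component_singleton[OF 2, of "\<lambda>_. lborel"] by simp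
      show ?thesis by measurable
    qed
    then have [measurable]: "(\<lambda>x. q ^ c x) \<in> borel_measurable ?M"
      unfolding alt by (rule borel_measurable_prod)
    note [measurable] = sets_window_set[OF w]
    show "(\<lambda>x. indicator (window_set n D w) x * ennreal (q ^ c x)) \<in> borel_measurable ?M"
      by measurable
  qed
  also have "\<dots> \<le> ennreal (q ^ m) * ennreal (2 * ((real n)\<^sup>2 + 1) * ((real n + 1) / qpoch q n))"
    unfolding c_def by (intro mult_left_mono window_set_integral_le[OF w D(1) q]) simp
  also have "\<dots> = ennreal (q ^ m * (2 * ((real n)\<^sup>2 + 1) * ((real n + 1) / qpoch q n)))"
    using q by (intro ennreal_mult[symmetric] mult_nonneg_nonneg divide_nonneg_nonneg)
      (auto simp: less_imp_le[OF qpoch_pos])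
  finally show ?thesis unfolding q_def m_def .
qed

lemma sum_Pow_power_card:
  fixes a :: real
  assumes "finite A"
  shows "(\<Sum>X\<in>Pow A. a ^ card X) = (1 + a) ^ card A"
  using prod_add[OF assms, of "\<lambda>_. a" "\<lambda>_. 1"] by (simp add: add.commute)

text \<open>Markov's inequality. The 4 per exceptional vertex is 2 for integrating it out times 2
  for its side of the window, the factor \<open>n\<close> counts the choices of \<open>w\<close>,
  and summing over all sets \<open>D\<close> of any size produces the \<open>n\<close>-th
  power.\<close>

lemma prob_polytope_volume_ge:
  assumes \<delta>: "0 < \<delta>" "\<delta> \<le> 1/8" and p: "0 < p" "p < 1" and n: "1 \<le> n" and a: "0 < a"
  shows "measure_pmf.prob (gnp n p)
           {E. cut_dense \<delta> n E \<and> a \<le> polytope_volume {1..n} E (chosen_roots {1..n} E)} \<le>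
         real n * (2 * ((real n)\<^sup>2 + 1) * ((real n + 1) / qpoch (1 - p) n)) *
           (1 + 4 * (1 - p) ^ (n div 4)) ^ n / a"
proof -
  let ?g = "gnp n p" and ?V = "{1..n}"
  define q where "q = 1 - p"
  have q: "0 < q" "q < 1" using p by (auto simp: q_def)
  define K where "K = 2 * ((real n)\<^sup>2 + 1) * ((real n + 1) / qpoch q n)"
  have K0: "0 \<le> K" using qpoch_pos[of q n] q by (simp add: K_def)
  define Y where "Y = {E. cut_dense \<delta> n E \<and> a \<le> polytope_volume ?V E (chosen_roots ?V E)}"
  define S where "S E = (\<Sum>(D, Dp, w)\<in>profiles n.
           2 ^ card D * emeasure (\<Pi>\<^sub>M u\<in>?V - D. (lborel :: real measure)) (profile_set n E D Dp w))" for E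
  have "ennreal a * emeasure ?g Y = (\<integral>\<^sup>+E. ennreal a * indicator Y E \<partial>?g)"
    by (simp add: nn_integral_cmult)
  also have "\<dots> \<le> (\<integral>\<^sup>+E. S E \<partial>?g)"
  proof (rule nn_integral_mono_AE, rule AE_pmfI)
    fix E assume E: "E \<in> set_pmf ?g"
    show "ennreal a * indicator Y E \<le> S E"
    proof (cases "E \<in> Y")
      case True
      have "ennreal a \<le> ennreal (polytope_volume ?V E (chosen_roots ?V E))"
        using True by (intro ennreal_leI) (simp add: Y_def)
      also have "\<dots> \<le> S E"
        unfolding S_def using True \<delta> n
        by (intro polytope_volume_le_sum_profiles[OF fin_graph_gnp[OF E] is_root_set_chosen]) (auto simp: Y_def)
      finally show ?thesis using True by simp
    qed simp
  qed
  also have "\<dots> = (\<Sum>(D, Dp, w)\<in>profiles n. \<integral>\<^sup>+E. 2 ^ card D *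
       emeasure (\<Pi>\<^sub>M u\<in>?V - D. (lborel :: real measure)) (profile_set n E D Dp w) \<partial>?g)"
    unfolding S_def case_prod_unfold by (rule nn_integral_sum) simp
  also have "\<dots> \<le> (\<Sum>(D, Dp, w)\<in>profiles n. ennreal (2 ^ card D * (q ^ (n div 4 * card D) * K)))"
  proof (rule sum_mono)
    fix t assume t: "t \<in> profiles n"
    obtain D Dp w where teq: "t = (D, Dp, w)" by (cases t)
    have D: "D \<subseteq> ?V" "Dp \<subseteq> D" "w \<in> ?V - D" using t teq by (auto simp: profiles_def)
    have two: "(2 :: ennreal) ^ k = ennreal (2 ^ k)" for k by (simp add: ennreal_power[symmetric])
    have "(\<integral>\<^sup>+E. 2 ^ card D * emeasure (\<Pi>\<^sub>M u\<in>?V - D. (lborel :: real measure)) (profile_set n E D Dp w) \<partial>?g) =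
       2 ^ card D * (\<integral>\<^sup>+E. emeasure (\<Pi>\<^sub>M u\<in>?V - D. (lborel :: real measure)) (profile_set n E D Dp w) \<partial>?g)"
      by (rule nn_integral_cmult) simp
    also have "\<dots> \<le> 2 ^ card D * ennreal (q ^ (n div 4 * card D) * K)"
      unfolding q_def K_def by (intro mult_left_mono expected_profile_volume_le D p) simp
    also have "\<dots> = ennreal (2 ^ card D * (q ^ (n div 4 * card D) * K))"
      unfolding two using q K0 by (intro ennreal_mult[symmetric]) auto
    finally show "(case t of (D, Dp, w) \<Rightarrow> \<integral>\<^sup>+E. 2 ^ card D *
       emeasure (\<Pi>\<^sub>M u\<in>?V - D. (lborel :: real measure)) (profile_set n E D Dp w) \<partial>?g) \<le>
       (case t of (D, Dp, w) \<Rightarrow> ennreal (2 ^ card D * (q ^ (n div 4 * card D) * K)))"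
      by (simp add: teq)
  qed
  also have "\<dots> = ennreal (\<Sum>(D, Dp, w)\<in>profiles n. 2 ^ card D * (q ^ (n div 4 * card D) * K))"
    unfolding case_prod_unfold using q K0 by (intro sum_ennreal) auto
  also have "\<dots> \<le> ennreal (real n * K * (1 + 4 * q ^ (n div 4)) ^ n)"
  proof (rule ennreal_leI)
    have "(\<Sum>(D, Dp, w)\<in>profiles n. 2 ^ card D * (q ^ (n div 4 * card D) * K)) =
        (\<Sum>D\<in>Pow ?V. \<Sum>t\<in>Pow D \<times> (?V - D). 2 ^ card D * (q ^ (n div 4 * card D) * K))"
      unfolding profiles_def case_prod_unfold
      by (subst sum.Sigma) (auto simp: finite_subset case_prod_unfold)
    also have "\<dots> \<le> (\<Sum>D\<in>Pow ?V. real n * K * (4 * q ^ (n div 4)) ^ card D)"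
    proof (rule sum_mono)
      fix D assume D: "D \<in> Pow ?V"
      then have finD: "finite D" by (auto intro: finite_subset)
      have "card (?V - D) \<le> card ?V" by (intro card_mono) auto
      then have "card (?V - D) \<le> n" by simp
      have "(\<Sum>t\<in>Pow D \<times> (?V - D). 2 ^ card D * (q ^ (n div 4 * card D) * K)) =
          2 ^ card D * real (card (?V - D)) * (2 ^ card D * (q ^ (n div 4 * card D) * K))"
        using finD by (simp add: card_cartesian_product card_Pow)
      also have "\<dots> \<le> 2 ^ card D * real n * (2 ^ card D * (q ^ (n div 4 * card D) * K))"
        using \<open>card (?V - D) \<le> n\<close> q K0 by (intro mult_right_mono mult_left_mono mult_nonneg_nonneg) auto
      also have "\<dots> = real n * K * (2 ^ card D * 2 ^ card D * q ^ (n div 4 * card D))" by (simp add: mult_ac)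
      also have "2 ^ card D * 2 ^ card D * q ^ (n div 4 * card D) = (4 * q ^ (n div 4)) ^ card D"
      proof -
        have "(2::real) ^ card D * 2 ^ card D = 4 ^ card D" by (simp flip: power_mult_distrib)
        then show ?thesis by (simp add: power_mult power_mult_distrib)
      qed
      finally show "(\<Sum>t\<in>Pow D \<times> (?V - D). 2 ^ card D * (q ^ (n div 4 * card D) * K)) \<le>
          real n * K * (4 * q ^ (n div 4)) ^ card D" .
    qed
    also have "\<dots> = real n * K * (1 + 4 * q ^ (n div 4)) ^ n"
      unfolding sum_distrib_left[symmetric] by (subst sum_Pow_power_card) auto
    finally show "(\<Sum>(D, Dp, w)\<in>profiles n. 2 ^ card D * (q ^ (n div 4 * card D) * K)) \<le>
        real n * K * (1 + 4 * q ^ (n div 4)) ^ n" .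
  qed
  finally have "ennreal (a * measure_pmf.prob ?g Y) \<le> ennreal (real n * K * (1 + 4 * q ^ (n div 4)) ^ n)"
    using a by (simp add: measure_pmf.emeasure_eq_measure ennreal_mult)
  then have "a * measure_pmf.prob ?g Y \<le> real n * K * (1 + 4 * q ^ (n div 4)) ^ n"
    using q K0 by (subst (asm) ennreal_le_iff) auto
  then have "measure_pmf.prob ?g Y \<le> real n * K * (1 + 4 * q ^ (n div 4)) ^ n / a"
    by (metis a mult.commute pos_le_divide_eq)
  then show ?thesis unfolding Y_def K_def q_def .
qed

section \<open>Growth constants\<close>

text \<open>Handshake lemma, as an inequality because only neighbours inside \<open>F\<close>
  count.\<close>

lemma sum_degrees_le:
  assumes "finite F" "finite E"
  shows "(\<Sum>v\<in>F. card {u \<in> F. {u, v} \<in> E}) \<le> 2 * card E"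
proof -
  have two: "card {(v, u). {u, v} = e} \<le> 2 \<and> finite {(v, u). {u, v} = e}" for e :: "'a set"
  proof (cases "\<exists>a b. e = {a, b}")
    case True
    then obtain a b where "e = {a, b}" by blast
    then have sub: "{(v, u). {u, v} = e} \<subseteq> {(a, b), (b, a)}" by (auto simp: doubleton_eq_iff)
    have "card {(a, b), (b, a)} \<le> 2" by (cases "a = b") auto
    then show ?thesis using card_mono[OF _ sub] finite_subset[OF sub] by auto
  next
    case False
    then have "{(v, u). {u, v} = e} = {}" by auto
    then show ?thesis by (simp only: card.empty) simp
  qed
  have "(\<Sum>v\<in>F. card {u \<in> F. {u, v} \<in> E}) = card (SIGMA v:F. {u \<in> F. {u, v} \<in> E})"
    using assms by (subst card_SigmaI) auto
  also have "\<dots> \<le> card (\<Union>e\<in>E. {(v, u). {u, v} = e})"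
    using assms two by (intro card_mono finite_UN_I) auto
  also have "\<dots> \<le> (\<Sum>e\<in>E. card {(v, u). {u, v} = e})" using assms by (intro card_UN_le) auto
  also have "\<dots> \<le> (\<Sum>e\<in>E. 2)" using two by (intro sum_mono) auto
  finally show ?thesis by simp
qed

lemma ln_growth_constant:
  assumes "fin_graph V E"
  shows "ln (growth_constant V E) = ln (polytope_volume V E (chosen_roots V E)) / real (free_dim V E)"
  using polytope_volume_ge_1[OF assms is_root_set_chosen]
  by (simp add: growth_constant_def ln_powr)

text \<open>An edge to a root at 0 demands only \<open>\<bar>y u\<bar> \<le> 1\<close>, which is why
  \<open>lipschitz_volume_lower_bound\<close> carries that extra condition.\<close>

lemma polytope_volume_ge_exp:
  fixes d h :: real and J :: nat and om :: "nat \<Rightarrow> real"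
  assumes G: "fin_graph V E" and root: "is_root_set V E R" and h: "0 < h" and d: "0 < d"
    and om: "\<And>j. om j = h / (1 - exp (- h) ^ j)"
    and C: "C = 2 * (\<Sum>j=1..J. om j)" and Cd: "2 * C \<le> d"
  shows "exp (\<Sum>v\<in>V - R. (h * (\<Sum>j=1..J. - ln (1 - exp (- h) ^ j)) + real J * h
             - (\<Sum>j=1..J. om j * (1 - (1 - real j * h / d) ^ card {u \<in> V - R. {u, v} \<in> E}))) / d - (C / d)\<^sup>2)
         \<le> polytope_volume V E R"
proof -
  have V: "finite V" and E: "E \<subseteq> all_pairs V" using G by (auto simp: fin_graph_def)
  have R: "R \<subseteq> V" using root by (simp add: is_root_set_def)
  have noloop: "{v} \<notin> E" for v using E by (auto simp: all_pairs_eq)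
  let ?F = "V - R" and ?M = "\<Pi>\<^sub>M v\<in>V - R. (lborel :: real measure)"
  let ?X = "{y \<in> space ?M. (\<forall>u\<in>?F. \<forall>v\<in>?F. {u, v} \<in> E \<longrightarrow> \<bar>y u - y v\<bar> \<le> 1) \<and> (\<forall>u\<in>?F. \<bar>y u\<bar> \<le> 1)}"
  let ?S = "\<Sum>v\<in>?F. (h * (\<Sum>j=1..J. - ln (1 - exp (- h) ^ j)) + real J * h
             - (\<Sum>j=1..J. om j * (1 - (1 - real j * h / d) ^ card {u \<in> ?F. {u, v} \<in> E}))) / d - (C / d)\<^sup>2"
  have "ennreal (exp ?S) \<le> emeasure ?M ?X"
    using V by (intro lipschitz_volume_lower_bound[OF _ noloop h d om C Cd]) auto
  also have "\<dots> \<le> emeasure ?M ((\<lambda>x. restrict x ?F) ` lipschitz_polytope V E R)"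
  proof (rule emeasure_mono)
    show "?X \<subseteq> (\<lambda>x. restrict x ?F) ` lipschitz_polytope V E R"
    proof
      fix y assume y: "y \<in> ?X"
      have "\<bar>(if u \<in> R then 0 else y u) - (if v \<in> R then 0 else y v)\<bar> \<le> 1"
        if "u \<in> V" "v \<in> V" "{u, v} \<in> E" for u v using y that by auto
      then show "y \<in> (\<lambda>x. restrict x ?F) ` lipschitz_polytope V E R"
        unfolding projected_polytope[OF R] using y by blast
    qed
  qed (rule sets_projected_polytope[OF V R])
  also have "\<dots> = ennreal (polytope_volume V E R)"
    by (rule emeasure_projected_polytope[OF G root])
  finally show ?thesis using polytope_volume_ge_1[OF G root] by (simp add: ennreal_le_iff)
qed

text \<open>The average of the convex function \<open>k \<mapsto> t ^ k\<close> over the degrees is bounded below by its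
  tangent at \<open>k = d\<close>, so only the number of edges matters.\<close>

lemma ln_growth_constant_ge:
  assumes "\<epsilon> > 0"
  shows "\<exists>\<delta>>0. \<exists>d0>0. \<forall>d\<ge>d0. \<forall>V :: 'a set. \<forall>E. fin_graph V E \<longrightarrow> 0 < free_dim V E \<longrightarrow>
           2 * real (card E) \<le> (1 + \<delta>) * d * real (free_dim V E) \<longrightarrow>
           pi\<^sup>2 / 6 - \<epsilon> \<le> d * ln (growth_constant V E)"
proof -
  obtain h J where h: "0 < h" and hA: "pi\<^sup>2 / 6 - \<epsilon> / 3 \<le> h * (\<Sum>j=1..J. - ln (1 - exp (- h) ^ j))"
    using ex_step_size_ge[of "\<epsilon> / 3"] assms by auto
  define q where "q = exp (- h)"
  have q: "0 < q" "q < 1" using h by (auto simp: q_def)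
  define om where "om j = h / (1 - q ^ j)" for j
  define C where "C = 2 * (\<Sum>j=1..J. om j)"
  define A where "A = h * (\<Sum>j=1..J. - ln (1 - q ^ j))"
  have qj: "0 < q ^ j" "q ^ j < 1" if "1 \<le> j" for j
    using that q power_less_one_iff[of q j] by auto
  have om0: "0 < om j" if "1 \<le> j" for j using qj[OF that] h by (simp add: om_def)
  have omq: "om j * (1 - q ^ j) = h" if "1 \<le> j" for j using qj[OF that] by (simp add: om_def)
  \<comment> \<open>Sensitivity to the number of edges: an average degree of (1 + \<delta>) d
    instead of d lowers the limiting bound by \<delta> B.\<close>
  define B where "B = (\<Sum>j=1..J. om j * (q ^ j * (real j * h)))"
  have B0: "0 \<le> B" unfolding B_def using om0 q h by (intro sum_nonneg mult_nonneg_nonneg) (auto simp: less_imp_le)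
  define \<delta> where "\<delta> = \<epsilon> / (3 * (B + 1))"
  have \<delta>: "0 < \<delta>" using assms B0 by (simp add: \<delta>_def)
  have \<delta>B: "\<delta> * B < \<epsilon> / 2"
  proof -
    have "\<delta> * B \<le> \<delta> * (B + 1)" using \<delta> by simp
    also have "\<dots> = \<epsilon> / 3"
      using B0 by (simp only: \<delta>_def times_divide_eq_left) (subst nonzero_mult_divide_mult_cancel_right, auto)
    finally show ?thesis using assms by linarith
  qed
  \<comment> \<open>With t = 1 - j h / d, this is the tangent of t^k at k = d, evaluated at k = (1 +
    \<delta>) d.\<close>
  define r where "r d j = (1 - real j * h / d) powr d * (1 + \<delta> * (d * ln (1 - real j * h / d)))" for d j
  have lim: "((\<lambda>d. r d j) \<longlongrightarrow> q ^ j * (1 - \<delta> * (real j * h))) at_top" for j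
  proof -
    define c where "c = real j * h"
    have "((\<lambda>d. (1 - c / d) powr d * (1 + \<delta> * (d * ln (1 - c / d)))) \<longlongrightarrow> exp (- c) * (1 + \<delta> * (- c))) at_top"
    proof (intro tendsto_intros)
      show l: "((\<lambda>d. d * ln (1 - c / d)) \<longlongrightarrow> - c) at_top" by real_asymp
      show "((\<lambda>d. (1 - c / d) powr d) \<longlongrightarrow> exp (- c)) at_top" by real_asymp
    qed
    moreover have "exp (- c) = q ^ j" by (simp add: c_def q_def exp_of_nat_mult[symmetric])
    ultimately show ?thesis by (simp add: r_def c_def)
  qed
  have "((\<lambda>d. A + real J * h - (\<Sum>j=1..J. om j * (1 - r d j)) - C\<^sup>2 / d) \<longlongrightarrow>
      A + real J * h - (\<Sum>j=1..J. om j * (1 - q ^ j * (1 - \<delta> * (real j * h)))) - 0) at_top"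
    by (intro tendsto_intros lim) real_asymp
  \<comment> \<open>The choice of \<open>om\<close> makes every om j (1 - q^j) equal to
    \<open>h\<close>; their sum cancels \<open>J * h\<close> and leaves the entropy term
    \<open>A\<close>.\<close>
  moreover have "A + real J * h - (\<Sum>j=1..J. om j * (1 - q ^ j * (1 - \<delta> * (real j * h)))) - 0 = A - \<delta> * B"
  proof -
    have "(\<Sum>j=1..J. om j * (1 - q ^ j * (1 - \<delta> * (real j * h)))) =
        (\<Sum>j=1..J. om j * (1 - q ^ j) + \<delta> * (om j * (q ^ j * (real j * h))))"
      by (intro sum.cong refl) (simp add: algebra_simps)
    also have "\<dots> = (\<Sum>j=1..J. h) + \<delta> * B"
      unfolding sum.distrib B_def sum_distrib_left using omq by simp
    finally show ?thesis by simp
  qed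
  moreover have "pi\<^sup>2 / 6 - \<epsilon> < A - \<delta> * B"
    using hA \<delta>B assms unfolding A_def q_def by linarith
  ultimately have "eventually (\<lambda>d. pi\<^sup>2 / 6 - \<epsilon> < A + real J * h - (\<Sum>j=1..J. om j * (1 - r d j)) - C\<^sup>2 / d) at_top"
    by (auto intro: order_tendstoD(1))
  then obtain d1 where d1: "\<And>d. d \<ge> d1 \<Longrightarrow>
      pi\<^sup>2 / 6 - \<epsilon> < A + real J * h - (\<Sum>j=1..J. om j * (1 - r d j)) - C\<^sup>2 / d"
    by (auto simp: eventually_at_top_linorder)
  \<comment> \<open>The entry \<open>2 * C\<close> meets the hypothesis of the volume bound, and
    \<open>2 * J * h\<close> keeps 1 - j h / d at least 1/2.\<close>
  define d0 where "d0 = Max {d1, 2 * C, 2 * real J * h, 1}"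
  have "pi\<^sup>2 / 6 - \<epsilon> \<le> d * ln (growth_constant V E)"
    if d: "d \<ge> d0" and G: "fin_graph V E" and N0: "0 < free_dim V E"
      and cE: "2 * real (card E) \<le> (1 + \<delta>) * d * real (free_dim V E)" for d and V :: "'a set" and E
  proof -
    have dd: "d1 \<le> d" "2 * C \<le> d" "2 * real J * h \<le> d" "1 \<le> d" using d by (auto simp: d0_def)
    have V: "finite V" and E: "E \<subseteq> all_pairs V" using G by (auto simp: fin_graph_def)
    have finE: "finite E" using E finite_all_pairs[OF V] by (rule finite_subset)
    define R where "R = chosen_roots V E"
    have root: "is_root_set V E R" unfolding R_def by (rule is_root_set_chosen)
    define F where "F = V - R"
    define N where "N = real (free_dim V E)"
    have F: "finite F" "real (card F) = N" using V card_non_roots[OF V root] by (auto simp: F_def N_def)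
    have N: "0 < N" using N0 by (simp add: N_def)
    define dg where "dg v = card {u \<in> F. {u, v} \<in> E}" for v
    have "real (\<Sum>v\<in>F. dg v) \<le> real (2 * card E)"
      unfolding dg_def using sum_degrees_le[OF F(1) finE] by (rule of_nat_mono)
    then have sdg: "(\<Sum>v\<in>F. real (dg v)) \<le> (1 + \<delta>) * d * N" using cE by (simp add: N_def)
    have avg: "N * r d j \<le> (\<Sum>v\<in>F. (1 - real j * h / d) ^ dg v)" if j: "j \<in> {1..J}" for j
    proof -
      define t where "t = 1 - real j * h / d"
      have "real j * h \<le> real J * h" using j h by simp
      then have "2 * (real j * h) \<le> d" using dd by linarith
      then have t: "1/2 \<le> t" "t < 1" using dd j h by (auto simp: t_def field_simps)
      define l where "l = - ln t"
      have l: "0 < l" using t by (simp add: l_def)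
      have tk: "t ^ k \<ge> t powr d * (1 - (real k - d) * l)" for k
      proof -
        have "t ^ k = t powr d * exp (- ((real k - d) * l))"
          using t by (simp add: powr_realpow[symmetric] powr_def l_def exp_add[symmetric] algebra_simps)
        moreover have "1 - (real k - d) * l \<le> exp (- ((real k - d) * l))"
          using exp_ge_add_one_self[of "- ((real k - d) * l)"] by simp
        ultimately show ?thesis using t by (simp add: mult_left_mono)
      qed
      have r: "r d j = t powr d * (1 - \<delta> * (d * l))" by (simp add: r_def t_def l_def)
      have "N * r d j = t powr d * (N - \<delta> * d * N * l)" unfolding r by (simp add: algebra_simps)
      \<comment> \<open>Since t < 1 the tangent has negative slope, so an upper bound on the sum of
        the degrees is enough.\<close>
      also have "\<dots> \<le> t powr d * (N - ((\<Sum>v\<in>F. real (dg v)) - d * N) * l)"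
      proof (intro mult_left_mono diff_mono order.refl mult_right_mono)
        show "(\<Sum>v\<in>F. real (dg v)) - d * N \<le> \<delta> * d * N" using sdg by (simp add: algebra_simps)
      qed (use l in auto)
      also have "\<dots> = (\<Sum>v\<in>F. t powr d * (1 - (real (dg v) - d) * l))"
        unfolding sum_distrib_left[symmetric] sum_subtractf sum_distrib_right[symmetric]
        using F by (simp add: algebra_simps)
      also have "\<dots> \<le> (\<Sum>v\<in>F. t ^ dg v)" by (intro sum_mono tk)
      finally show ?thesis by (simp add: t_def)
    qed
    define S where "S = (\<Sum>v\<in>F. (A + real J * h
             - (\<Sum>j=1..J. om j * (1 - (1 - real j * h / d) ^ dg v))) / d - (C / d)\<^sup>2)"
    have "exp S \<le> polytope_volume V E R"
      unfolding S_def F_def A_def q_def dg_def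
      using dd h om_def C_def by (intro polytope_volume_ge_exp[OF G root]) (auto simp: q_def)
    then have "S \<le> ln (polytope_volume V E R)"
      using polytope_volume_ge_1[OF G root] by (subst ln_ge_iff) auto
    then have gc: "S / N \<le> ln (growth_constant V E)"
      unfolding ln_growth_constant[OF G] R_def[symmetric] N_def[symmetric]
      using N by (intro divide_right_mono) auto
    have "N * (A + real J * h - (\<Sum>j=1..J. om j * (1 - r d j))) =
        N * (A + real J * h) - (\<Sum>j=1..J. om j * (N - N * r d j))"
      by (simp add: algebra_simps sum_distrib_left)
    also have "\<dots> \<le> N * (A + real J * h) - (\<Sum>j=1..J. om j * (N - (\<Sum>v\<in>F. (1 - real j * h / d) ^ dg v)))"
      using avg om0 by (intro diff_mono order.refl sum_mono mult_left_mono) (auto simp: less_imp_le)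
    also have "\<dots> = (\<Sum>v\<in>F. A + real J * h - (\<Sum>j=1..J. om j * (1 - (1 - real j * h / d) ^ dg v)))"
    proof -
      have "(\<Sum>v\<in>F. \<Sum>j=1..J. om j * (1 - (1 - real j * h / d) ^ dg v)) =
          (\<Sum>j=1..J. \<Sum>v\<in>F. om j * (1 - (1 - real j * h / d) ^ dg v))" by (rule sum.swap)
      also have "\<dots> = (\<Sum>j=1..J. om j * (N - (\<Sum>v\<in>F. (1 - real j * h / d) ^ dg v)))"
        unfolding sum_distrib_left[symmetric] sum_subtractf using F by simp
      finally show ?thesis using F by (simp add: sum_subtractf)
    qed
    finally have 1: "N * (A + real J * h - (\<Sum>j=1..J. om j * (1 - r d j))) \<le>
        (\<Sum>v\<in>F. A + real J * h - (\<Sum>j=1..J. om j * (1 - (1 - real j * h / d) ^ dg v)))" .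
    have 2: "S = (\<Sum>v\<in>F. A + real J * h - (\<Sum>j=1..J. om j * (1 - (1 - real j * h / d) ^ dg v))) / d
        - N * (C / d)\<^sup>2"
    proof -
      have "(\<Sum>v\<in>F. f v / d - c) = (\<Sum>v\<in>F. f v) / d - N * c" for f c
        using F by (simp add: sum_subtractf sum_divide_distrib)
      then show ?thesis unfolding S_def .
    qed
    have "N * ((A + real J * h - (\<Sum>j=1..J. om j * (1 - r d j))) / d - (C / d)\<^sup>2) \<le> S"
      unfolding 2 using divide_right_mono[OF 1, of d] dd by (simp add: right_diff_distrib)
    then have "(A + real J * h - (\<Sum>j=1..J. om j * (1 - r d j))) / d - (C / d)\<^sup>2 \<le> S / N"
      using N by (simp add: pos_le_divide_eq mult.commute)
    then have "(A + real J * h - (\<Sum>j=1..J. om j * (1 - r d j))) / d - (C / d)\<^sup>2 \<le> ln (growth_constant V E)"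
      using gc by linarith
    then have "d * ((A + real J * h - (\<Sum>j=1..J. om j * (1 - r d j))) / d - (C / d)\<^sup>2) \<le> d * ln (growth_constant V E)"
      using dd by (intro mult_left_mono) auto
    moreover have "d * ((A + real J * h - (\<Sum>j=1..J. om j * (1 - r d j))) / d - (C / d)\<^sup>2) =
        A + real J * h - (\<Sum>j=1..J. om j * (1 - r d j)) - C\<^sup>2 / d"
    proof -
      have "d * (X / d - (C / d)\<^sup>2) = X - C\<^sup>2 / d" for X
        using dd by (simp add: right_diff_distrib power2_eq_square)
      then show ?thesis .
    qed
    ultimately show ?thesis using d1[OF dd(1)] by linarith
  qed
  moreover have "0 < d0" unfolding d0_def by (subst Max_gr_iff) auto
  ultimately show ?thesis using \<delta> by blast
qed

text \<open>The root function is constant along edges and fixes the roots, so two halves of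
  \<open>R\<close> have no edge between them. The added 2 absorbs the rounding of the
  halves.\<close>

lemma cut_dense_card_roots:
  assumes root: "is_root_set {1..n} E R" and cut: "cut_dense \<delta> n E"
  shows "real (card R) < 2 * \<delta> * real n + 2"
proof (rule ccontr)
  assume "\<not> ?thesis"
  then have big: "2 * \<delta> * real n + 2 \<le> real (card R)" by simp
  have R: "R \<subseteq> {1..n}" using root by (simp add: is_root_set_def)
  then have finR: "finite R" by (rule finite_subset) simp
  obtain rt where rt: "\<And>r. r \<in> R \<Longrightarrow> rt r = r"
      "\<And>u v. u \<in> {1..n} \<Longrightarrow> v \<in> {1..n} \<Longrightarrow> {u, v} \<in> E \<Longrightarrow> rt u = rt v"
    using ex_root_function[OF root] by blast
  obtain A where A: "A \<subseteq> R" "card A = card R div 2"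
    by (rule obtain_subset_with_card_n[of "card R div 2" R]) auto
  have cB: "card (R - A) = card R - card R div 2"
    using A finR by (simp add: card_Diff_subset finite_subset)
  have "real (card R) \<le> 2 * real (card R div 2) + 1" by linarith
  then have 1: "\<delta> * real n \<le> real (card A)" using big A by linarith
  have "card A \<le> card (R - A)" unfolding cB A(2) by linarith
  then have 2: "\<delta> * real n \<le> real (card (R - A))" using 1 by linarith
  have "A \<subseteq> {1..n}" "R - A \<subseteq> {1..n}" "A \<inter> (R - A) = {}" using A R by auto
  then obtain a b where ab: "a \<in> A" "b \<in> R - A" "{a, b} \<in> E"
    using cut 1 2 unfolding cut_dense_def by blast
  then have "rt a = rt b" using A R by (intro rt(2)) auto
  then show False using ab A rt(1)[of a] rt(1)[of b] by auto
qed

text \<open>Write 1 - d / n as exp (- b). Then b \<ge> d / n, and the bound of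
  \<open>qpoch_exp_ge\<close> increases with b.\<close>

lemma qpoch_one_minus_ge:
  assumes "0 < d" "d < real n"
  shows "exp (- (pi\<^sup>2 * real n / (6 * d))) \<le> qpoch (1 - d / real n) n"
proof -
  have n: "0 < real n" using assms by linarith
  define b where "b = - ln (1 - d / real n)"
  have q: "0 < 1 - d / real n" using assms n by (simp add: field_simps)
  have b: "d / real n \<le> b" using ln_le_minus_one[OF q] by (simp add: b_def)
  have dn: "0 < d / real n" using assms n by simp
  then have b0: "0 < b" using b by linarith
  have "pi\<^sup>2 / (6 * b) \<le> pi\<^sup>2 / (6 * (d / real n))"
    using b b0 dn by (intro divide_left_mono mult_pos_pos) auto
  also have "\<dots> = pi\<^sup>2 * real n / (6 * d)" by simp
  finally have "exp (- (pi\<^sup>2 * real n / (6 * d))) \<le> exp (- (pi\<^sup>2 / (6 * b)))" by simp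
  also have "\<dots> \<le> qpoch (exp (- b)) n" by (rule qpoch_exp_ge[OF b0])
  also have "exp (- b) = 1 - d / real n" using q by (simp add: b_def)
  finally show ?thesis .
qed

text \<open>In the exponent the slack \<epsilon> / d competes with 4 exp (- d / 8), the price of the
  exceptional vertices. For large d the slack wins, and the polynomial factor vanishes against it as
  n grows.\<close>

lemma prob_polytope_volume_ge_exp:
  assumes \<delta>: "0 < \<delta>" "\<delta> \<le> 1/8" and d: "0 < d" "d < real n" and n: "8 \<le> n"
  shows "measure_pmf.prob (gnp n (d / real n)) {E. cut_dense \<delta> n E \<and>
             exp (real n * (pi\<^sup>2 / 6 + \<epsilon>) / d) \<le> polytope_volume {1..n} E (chosen_roots {1..n} E)} \<le>
         2 * real n * ((real n)\<^sup>2 + 1) * (real n + 1) * exp (- (\<epsilon> / d - 4 * exp (- d / 8)) * real n)"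
proof -
  define q where "q = 1 - d / real n"
  have n0: "0 < real n" using n by simp
  have p: "0 < d / real n" "d / real n < 1" using d n0 by (auto simp: field_simps)
  define K where "K = real n * (2 * ((real n)\<^sup>2 + 1) * (real n + 1))"
  have K0: "0 \<le> K" by (simp add: K_def)
  have qp: "exp (- (pi\<^sup>2 * real n / (6 * d))) \<le> qpoch q n"
    unfolding q_def by (rule qpoch_one_minus_ge[OF d])
  have "q ^ (n div 4) \<le> exp (- (d / real n)) ^ (n div 4)"
    unfolding q_def using p exp_ge_add_one_self[of "- (d / real n)"] by (intro power_mono) auto
  also have "\<dots> = exp (- (real (n div 4) * (d / real n)))" by (simp flip: exp_of_nat_mult)
  also have "\<dots> \<le> exp (- d / 8)"
  proof -
    have "real n / 8 \<le> real (n div 4)" using n by linarith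
    then have "real n / 8 * (d / real n) \<le> real (n div 4) * (d / real n)"
      using p by (intro mult_right_mono) auto
    then show ?thesis using n0 by simp
  qed
  finally have qn: "q ^ (n div 4) \<le> exp (- d / 8)" .
  have pw: "(1 + 4 * q ^ (n div 4)) ^ n \<le> exp (4 * exp (- d / 8) * real n)"
  proof -
    have "(1 + 4 * q ^ (n div 4)) ^ n \<le> exp (4 * q ^ (n div 4)) ^ n"
      using p by (intro power_mono) (auto simp: q_def)
    also have "\<dots> = exp (real n * (4 * q ^ (n div 4)))" by (simp add: exp_of_nat_mult)
    also have "\<dots> \<le> exp (4 * exp (- d / 8) * real n)" using qn n0 by simp
    finally show ?thesis .
  qed
  have "measure_pmf.prob (gnp n (d / real n)) {E. cut_dense \<delta> n E \<and>
      exp (real n * (pi\<^sup>2 / 6 + \<epsilon>) / d) \<le> polytope_volume {1..n} E (chosen_roots {1..n} E)} \<le>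
      real n * (2 * ((real n)\<^sup>2 + 1) * ((real n + 1) / qpoch q n)) * (1 + 4 * q ^ (n div 4)) ^ n /
      exp (real n * (pi\<^sup>2 / 6 + \<epsilon>) / d)"
    unfolding q_def using n by (intro prob_polytope_volume_ge[OF \<delta> p]) auto
  also have "\<dots> = K / qpoch q n * (1 + 4 * q ^ (n div 4)) ^ n / exp (real n * (pi\<^sup>2 / 6 + \<epsilon>) / d)"
    by (simp add: K_def)
  also have "\<dots> \<le> K / exp (- (pi\<^sup>2 * real n / (6 * d))) * exp (4 * exp (- d / 8) * real n) /
      exp (real n * (pi\<^sup>2 / 6 + \<epsilon>) / d)"
    using K0 qp pw p by (intro divide_right_mono mult_mono divide_left_mono mult_pos_pos)
      (auto simp: q_def intro: less_le_trans[OF exp_gt_zero])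
  also have "\<dots> = K * exp (pi\<^sup>2 * real n / (6 * d) + 4 * exp (- d / 8) * real n - real n * (pi\<^sup>2 / 6 + \<epsilon>) / d)"
  proof -
    have "K / exp (- a) * exp b / exp c = K * exp (a + b - c)" for a b c
      by (simp add: exp_add exp_diff exp_minus field_simps)
    then show ?thesis .
  qed
  also have "pi\<^sup>2 * real n / (6 * d) + 4 * exp (- d / 8) * real n - real n * (pi\<^sup>2 / 6 + \<epsilon>) / d =
      - (\<epsilon> / d - 4 * exp (- d / 8)) * real n"
    using d by (simp add: field_simps)
  finally show ?thesis by (simp add: K_def mult_ac)
qed

lemma ln_one_plus_times_gt:
  fixes \<delta> :: real
  assumes "0 < \<delta>"
  shows "\<delta> < (1 + \<delta>) * ln (1 + \<delta>)"
proof -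
  define x where "x = 1 / (1 + \<delta>)"
  have x: "0 < x" "x \<noteq> 1" "(1 + \<delta>) * x = 1" using assms by (auto simp: x_def)
  have "ln x \<noteq> x - 1" using ln_eq_minus_one[OF x(1)] x(2) by blast
  then have "ln x < x - 1" using ln_le_minus_one[OF x(1)] by linarith
  moreover have "ln x = - ln (1 + \<delta>)" using assms by (simp add: x_def ln_div)
  ultimately have "(1 + \<delta>) * (1 - x) < (1 + \<delta>) * ln (1 + \<delta>)"
    using assms by (intro mult_strict_left_mono) auto
  then show ?thesis using x(3) by (simp add: right_diff_distrib)
qed

text \<open>Three events are bad: too many edges, a missing cut, and a large volume on a cut-dense
  graph. Outside them the deterministic lower bound and the volume bound apply together, and for
  large d each has probability tending to 0.\<close>

theorem ln_growth_constant_gnp: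
  assumes \<epsilon>: "\<epsilon> > 0"
  shows "\<exists>d0>0. \<forall>d\<ge>d0. (\<lambda>n. measure_pmf.prob (gnp n (d / real n))
           {E. \<bar>ln (growth_constant {1..n} E) - pi\<^sup>2 / (6 * d)\<bar> \<le> \<epsilon> / d}) \<longlonglongrightarrow> 1"
proof -
  obtain \<eta> d1 where \<eta>: "\<eta> > 0" and d1: "d1 > 0"
    and low: "\<And>d (V :: nat set) E. d \<ge> d1 \<Longrightarrow> fin_graph V E \<Longrightarrow> 0 < free_dim V E \<Longrightarrow>
           2 * real (card E) \<le> (1 + \<eta>) * d * real (free_dim V E) \<Longrightarrow>
           pi\<^sup>2 / 6 - \<epsilon> \<le> d * ln (growth_constant V E)"
    using ln_growth_constant_ge[OF \<epsilon>, where ?'a = nat] by blast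
  \<comment> \<open>Capped at 1 so that the square of \<open>\<eta>'\<close> is at most
    \<open>\<eta>'\<close> in the expansion below.\<close>
  define \<eta>' where "\<eta>' = min \<eta> 1"
  have \<eta>': "0 < \<eta>'" "\<eta>' \<le> \<eta>" "\<eta>' \<le> 1" using \<eta> by (auto simp: \<eta>'_def)
  \<comment> \<open>The entry 1/8 is what \<open>ex_profile\<close> requires. The others absorb the
    drop in dimension from n to (1 - 3 \<delta>) n: \<open>\<eta>' / 12\<close> in the edge count,
    the last one in the exponent of the volume.\<close>
  define \<delta> where "\<delta> = Min {1/8, \<eta>' / 12, \<epsilon> / (6 * (pi\<^sup>2 / 6 + \<epsilon>))}"
  have P0: "0 < pi\<^sup>2 / 6 + \<epsilon>" using \<epsilon> by (simp add: add_nonneg_pos)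
  have \<delta>: "0 < \<delta>" "\<delta> \<le> 1/8" "\<delta> \<le> \<eta>' / 12" "\<delta> \<le> \<epsilon> / (6 * (pi\<^sup>2 / 6 + \<epsilon>))"
  proof -
    show "0 < \<delta>" unfolding \<delta>_def using \<eta>' \<epsilon> P0 by (subst Min_gr_iff) auto
  qed (unfold \<delta>_def, (rule Min_le; simp)+)
  have \<delta>1: "1 + \<eta>' / 3 \<le> (1 + \<eta>) * (1 - 3 * \<delta>)"
  proof -
    have "1 + \<eta>' / 3 \<le> (1 + \<eta>') * (1 - \<eta>' / 4)"
    proof -
      have "\<eta>' * \<eta>' \<le> \<eta>'" using \<eta>' mult_left_mono[OF \<eta>'(3), of \<eta>'] by simp
      moreover have "(1 + \<eta>') * (1 - \<eta>' / 4) = 1 + 3 / 4 * \<eta>' - (\<eta>' * \<eta>') / 4" by (simp add: field_simps)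
      ultimately show ?thesis using \<eta>'(1) by linarith
    qed
    also have "\<dots> \<le> (1 + \<eta>) * (1 - 3 * \<delta>)"
      using \<eta>' \<delta> by (intro mult_mono) auto
    finally show ?thesis .
  qed
  have \<delta>2: "pi\<^sup>2 / 6 + \<epsilon> / 2 \<le> (pi\<^sup>2 / 6 + \<epsilon>) * (1 - 3 * \<delta>)"
  proof -
    define P where "P = pi\<^sup>2 / 6 + \<epsilon>"
    have "0 < 6 * P" using P0 by (simp add: P_def)
    moreover have "\<delta> \<le> \<epsilon> / (6 * P)" using \<delta>(4) unfolding P_def .
    ultimately have "\<delta> * (6 * P) \<le> \<epsilon>" by (simp only: pos_le_divide_eq)
    moreover have "P * (1 - 3 * \<delta>) = P - \<delta> * (6 * P) / 2" by (simp add: algebra_simps)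
    ultimately have "P - \<epsilon> / 2 \<le> P * (1 - 3 * \<delta>)" by linarith
    then show ?thesis by (simp add: P_def)
  qed
  have "eventually (\<lambda>d. 4 * exp (- d / 8) < \<epsilon> / 2 / d) at_top" using \<epsilon> by real_asymp
  moreover have "eventually (\<lambda>d. 4 * exp (- (d * \<delta>\<^sup>2)) < 1) at_top"
  proof -
    have "0 < \<delta>\<^sup>2" using \<delta> by simp
    then show ?thesis by real_asymp
  qed
  moreover have "eventually (\<lambda>d. d1 \<le> d) at_top" by (rule eventually_ge_at_top)
  ultimately have "eventually (\<lambda>d. 4 * exp (- d / 8) < \<epsilon> / 2 / d \<and> 4 * exp (- (d * \<delta>\<^sup>2)) < 1 \<and> d1 \<le> d) at_top"
    by eventually_elim auto
  then obtain d0 where d0: "\<And>d. d \<ge> d0 \<Longrightarrow> 4 * exp (- d / 8) < \<epsilon> / 2 / d \<and> 4 * exp (- (d * \<delta>\<^sup>2)) < 1 \<and> d1 \<le> d"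
    by (auto simp: eventually_at_top_linorder)
  have main: "(\<lambda>n. measure_pmf.prob (gnp n (d / real n))
           {E. \<bar>ln (growth_constant {1..n} E) - pi\<^sup>2 / (6 * d)\<bar> \<le> \<epsilon> / d}) \<longlonglongrightarrow> 1" if dge: "d \<ge> d0" for d
  proof -
    have dd: "4 * exp (- d / 8) < \<epsilon> / 2 / d" "4 * exp (- (d * \<delta>\<^sup>2)) < 1" "d1 \<le> d"
      using d0[OF dge] by auto
    have d: "0 < d" using dd d1 by linarith
    define c1 where "c1 = d * ((1 + \<eta>' / 3) * ln (1 + \<eta>' / 3) - \<eta>' / 3) / 2"
    have c1: "0 < c1" unfolding c1_def using d ln_one_plus_times_gt[of "\<eta>' / 3"] \<eta>' by simp
    define c2 where "c2 = \<epsilon> / 2 / d - 4 * exp (- d / 8)"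
    have c2: "0 < c2" using dd by (simp add: c2_def)
    define Good where "Good n = {E. \<bar>ln (growth_constant {1..n} E) - pi\<^sup>2 / (6 * d)\<bar> \<le> \<epsilon> / d}" for n :: nat
    define B1 where "B1 n = {E :: nat set set. (1 + \<eta>' / 3) * d * real n / 2 \<le> real (card E)}" for n
    define B2 where "B2 n = {E. \<not> cut_dense \<delta> n E}" for n
    define B3 where "B3 n = {E. cut_dense \<delta> n E \<and> exp (real n * (pi\<^sup>2 / 6 + \<epsilon> / 2) / d) \<le>
        polytope_volume {1..n} E (chosen_roots {1..n} E)}" for n
    have cover: "E \<in> Good n \<union> B1 n \<union> B2 n \<union> B3 n"
      if E: "E \<in> set_pmf (gnp n (d / real n))" and n: "2 / \<delta> \<le> real n" for E n
    proof (rule ccontr)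
      assume "\<not> ?thesis"
      then have nG: "E \<notin> Good n" and b1: "real (card E) < (1 + \<eta>' / 3) * d * real n / 2"
        and b2: "cut_dense \<delta> n E"
        and b3: "polytope_volume {1..n} E (chosen_roots {1..n} E) < exp (real n * (pi\<^sup>2 / 6 + \<epsilon> / 2) / d)"
        by (auto simp: B1_def B2_def B3_def)
      have G: "fin_graph {1..n} E" using E by (rule fin_graph_gnp)
      define R where "R = chosen_roots {1..n} E"
      have root: "is_root_set {1..n} E R" unfolding R_def by (rule is_root_set_chosen)
      have n\<delta>: "2 \<le> \<delta> * real n" using n \<delta> by (simp add: field_simps)
      have n0: "0 < real n" using n\<delta> \<delta> by (smt (verit) mult_nonneg_nonpos)
      define N where "N = real (free_dim {1..n} E)"
      have "R \<subseteq> {1..n}" using root by (simp add: is_root_set_def)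
      then have "card R + card ({1..n} - R) = n"
        by (metis card_Diff_subset card_atLeastAtMost card_mono diff_Suc_1 finite_atLeastAtMost finite_subset le_add_diff_inverse)
      then have "real (card R) + N = real n"
        unfolding N_def using card_non_roots[OF _ root] by (metis finite_atLeastAtMost of_nat_add)
      \<comment> \<open>Once 2 \<le> \<delta> n, the bound 2 \<delta> n + 2 on the number of roots
        is at most 3 \<delta> n.\<close>
      then have N: "(1 - 3 * \<delta>) * real n \<le> N"
        using cut_dense_card_roots[OF root b2] n\<delta> by (simp add: algebra_simps)
      have "0 < (1 - 3 * \<delta>) * real n" using \<delta> n0 by simp
      then have N0: "0 < N" using N by linarith
      have "2 * real (card E) \<le> (1 + \<eta>' / 3) * (d * real n)" using b1 by simp
      also have "\<dots> \<le> (1 + \<eta>) * (1 - 3 * \<delta>) * (d * real n)"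
        using \<delta>1 d n0 by (intro mult_right_mono) auto
      also have "\<dots> = (1 + \<eta>) * d * ((1 - 3 * \<delta>) * real n)" by simp
      also have "\<dots> \<le> (1 + \<eta>) * d * N" using N \<eta> d by (intro mult_left_mono) auto
      finally have "pi\<^sup>2 / 6 - \<epsilon> \<le> d * ln (growth_constant {1..n} E)"
        using N0 unfolding N_def by (intro low[OF dd(3) G]) auto
      then have lower: "(pi\<^sup>2 / 6 - \<epsilon>) / d \<le> ln (growth_constant {1..n} E)"
        using d by (simp add: pos_divide_le_eq mult.commute)
      have "ln (polytope_volume {1..n} E R) \<le> real n * (pi\<^sup>2 / 6 + \<epsilon> / 2) / d"
        using b3 polytope_volume_ge_1[OF G root] unfolding R_def[symmetric]
        by (subst ln_exp[symmetric], subst ln_le_cancel_iff) auto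
      also have "\<dots> \<le> real n * ((pi\<^sup>2 / 6 + \<epsilon>) * (1 - 3 * \<delta>)) / d"
        using \<delta>2 d n0 by (intro divide_right_mono mult_left_mono) auto
      also have "\<dots> = (pi\<^sup>2 / 6 + \<epsilon>) * ((1 - 3 * \<delta>) * real n) / d" by simp
      also have "\<dots> \<le> (pi\<^sup>2 / 6 + \<epsilon>) * N / d"
        using N P0 d by (intro divide_right_mono mult_left_mono) auto
      finally have "ln (growth_constant {1..n} E) \<le> (pi\<^sup>2 / 6 + \<epsilon>) / d"
        unfolding ln_growth_constant[OF G] R_def[symmetric] N_def[symmetric]
        using N0 by (simp add: pos_divide_le_eq)
      with lower have "E \<in> Good n"
        unfolding Good_def by (simp add: abs_le_iff add_divide_distrib diff_divide_distrib)
      with nG show False ..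
    qed
    define L where "L n = 1 - (exp (- c1 * real n) + (4 * exp (- (d * \<delta>\<^sup>2))) ^ n +
        2 * real n * ((real n)\<^sup>2 + 1) * (real n + 1) * exp (- c2 * real n))" for n
    have "L \<longlonglongrightarrow> 1 - (0 + 0 + 0)"
      unfolding L_def
    proof (intro tendsto_diff tendsto_add tendsto_const)
      show "(\<lambda>n. exp (- c1 * real n)) \<longlonglongrightarrow> 0" using c1 by real_asymp
      show "(\<lambda>n. (4 * exp (- (d * \<delta>\<^sup>2))) ^ n) \<longlonglongrightarrow> 0" using dd(2) by (intro LIMSEQ_power_zero) auto
      show "(\<lambda>n. 2 * real n * ((real n)\<^sup>2 + 1) * (real n + 1) * exp (- c2 * real n)) \<longlonglongrightarrow> 0"
        using c2 by real_asymp
    qed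
    then have L: "L \<longlonglongrightarrow> 1" by simp
    have "eventually (\<lambda>n. L n \<le> measure_pmf.prob (gnp n (d / real n)) (Good n)) sequentially"
    proof -
      have "eventually (\<lambda>n. max (max (2 / \<delta>) (d + 1)) 8 \<le> real n) sequentially"
        by real_asymp
      then show ?thesis
      proof eventually_elim
        case (elim n)
        then have n: "2 / \<delta> \<le> real n" "d < real n" "8 \<le> n" by auto
        let ?M = "gnp n (d / real n)"
        have "1 = measure_pmf.prob ?M (UNIV \<inter> set_pmf ?M)"
          unfolding measure_Int_set_pmf by (simp add: measure_pmf.prob_space[simplified])
        also have "\<dots> \<le> measure_pmf.prob ?M (Good n \<union> B1 n \<union> B2 n \<union> B3 n)"
        proof (rule measure_pmf.finite_measure_mono)
          show "UNIV \<inter> set_pmf ?M \<subseteq> Good n \<union> B1 n \<union> B2 n \<union> B3 n"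
            using cover[OF _ n(1)] by blast
        qed simp
        also have "\<dots> \<le> measure_pmf.prob ?M (Good n \<union> B1 n \<union> B2 n) + measure_pmf.prob ?M (B3 n)"
          by (rule measure_Un_le) auto
        also have "measure_pmf.prob ?M (Good n \<union> B1 n \<union> B2 n) \<le>
            measure_pmf.prob ?M (Good n \<union> B1 n) + measure_pmf.prob ?M (B2 n)"
          by (rule measure_Un_le) auto
        also have "measure_pmf.prob ?M (Good n \<union> B1 n) \<le> measure_pmf.prob ?M (Good n) + measure_pmf.prob ?M (B1 n)"
          by (rule measure_Un_le) auto
        finally have "1 \<le> measure_pmf.prob ?M (Good n) + measure_pmf.prob ?M (B1 n) +
            measure_pmf.prob ?M (B2 n) + measure_pmf.prob ?M (B3 n)" by simp
        moreover have "measure_pmf.prob ?M (B1 n) \<le> exp (- c1 * real n)"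
          unfolding B1_def c1_def using prob_gnp_card_ge[of d n "\<eta>' / 3"] d n \<eta>' by simp
        moreover have "measure_pmf.prob ?M (B2 n) \<le> (4 * exp (- (d * \<delta>\<^sup>2))) ^ n"
          unfolding B2_def using d n \<delta> by (intro prob_gnp_not_cut_dense) auto
        moreover have "measure_pmf.prob ?M (B3 n) \<le>
            2 * real n * ((real n)\<^sup>2 + 1) * (real n + 1) * exp (- c2 * real n)"
          unfolding B3_def c2_def by (rule prob_polytope_volume_ge_exp[OF \<delta>(1,2) d n(2,3)])
        ultimately show ?case unfolding L_def by linarith
      qed
    qed
    then have "(\<lambda>n. measure_pmf.prob (gnp n (d / real n)) (Good n)) \<longlonglongrightarrow> 1"
      by (rule tendsto_sandwich[OF _ _ L tendsto_const]) (simp add: always_eventually)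
    then show ?thesis unfolding Good_def .
  qed
  show ?thesis
  proof (intro exI[of _ "max d0 1"] conjI allI impI)
    fix d assume "max d0 1 \<le> d"
    then show "(\<lambda>n. measure_pmf.prob (gnp n (d / real n))
           {E. \<bar>ln (growth_constant {1..n} E) - pi\<^sup>2 / (6 * d)\<bar> \<le> \<epsilon> / d}) \<longlonglongrightarrow> 1"
      by (intro main) simp
  qed simp
qed

section \<open>From the logarithm to the growth constant itself\<close>

lemma abs_exp_minus_one_minus_le:
  fixes x :: real
  assumes "0 \<le> x" "x \<le> 1"
  shows "\<bar>exp x - 1 - x\<bar> \<le> x\<^sup>2"
  unfolding abs_le_iff using exp_bound[OF assms] exp_ge_add_one_self[of x] zero_le_power2[of x]
  by (intro conjI) linarith+

theorem theorem1p1: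
  shows
    "(\<forall>\<epsilon>>0. \<exists>d0::real. \<forall>d\<ge>d0.
        (\<lambda>n. measure_pmf.prob (gnp n (d / real n))
           {E. \<bar>ln (growth_constant {1..n} E) - pi\<^sup>2 / (6 * d)\<bar> \<le> \<epsilon> / d}) \<longlonglongrightarrow> 1)
     \<and>
     (\<exists>\<delta> :: real \<Rightarrow> real. \<delta> \<in> o[at_top](\<lambda>d. 1 / d) \<and>
        (\<forall>\<^sub>F d in at_top.
          (\<lambda>n. measure_pmf.prob (gnp n (d / real n))
             {E. \<bar>growth_constant {1..n} E - (1 + pi\<^sup>2 / (6 * d))\<bar> \<le> \<delta> d}) \<longlonglongrightarrow> 1))"
proof (rule conjI)
  show "\<forall>\<epsilon>>0. \<exists>d0::real. \<forall>d\<ge>d0.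
        (\<lambda>n. measure_pmf.prob (gnp n (d / real n))
           {E. \<bar>ln (growth_constant {1..n} E) - pi\<^sup>2 / (6 * d)\<bar> \<le> \<epsilon> / d}) \<longlonglongrightarrow> 1"
    using ln_growth_constant_gnp by blast
next
  let ?P = "\<lambda>\<epsilon> d. (\<lambda>n. measure_pmf.prob (gnp n (d / real n))
           {E. \<bar>ln (growth_constant {1..n} E) - pi\<^sup>2 / (6 * d)\<bar> \<le> \<epsilon> / d}) \<longlonglongrightarrow> 1"
  have "\<exists>d0>0. \<forall>d\<ge>d0. ?P (1 / real (Suc m)) d" for m
    by (rule ln_growth_constant_gnp) simp
  then have "\<forall>m. \<exists>d0. \<forall>d\<ge>d0. ?P (1 / real (Suc m)) d" by blast
  from choice[OF this] obtain D where D: "\<And>m d. D m \<le> d \<Longrightarrow> ?P (1 / real (Suc m)) d" by blast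
  \<comment> \<open>A diagonal choice of the accuracy: the largest index \<open>m \<le> d\<close> whose threshold has been passed.\<close>
  define S where "S d = {m. real m \<le> d \<and> D m \<le> d}" for d
  define \<mu> where "\<mu> d = Max (S d)" for d
  have finS: "finite (S d)" for d
  proof (rule finite_subset)
    show "S d \<subseteq> {..nat \<lceil>d\<rceil>}" by (auto simp: S_def) linarith
  qed simp
  have \<mu>S: "\<mu> d \<in> S d" if "0 \<le> d" "D 0 \<le> d" for d
  proof -
    have "0 \<in> S d" using that by (simp add: S_def)
    then show ?thesis unfolding \<mu>_def using finS by (intro Max_in) auto
  qed
  have \<mu>_ge: "m \<le> \<mu> d" if "real m \<le> d" "D m \<le> d" for m d
    unfolding \<mu>_def using that finS by (intro Max_ge) (auto simp: S_def)
  have \<mu>_lim: "filterlim \<mu> at_top at_top"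
    unfolding filterlim_at_top
  proof
    fix m
    show "eventually (\<lambda>d. m \<le> \<mu> d) at_top"
      using eventually_ge_at_top[of "real m"] eventually_ge_at_top[of "D m"]
      by eventually_elim (rule \<mu>_ge)
  qed
  define \<epsilon> where "\<epsilon> d = 1 / real (Suc (\<mu> d))" for d
  have \<epsilon>_lim: "(\<epsilon> \<longlongrightarrow> 0) at_top"
  proof -
    have "(\<lambda>m. 1 / real (Suc m)) \<longlonglongrightarrow> 0" by real_asymp
    from filterlim_compose[OF this \<mu>_lim] show ?thesis unfolding \<epsilon>_def .
  qed
  have \<epsilon>1: "0 < \<epsilon> d" "\<epsilon> d \<le> 1" for d by (auto simp: \<epsilon>_def)
  \<comment> \<open>The first summand is the error of the logarithm. The second, (4 / d)^2, bounds
    the quadratic remainder of exp, because pi^2 / 6 + \<epsilon> d is at most 4.\<close>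
  define \<delta> where "\<delta> d = \<epsilon> d / d + 16 / d\<^sup>2" for d
  have "\<delta> \<in> o[at_top](\<lambda>d. 1 / d)"
  proof (rule smalloI_tendsto)
    have "((\<lambda>d. \<epsilon> d + 16 / d) \<longlongrightarrow> 0 + 0) at_top"
      by (intro tendsto_add \<epsilon>_lim) real_asymp
    moreover have "eventually (\<lambda>d. \<epsilon> d + 16 / d = \<delta> d / (1 / d)) at_top"
      using eventually_gt_at_top[of 0]
      by eventually_elim (simp add: \<delta>_def field_simps power2_eq_square)
    ultimately show "((\<lambda>d. \<delta> d / (1 / d)) \<longlongrightarrow> 0) at_top"
      using tendsto_cong by force
  qed (use eventually_gt_at_top[of "0::real"] in eventually_elim, auto)
  moreover have "\<forall>\<^sub>F d in at_top. (\<lambda>n. measure_pmf.prob (gnp n (d / real n))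
             {E. \<bar>growth_constant {1..n} E - (1 + pi\<^sup>2 / (6 * d))\<bar> \<le> \<delta> d}) \<longlonglongrightarrow> 1"
    \<comment> \<open>From d = 4 on, the logarithm is at most 4 / d \<le> 1, within the range of the
      quadratic estimate.\<close>
    using eventually_ge_at_top[of 4] eventually_ge_at_top[of "D 0"]
  proof eventually_elim
    case (elim d)
    then have "\<mu> d \<in> S d" by (intro \<mu>S) auto
    then have P: "?P (\<epsilon> d) d" unfolding \<epsilon>_def by (intro D) (simp add: S_def)
    have sub: "\<bar>growth_constant {1..n} E - (1 + pi\<^sup>2 / (6 * d))\<bar> \<le> \<delta> d"
      if E: "E \<in> set_pmf (gnp n (d / real n))"
        and ln: "\<bar>ln (growth_constant {1..n} E) - pi\<^sup>2 / (6 * d)\<bar> \<le> \<epsilon> d / d" for n E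
    proof -
      have G: "fin_graph {1..n} E" using E by (rule fin_graph_gnp)
      define x where "x = ln (growth_constant {1..n} E)"
      have ex: "growth_constant {1..n} E = exp x"
        using growth_constant_power(1)[OF G] by (simp add: x_def)
      have x0: "0 \<le> x"
        unfolding x_def ln_growth_constant[OF G]
        using polytope_volume_ge_1[OF G is_root_set_chosen] by simp
      have "pi < 4" by (rule pi_less_4)
      then have "pi\<^sup>2 < 4\<^sup>2" by (intro power_strict_mono) auto
      then have pi2: "pi\<^sup>2 / 6 \<le> 3" by simp
      have "x \<le> pi\<^sup>2 / (6 * d) + \<epsilon> d / d" using ln unfolding x_def by linarith
      also have "\<dots> = (pi\<^sup>2 / 6 + \<epsilon> d) / d" by (simp add: add_divide_distrib)
      also have "\<dots> \<le> 4 / d" using pi2 \<epsilon>1[of d] elim by (intro divide_right_mono) auto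
      finally have x4: "x \<le> 4 / d" .
      moreover have "4 / d \<le> 1" using elim by simp
      ultimately have x1: "x \<le> 1" by linarith
      have "\<bar>exp x - 1 - x\<bar> \<le> x\<^sup>2" by (rule abs_exp_minus_one_minus_le[OF x0 x1])
      also have "\<dots> \<le> (4 / d)\<^sup>2" using x0 x4 by (intro power_mono) auto
      also have "\<dots> = 16 / d\<^sup>2" by (simp add: power_divide)
      finally have "\<bar>exp x - 1 - x\<bar> \<le> 16 / d\<^sup>2" .
      moreover have "\<bar>x - pi\<^sup>2 / (6 * d)\<bar> \<le> \<epsilon> d / d" using ln unfolding x_def .
      ultimately show ?thesis unfolding ex \<delta>_def by linarith
    qed
    have mono: "measure_pmf.prob (gnp n (d / real n))
          {E. \<bar>ln (growth_constant {1..n} E) - pi\<^sup>2 / (6 * d)\<bar> \<le> \<epsilon> d / d} \<le>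
        measure_pmf.prob (gnp n (d / real n))
          {E. \<bar>growth_constant {1..n} E - (1 + pi\<^sup>2 / (6 * d))\<bar> \<le> \<delta> d}" (is "measure_pmf.prob ?M ?A \<le> measure_pmf.prob ?M ?B") for n
    proof -
      have "measure_pmf.prob ?M ?A = measure_pmf.prob ?M (?A \<inter> set_pmf ?M)"
        by (simp only: measure_Int_set_pmf)
      also have "\<dots> \<le> measure_pmf.prob ?M ?B"
        using sub by (intro measure_pmf.finite_measure_mono) auto
      finally show ?thesis .
    qed
    show ?case
      by (rule tendsto_sandwich[OF _ _ P tendsto_const]) (use mono in \<open>auto intro!: always_eventually\<close>)
  qed
  ultimately show "\<exists>\<delta> :: real \<Rightarrow> real. \<delta> \<in> o[at_top](\<lambda>d. 1 / d) \<and>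
        (\<forall>\<^sub>F d in at_top.
          (\<lambda>n. measure_pmf.prob (gnp n (d / real n))
             {E. \<bar>growth_constant {1..n} E - (1 + pi\<^sup>2 / (6 * d))\<bar> \<le> \<delta> d}) \<longlonglongrightarrow> 1)"
    by blast
qed

end
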